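(* Let $G$ be a discrete group. Let $(T_t)_{t\geq0}$ be a weak* continuous semigroup of selfadjoint $\tau_G$-Markov Fourier multipliers on the von Neumann algebra $\mathrm{VN}(G)$. Then the semigroup $(T_t)_{t\geq0}$ is dilatable.
   Context: Fourier multipliers. For a discrete group $G$ with neutral element $e$, let $\lambda_s\colon\ell^2_G\to\ell^2_G$ denote left translation by $s\in G$, and let $\mathrm{VN}(G)$ be the von Neumann algebra generated by the $\lambda_s$, $s\in G$, equipped with its canonical normal faithful normalized trace $\tau_G(x)=\langle\epsilon_e,x(\epsilon_e)\rangle_{\ell^2_G}$, where $(\epsilon_s)_{s\in G}$ is the canonical basis of $\ell^2_G$. A Fourier multiplier is a normal linear map $T\colon\mathrm{VN}(G)\to\mathrm{VN}(G)$ for which there is a function $s\mapsto a_s$, $G\to\mathbb{C}$, with $T(\lambda_s)=a_s\lambda_s$ for all $s\in G$. Markov maps. Let $(M,\phi)$ and $(N,\psi)$ be von Neumann algebras equipped with normal faithful states. A linear map $T\colon M\to N$ is a $(\phi,\psi)$-Markov map if (1) $T$ is completely positive; (2) $T$ is unital; (3) $\psi\circ T=\phi$; (4) $T\circ\sigma_t^{\phi}=\sigma_t^{\psi}\circ T$ for all $t\in\mathbb{R}$, where $(\sigma^\phi_t)$ and $(\sigma^\psi_t)$ are the modular automorphism groups. A $\phi$-Markov map is a $(\phi,\phi)$-Markov map $M\to M$. Adjoint. For a $(\phi,\psi)$-Markov map $T$ there is a unique linear map $T^*\colon N\to M$ with $\phi(T^*(y)x)=\psi(yT(x))$ for all $x\in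 M$, $y\in N$. A $\phi$-Markov map $T$ is selfadjoint if $T=T^*$. If $J\colon M\to N$ is a $(\phi,\psi)$-Markov $*$-monomorphism, then $\mathbb{E}:=J^*\colon N\to M$ is the canonical faithful normal state-preserving conditional expectation associated with $J$. Weak* continuity. A semigroup $(T_t)_{t\ge 0}$ (with $T_0=\mathrm{Id}$) on $M$ is weak* continuous if $t\mapsto\langle y,T_t(x)\rangle_{M_*,M}$ is continuous for all $x\in M$, $y\in M_*$; similarly for groups indexed by $\mathbb{R}$. Dilatable semigroup. A weak* continuous semigroup $(T_t)_{t\ge0}$ of $\phi$-Markov maps on $M$ is dilatable if there exist a von Neumann algebra $N$ equipped with a normal faithful state $\psi$, a weak* continuous group $(U_t)_{t\in\mathbb{R}}$ of $*$-automorphisms of $N$ leaving $\psi$ invariant, and a $(\phi,\psi)$-Markov $*$-monomorphism $J\colon M\to N$ such that $T_t=\mathbb{E}U_tJ$ for all $t\ge0$, where $\mathbb{E}=J^*\colon N\to M$. *)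

theory Defs
  imports "HOL-Analysis.Analysis" "HOL-Library.Nonpos_Ints"
begin

section \<open>Complex Hilbert spaces\<close>

text \<open>The inner product is antilinear in the first and linear in the second argument; its real
  part is the real inner product of the library.\<close>

class chilbert_space = real_inner + complete_space +
  fixes scaleC :: "complex \<Rightarrow> 'a \<Rightarrow> 'a" (infixr "*\<^sub>C" 75)
    and cinner :: "'a \<Rightarrow> 'a \<Rightarrow> complex"
  assumes scaleR_scaleC: "r *\<^sub>R x = complex_of_real r *\<^sub>C x"
    and scaleC_add_right: "c *\<^sub>C (x + y) = c *\<^sub>C x + c *\<^sub>C y"
    and scaleC_add_left: "(c + d) *\<^sub>C x = c *\<^sub>C x + d *\<^sub>C x"
    and scaleC_scaleC: "c *\<^sub>C d *\<^sub>C x = (c * d) *\<^sub>C x"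
    and cinner_commute: "cinner x y = cnj (cinner y x)"
    and cinner_add_right: "cinner x (y + z) = cinner x y + cinner x z"
    and cinner_scaleC_right: "cinner x (c *\<^sub>C y) = c * cinner x y"
    and inner_Re_cinner: "inner x y = Re (cinner x y)"

lemma cinner_scaleC_left:
  fixes x y :: "'a::chilbert_space"
  shows "cinner (c *\<^sub>C x) y = cnj c * cinner x y"
  using cinner_commute[of "c *\<^sub>C x" y] cinner_commute[of x y] by (simp add: cinner_scaleC_right)

lemma norm_scaleC:
  fixes x :: "'a::chilbert_space"
  shows "norm (c *\<^sub>C x) = cmod c * norm x"
proof -
  have c: "cnj c * c = complex_of_real ((cmod c)\<^sup>2)"
    using complex_norm_square[of c] by (simp add: mult.commute)
  have "(norm (c *\<^sub>C x))\<^sup>2 = Re ((cnj c * c) * cinner x x)"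
    by (simp add: power2_norm_eq_inner inner_Re_cinner cinner_scaleC_left cinner_scaleC_right ac_simps
        del: times_complex.sel)
  also have "\<dots> = (cmod c)\<^sup>2 * (norm x)\<^sup>2"
    unfolding c by (simp add: power2_norm_eq_inner inner_Re_cinner del: of_real_power)
  finally show ?thesis
    by (metis norm_ge_zero power2_eq_iff_nonneg power_mult_distrib zero_le_mult_iff)
qed


section \<open>The Hilbert space of square summable families\<close>

typedef 'i ell2 = "{f :: 'i \<Rightarrow> complex. (\<lambda>i. (cmod (f i))\<^sup>2) summable_on UNIV}"
  by (rule exI[of _ "\<lambda>_. 0"]) simp

setup_lifting type_definition_ell2

lemma square_summable_mult:
  fixes f g :: "'i \<Rightarrow> complex"
  assumes "(\<lambda>i. (cmod (f i))\<^sup>2) summable_on UNIV" "(\<lambda>i. (cmod (g i))\<^sup>2) summable_on UNIV"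
  shows "(\<lambda>i. cnj (f i) * g i) summable_on UNIV"
proof -
  have "(\<lambda>i. cmod (cnj (f i) * g i)) summable_on UNIV"
  proof (rule summable_on_comparison_test)
    show "(\<lambda>i. (cmod (f i))\<^sup>2 + (cmod (g i))\<^sup>2) summable_on UNIV"
      by (intro summable_on_add assms)
    show "cmod (cnj (f i) * g i) \<le> (cmod (f i))\<^sup>2 + (cmod (g i))\<^sup>2" for i
      using sum_squares_bound[of "cmod (f i)" "cmod (g i)"]
        mult_nonneg_nonneg[OF norm_ge_zero[of "f i"] norm_ge_zero[of "g i"]]
      unfolding norm_mult complex_mod_cnj by linarith
  qed simp
  then show ?thesis by (rule abs_summable_summable)
qed

lemma square_summable_add:
  fixes f g :: "'i \<Rightarrow> complex"
  assumes "(\<lambda>i. (cmod (f i))\<^sup>2) summable_on UNIV" "(\<lambda>i. (cmod (g i))\<^sup>2) summable_on UNIV"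
  shows "(\<lambda>i. (cmod (f i + g i))\<^sup>2) summable_on UNIV"
proof (rule summable_on_comparison_test)
  show "(\<lambda>i. 2 * (cmod (f i))\<^sup>2 + 2 * (cmod (g i))\<^sup>2) summable_on UNIV"
    by (intro summable_on_add summable_on_cmult_right assms)
  show "(cmod (f i + g i))\<^sup>2 \<le> 2 * (cmod (f i))\<^sup>2 + 2 * (cmod (g i))\<^sup>2" for i
  proof -
    have "(cmod (f i + g i))\<^sup>2 \<le> (cmod (f i) + cmod (g i))\<^sup>2"
      by (intro power_mono norm_triangle_ineq) simp
    also have "\<dots> \<le> 2 * (cmod (f i))\<^sup>2 + 2 * (cmod (g i))\<^sup>2"
      using sum_squares_bound[of "cmod (f i)" "cmod (g i)"] by (simp add: power2_sum)
    finally show ?thesis .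
  qed
qed simp

lemma square_summable_scale:
  fixes f :: "'i \<Rightarrow> complex"
  assumes "(\<lambda>i. (cmod (f i))\<^sup>2) summable_on UNIV"
  shows "(\<lambda>i. (cmod (c * f i))\<^sup>2) summable_on UNIV"
  using summable_on_cmult_right[OF assms, of "(cmod c)\<^sup>2"] by (simp add: norm_mult power_mult_distrib)

instantiation ell2 :: (type) real_vector
begin

lift_definition zero_ell2 :: "'a ell2" is "\<lambda>_. 0" by simp
lift_definition plus_ell2 :: "'a ell2 \<Rightarrow> 'a ell2 \<Rightarrow> 'a ell2" is "\<lambda>f g i. f i + g i"
  by (rule square_summable_add)
lift_definition uminus_ell2 :: "'a ell2 \<Rightarrow> 'a ell2" is "\<lambda>f i. - f i" by simp
lift_definition minus_ell2 :: "'a ell2 \<Rightarrow> 'a ell2 \<Rightarrow> 'a ell2" is "\<lambda>f g i. f i - g i"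
  subgoal for f g using square_summable_add[of f "\<lambda>i. - g i"] by simp
  done
lift_definition scaleR_ell2 :: "real \<Rightarrow> 'a ell2 \<Rightarrow> 'a ell2" is "\<lambda>r f i. complex_of_real r * f i"
  by (rule square_summable_scale)

instance
proof
  fix x y z :: "'a ell2" and r s :: real
  show "x + y + z = x + (y + z)" by transfer (simp add: add.assoc)
  show "x + y = y + x" by transfer (simp add: add.commute)
  show "0 + x = x" by transfer simp
  show "- x + x = 0" by transfer simp
  show "x - y = x + - y" by transfer simp
  show "r *\<^sub>R (x + y) = r *\<^sub>R x + r *\<^sub>R y" by transfer (simp add: ring_distribs)
  show "(r + s) *\<^sub>R x = r *\<^sub>R x + s *\<^sub>R x" by transfer (simp add: ring_distribs)
  show "r *\<^sub>R s *\<^sub>R x = (r * s) *\<^sub>R x" by transfer (simp add: mult.assoc)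
  show "1 *\<^sub>R x = x" by transfer simp
qed

end

instantiation ell2 :: (type) real_inner
begin

lift_definition inner_ell2 :: "'a ell2 \<Rightarrow> 'a ell2 \<Rightarrow> real" is "\<lambda>f g. Re (\<Sum>\<^sub>\<infinity>i. cnj (f i) * g i)" .

definition "norm_ell2 (x :: 'a ell2) = sqrt (inner x x)"
definition "sgn_ell2 (x :: 'a ell2) = scaleR (inverse (norm x)) x"
definition "dist_ell2 (x :: 'a ell2) y = norm (x - y)"
definition
  "(uniformity :: ('a ell2 \<times> 'a ell2) filter) = (INF e\<in>{0 <..}. principal {(x, y). dist x y < e})"
definition
  "open (S :: 'a ell2 set) = (\<forall>x\<in>S. \<forall>\<^sub>F (x', y) in uniformity. x' = x \<longrightarrow> y \<in> S)"

lemma inner_self_ell2: "inner x x = (\<Sum>\<^sub>\<infinity>i. (cmod (Rep_ell2 x i))\<^sup>2)"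
proof -
  have "(\<lambda>i. cnj (Rep_ell2 x i) * Rep_ell2 x i) summable_on UNIV"
    using Rep_ell2[of x] by (intro square_summable_mult) auto
  then have "inner x x = (\<Sum>\<^sub>\<infinity>i. Re (cnj (Rep_ell2 x i) * Rep_ell2 x i))"
    by (simp only: inner_ell2.rep_eq infsum_Re)
  then show ?thesis by (simp add: cmod_power2 flip: power2_eq_square)
qed

instance
proof
  fix x y z :: "'a ell2" and r :: real
  show "sgn x = x /\<^sub>R norm x" by (rule sgn_ell2_def)
  show "dist x y = norm (x - y)" by (rule dist_ell2_def)
  show "(uniformity :: ('a ell2 \<times> 'a ell2) filter) = (INF e\<in>{0 <..}. principal {(x, y). dist x y < e})"
    by (rule uniformity_ell2_def)
  show "open U = (\<forall>x\<in>U. \<forall>\<^sub>F (x', y) in uniformity. x' = x \<longrightarrow> y \<in> U)" for U :: "'a ell2 set"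
    by (rule open_ell2_def)
  show "norm x = sqrt (inner x x)" by (rule norm_ell2_def)
  show "inner x y = inner y x"
  proof transfer
    fix f g :: "'a \<Rightarrow> complex"
    have "(\<Sum>\<^sub>\<infinity>i. cnj (f i) * g i) = cnj (\<Sum>\<^sub>\<infinity>i. cnj (g i) * f i)"
      unfolding infsum_cnj[symmetric] by (simp add: mult.commute)
    then show "Re (\<Sum>\<^sub>\<infinity>i. cnj (f i) * g i) = Re (\<Sum>\<^sub>\<infinity>i. cnj (g i) * f i)" by simp
  qed
  show "inner (x + y) z = inner x z + inner y z"
    by transfer (simp add: ring_distribs infsum_add square_summable_mult)
  show "inner (r *\<^sub>R x) y = r * inner x y"
    by transfer (simp add: mult.assoc infsum_cmult_right square_summable_mult)
  show "0 \<le> inner x x" by (simp add: inner_self_ell2 infsum_nonneg)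
  show "inner x x = 0 \<longleftrightarrow> x = 0"
  proof
    assume "inner x x = 0"
    then have "(\<Sum>\<^sub>\<infinity>i. (cmod (Rep_ell2 x i))\<^sup>2) \<le> 0" by (simp only: inner_self_ell2)
    moreover have "(\<lambda>i. (cmod (Rep_ell2 x i))\<^sup>2) summable_on UNIV" using Rep_ell2[of x] by simp
    ultimately have "(cmod (Rep_ell2 x i))\<^sup>2 = 0" for i
      by (rule nonneg_infsum_le_0D) simp_all
    then have "Rep_ell2 x = (\<lambda>_. 0)" by auto
    then show "x = 0" by transfer
  next
    assume "x = 0"
    then show "inner x x = 0" by (simp add: inner_self_ell2 zero_ell2.rep_eq)
  qed
qed

end

lemma norm_ell2_square: "(norm x)\<^sup>2 = (\<Sum>\<^sub>\<infinity>i. (cmod (Rep_ell2 x i))\<^sup>2)"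
  by (simp add: power2_norm_eq_inner inner_self_ell2)

lemma finite_sum_le_norm_ell2:
  "finite F \<Longrightarrow> (\<Sum>i\<in>F. (cmod (Rep_ell2 x i))\<^sup>2) \<le> (norm x)\<^sup>2"
  unfolding norm_ell2_square using Rep_ell2[of x] by (intro finite_sum_le_infsum) auto

lemma cmod_Rep_le_norm_ell2: "cmod (Rep_ell2 x i) \<le> norm x"
  by (rule power2_le_imp_le) (use finite_sum_le_norm_ell2[of "{i}" x] in simp_all)

instance ell2 :: (type) complete_space
proof
  fix X :: "nat \<Rightarrow> 'a ell2"
  assume cauchy: "Cauchy X"
  have "Cauchy (\<lambda>n. Rep_ell2 (X n) i)" for i
  proof (rule CauchyI)
    fix e :: real assume "e > 0"
    then obtain M where M: "\<And>m n. m \<ge> M \<Longrightarrow> n \<ge> M \<Longrightarrow> norm (X m - X n) < e"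
      using CauchyD[OF cauchy] by blast
    have "norm (Rep_ell2 (X m) i - Rep_ell2 (X n) i) < e" if "m \<ge> M" "n \<ge> M" for m n
      using cmod_Rep_le_norm_ell2[of "X m - X n" i] M[OF that] by (simp add: minus_ell2.rep_eq)
    then show "\<exists>M. \<forall>m\<ge>M. \<forall>n\<ge>M. norm (Rep_ell2 (X m) i - Rep_ell2 (X n) i) < e" by blast
  qed
  then obtain f where f: "\<And>i. (\<lambda>n. Rep_ell2 (X n) i) \<longlonglongrightarrow> f i"
    unfolding Cauchy_convergent_iff convergent_def by metis
  have bound: "(\<Sum>i\<in>F. (cmod (Rep_ell2 (X m) i - f i))\<^sup>2) \<le> e\<^sup>2"
    if "finite F" "e > 0" "\<And>n. n \<ge> M \<Longrightarrow> norm (X m - X n) < e" for F e m M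
  proof (rule tendsto_upperbound)
    show "(\<lambda>n. \<Sum>i\<in>F. (cmod (Rep_ell2 (X m) i - Rep_ell2 (X n) i))\<^sup>2)
        \<longlonglongrightarrow> (\<Sum>i\<in>F. (cmod (Rep_ell2 (X m) i - f i))\<^sup>2)"
      by (intro tendsto_intros f)
    show "\<forall>\<^sub>F n in sequentially. (\<Sum>i\<in>F. (cmod (Rep_ell2 (X m) i - Rep_ell2 (X n) i))\<^sup>2) \<le> e\<^sup>2"
      using eventually_ge_at_top[of M]
    proof eventually_elim
      case (elim n)
      have "(\<Sum>i\<in>F. (cmod (Rep_ell2 (X m) i - Rep_ell2 (X n) i))\<^sup>2) \<le> (norm (X m - X n))\<^sup>2"
        using finite_sum_le_norm_ell2[OF \<open>finite F\<close>, of "X m - X n"] by (simp add: minus_ell2.rep_eq)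
      also have "\<dots> \<le> e\<^sup>2" using that(3)[OF elim] by (intro power_mono) auto
      finally show ?case .
    qed
  qed simp
  have diff: "(\<lambda>i. (cmod (Rep_ell2 (X m) i - f i))\<^sup>2) summable_on UNIV"
    if "e > 0" "\<And>n. n \<ge> M \<Longrightarrow> norm (X m - X n) < e" for e m M
  proof (rule nonneg_bdd_above_summable_on)
    show "bdd_above (sum (\<lambda>i. (cmod (Rep_ell2 (X m) i - f i))\<^sup>2) ` {F. F \<subseteq> UNIV \<and> finite F})"
      by (rule bdd_aboveI2[of _ _ "e\<^sup>2"], rule bound[OF _ that]) auto
  qed simp
  obtain M1 where M1: "\<And>m n. m \<ge> M1 \<Longrightarrow> n \<ge> M1 \<Longrightarrow> norm (X m - X n) < 1"
    using CauchyD[OF cauchy zero_less_one] by blast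
  have "(\<lambda>i. (cmod (f i))\<^sup>2) summable_on UNIV"
  proof -
    have "(\<lambda>i. (cmod (Rep_ell2 (X M1) i - f i))\<^sup>2) summable_on UNIV"
      by (rule diff[of 1 M1]) (use M1 in auto)
    from square_summable_add[OF square_summable_scale[OF this, of "-1"], of "Rep_ell2 (X M1)"]
    show ?thesis using Rep_ell2[of "X M1"] by simp
  qed
  then obtain x where x: "Rep_ell2 x = f" by (metis Abs_ell2_inverse mem_Collect_eq)
  have "X \<longlonglongrightarrow> x"
  proof (rule LIMSEQ_I)
    fix r :: real assume "r > 0"
    then obtain M where M: "\<And>m n. m \<ge> M \<Longrightarrow> n \<ge> M \<Longrightarrow> norm (X m - X n) < r / 2"
      using CauchyD[OF cauchy half_gt_zero] by blast
    have "norm (X m - x) < r" if m: "m \<ge> M" for m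
    proof -
      have hyp: "\<And>n. n \<ge> M \<Longrightarrow> norm (X m - X n) < r / 2" using M m by blast
      have "r / 2 > 0" using \<open>r > 0\<close> by simp
      have "(norm (X m - x))\<^sup>2 \<le> (r / 2)\<^sup>2"
        unfolding norm_ell2_square minus_ell2.rep_eq x
      proof (rule infsum_le_finite_sums)
        show "(\<lambda>i. (cmod (Rep_ell2 (X m) i - f i))\<^sup>2) summable_on UNIV"
          by (rule diff[OF \<open>r / 2 > 0\<close> hyp])
        show "(\<Sum>i\<in>F. (cmod (Rep_ell2 (X m) i - f i))\<^sup>2) \<le> (r / 2)\<^sup>2" if "finite F" for F
          by (rule bound[OF that \<open>r / 2 > 0\<close> hyp])
      qed
      then have "norm (X m - x) \<le> r / 2"
        by (rule power2_le_imp_le) (use \<open>r > 0\<close> in simp)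
      then show ?thesis using \<open>r > 0\<close> by simp
    qed
    then show "\<exists>no. \<forall>n\<ge>no. norm (X n - x) < r" by blast
  qed
  then show "convergent X" by (auto simp: convergent_def)
qed

instantiation ell2 :: (type) chilbert_space
begin

lift_definition scaleC_ell2 :: "complex \<Rightarrow> 'a ell2 \<Rightarrow> 'a ell2" is "\<lambda>c f i. c * f i"
  by (rule square_summable_scale)
lift_definition cinner_ell2 :: "'a ell2 \<Rightarrow> 'a ell2 \<Rightarrow> complex" is "\<lambda>f g. \<Sum>\<^sub>\<infinity>i. cnj (f i) * g i" .

instance
proof
  fix x y z :: "'a ell2" and c d :: complex and r :: real
  show "r *\<^sub>R x = complex_of_real r *\<^sub>C x" by transfer simp
  show "c *\<^sub>C (x + y) = c *\<^sub>C x + c *\<^sub>C y" by transfer (simp add: ring_distribs)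
  show "(c + d) *\<^sub>C x = c *\<^sub>C x + d *\<^sub>C x" by transfer (simp add: ring_distribs)
  show "c *\<^sub>C d *\<^sub>C x = (c * d) *\<^sub>C x" by transfer (simp add: mult.assoc)
  show "cinner x y = cnj (cinner y x)"
  proof transfer
    fix f g :: "'a \<Rightarrow> complex"
    show "(\<Sum>\<^sub>\<infinity>i. cnj (f i) * g i) = cnj (\<Sum>\<^sub>\<infinity>i. cnj (g i) * f i)"
      unfolding infsum_cnj[symmetric] by (simp add: mult.commute)
  qed
  show "cinner x (y + z) = cinner x y + cinner x z"
    by transfer (simp add: ring_distribs infsum_add square_summable_mult)
  show "cinner x (c *\<^sub>C y) = c * cinner x y"
    by transfer (simp add: mult.left_commute infsum_cmult_right square_summable_mult)
  show "inner x y = Re (cinner x y)" by transfer simp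
qed

end

lift_definition basis_vector :: "'i \<Rightarrow> 'i ell2" is "\<lambda>s i. if i = s then 1 else 0"
proof -
  fix s :: 'i
  have "(\<lambda>i. (cmod (if i = s then 1 else 0))\<^sup>2) summable_on {s}" by simp
  then show "(\<lambda>i. (cmod (if i = s then 1 else 0))\<^sup>2) summable_on UNIV"
    by (rule summable_on_cong_neutral[THEN iffD1, rotated 3]) auto
qed


section \<open>Bounded operators and von Neumann algebras\<close>

text \<open>The library type of bounded operators contains all real-linear operators;
  the complex-linear ones form the following set.\<close>

definition bounded_operators :: "('h::chilbert_space \<Rightarrow>\<^sub>L 'h) set" where
  "bounded_operators = {x. \<forall>c v. blinfun_apply x (c *\<^sub>C v) = c *\<^sub>C blinfun_apply x v}"

lift_definition scale_operator ::
  "complex \<Rightarrow> ('h::chilbert_space \<Rightarrow>\<^sub>L 'h) \<Rightarrow> 'h \<Rightarrow>\<^sub>L 'h" is "\<lambda>c x v. c *\<^sub>C x v"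
proof -
  fix c and x :: "'h \<Rightarrow> 'h"
  assume "bounded_linear x"
  then interpret x: bounded_linear x .
  show "bounded_linear (\<lambda>v. c *\<^sub>C x v)"
  proof
    show "c *\<^sub>C x (u + v) = c *\<^sub>C x u + c *\<^sub>C x v" for u v
      by (simp add: x.add scaleC_add_right)
    show "c *\<^sub>C x (r *\<^sub>R v) = r *\<^sub>R c *\<^sub>C x v" for r v
      unfolding x.scaleR by (simp add: scaleR_scaleC scaleC_scaleC mult.commute)
    obtain K where "\<And>v. norm (x v) \<le> norm v * K" using x.bounded by blast
    then have "norm (c *\<^sub>C x v) \<le> norm v * (cmod c * K)" for v
      by (metis norm_scaleC norm_ge_zero mult_left_mono mult.left_commute)
    then show "\<exists>K. \<forall>v. norm (c *\<^sub>C x v) \<le> norm v * K" by blast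
  qed
qed

text \<open>Meant for \<open>x\<close> in \<open>bounded_operators\<close>, where existence is the Riesz representation theorem.\<close>

definition adjoint_operator :: "('h::chilbert_space \<Rightarrow>\<^sub>L 'h) \<Rightarrow> 'h \<Rightarrow>\<^sub>L 'h" where
  "adjoint_operator x =
    (THE y. \<forall>v w. cinner (blinfun_apply y v) w = cinner v (blinfun_apply x w))"

definition commutant :: "('h::chilbert_space \<Rightarrow>\<^sub>L 'h) set \<Rightarrow> ('h \<Rightarrow>\<^sub>L 'h) set" where
  "commutant S = {x \<in> bounded_operators. \<forall>y\<in>S. x o\<^sub>L y = y o\<^sub>L x}"

definition von_neumann_algebra :: "('h::chilbert_space \<Rightarrow>\<^sub>L 'h) set \<Rightarrow> bool" where
  "von_neumann_algebra M \<longleftrightarrow> M \<subseteq> bounded_operators \<and> (\<forall>x\<in>M. adjoint_operator x \<in> M) \<and>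
    commutant (commutant M) = M"

definition generated_vna :: "('h::chilbert_space \<Rightarrow>\<^sub>L 'h) set \<Rightarrow> ('h \<Rightarrow>\<^sub>L 'h) set" where
  "generated_vna S = \<Inter>{M. von_neumann_algebra M \<and> S \<subseteq> M}"

text \<open>In what follows, functionals and maps on a von Neumann algebra \<open>M\<close> are functions on the
  ambient operator type of which only the values on \<open>M\<close> matter.\<close>

definition linear_on_vna ::
  "('h::chilbert_space \<Rightarrow>\<^sub>L 'h) set \<Rightarrow> (('h \<Rightarrow>\<^sub>L 'h) \<Rightarrow> ('k::chilbert_space \<Rightarrow>\<^sub>L 'k)) \<Rightarrow> bool" where
  "linear_on_vna M T \<longleftrightarrow> (\<forall>x\<in>M. \<forall>y\<in>M. T (x + y) = T x + T y) \<and>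
    (\<forall>c. \<forall>x\<in>M. T (scale_operator c x) = scale_operator c (T x))"

text \<open>The predual \<open>M\<^sub>*\<close>: the sigma-weakly continuous functionals on \<open>M\<close>.\<close>

definition predual :: "('h::chilbert_space \<Rightarrow>\<^sub>L 'h) set \<Rightarrow> (('h \<Rightarrow>\<^sub>L 'h) \<Rightarrow> complex) set" where
  "predual M = {\<omega>. \<exists>\<xi> \<eta> :: nat \<Rightarrow> 'h.
     summable (\<lambda>n. (norm (\<xi> n))\<^sup>2) \<and> summable (\<lambda>n. (norm (\<eta> n))\<^sup>2) \<and>
     (\<forall>x\<in>M. \<omega> x = (\<Sum>n. cinner (\<xi> n) (blinfun_apply x (\<eta> n))))}"

definition normal_map :: "('h::chilbert_space \<Rightarrow>\<^sub>L 'h) set \<Rightarrow> ('k::chilbert_space \<Rightarrow>\<^sub>L 'k) set \<Rightarrow>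
    (('h \<Rightarrow>\<^sub>L 'h) \<Rightarrow> ('k \<Rightarrow>\<^sub>L 'k)) \<Rightarrow> bool" where
  "normal_map M N T \<longleftrightarrow> T \<in> M \<rightarrow> N \<and> linear_on_vna M T \<and> (\<forall>\<omega>\<in>predual N. \<omega> \<circ> T \<in> predual M)"

definition normal_faithful_state ::
  "('h::chilbert_space \<Rightarrow>\<^sub>L 'h) set \<Rightarrow> (('h \<Rightarrow>\<^sub>L 'h) \<Rightarrow> complex) \<Rightarrow> bool" where
  "normal_faithful_state M \<phi> \<longleftrightarrow> \<phi> \<in> predual M \<and> \<phi> id_blinfun = 1 \<and>
    (\<forall>x\<in>M. \<phi> (adjoint_operator x o\<^sub>L x) \<in> \<real>\<^sub>\<ge>\<^sub>0) \<and>
    (\<forall>x\<in>M. \<phi> (adjoint_operator x o\<^sub>L x) = 0 \<longrightarrow> x = 0)"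

definition star_homomorphism :: "('h::chilbert_space \<Rightarrow>\<^sub>L 'h) set \<Rightarrow> ('k::chilbert_space \<Rightarrow>\<^sub>L 'k) set \<Rightarrow>
    (('h \<Rightarrow>\<^sub>L 'h) \<Rightarrow> ('k \<Rightarrow>\<^sub>L 'k)) \<Rightarrow> bool" where
  "star_homomorphism M N \<pi> \<longleftrightarrow> \<pi> \<in> M \<rightarrow> N \<and> linear_on_vna M \<pi> \<and>
    (\<forall>x\<in>M. \<forall>y\<in>M. \<pi> (x o\<^sub>L y) = \<pi> x o\<^sub>L \<pi> y) \<and>
    (\<forall>x\<in>M. \<pi> (adjoint_operator x) = adjoint_operator (\<pi> x))"

definition star_automorphism ::
  "('h::chilbert_space \<Rightarrow>\<^sub>L 'h) set \<Rightarrow> (('h \<Rightarrow>\<^sub>L 'h) \<Rightarrow> ('h \<Rightarrow>\<^sub>L 'h)) \<Rightarrow> bool" where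
  "star_automorphism M \<alpha> \<longleftrightarrow> star_homomorphism M M \<alpha> \<and> bij_betw \<alpha> M M"


section \<open>Weak* continuous semigroups and groups\<close>

definition weak_star_continuous_semigroup ::
  "('h::chilbert_space \<Rightarrow>\<^sub>L 'h) set \<Rightarrow> (real \<Rightarrow> ('h \<Rightarrow>\<^sub>L 'h) \<Rightarrow> ('h \<Rightarrow>\<^sub>L 'h)) \<Rightarrow> bool" where
  "weak_star_continuous_semigroup M T \<longleftrightarrow>
    (\<forall>t\<ge>0. T t \<in> M \<rightarrow> M \<and> linear_on_vna M (T t)) \<and>
    (\<forall>x\<in>M. T 0 x = x) \<and>
    (\<forall>s\<ge>0. \<forall>t\<ge>0. \<forall>x\<in>M. T (s + t) x = T s (T t x)) \<and>
    (\<forall>x\<in>M. \<forall>\<omega>\<in>predual M. continuous_on {0..} (\<lambda>t. \<omega> (T t x)))"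

definition weak_star_continuous_automorphism_group ::
  "('h::chilbert_space \<Rightarrow>\<^sub>L 'h) set \<Rightarrow> (real \<Rightarrow> ('h \<Rightarrow>\<^sub>L 'h) \<Rightarrow> ('h \<Rightarrow>\<^sub>L 'h)) \<Rightarrow> bool" where
  "weak_star_continuous_automorphism_group M U \<longleftrightarrow>
    (\<forall>t. star_automorphism M (U t)) \<and>
    (\<forall>x\<in>M. U 0 x = x) \<and>
    (\<forall>s t. \<forall>x\<in>M. U (s + t) x = U s (U t x)) \<and>
    (\<forall>x\<in>M. \<forall>\<omega>\<in>predual M. continuous_on UNIV (\<lambda>t. \<omega> (U t x)))"

definition leaves_invariant :: "('h::chilbert_space \<Rightarrow>\<^sub>L 'h) set \<Rightarrow>
    (('h \<Rightarrow>\<^sub>L 'h) \<Rightarrow> complex) \<Rightarrow> (real \<Rightarrow> ('h \<Rightarrow>\<^sub>L 'h) \<Rightarrow> ('h \<Rightarrow>\<^sub>L 'h)) \<Rightarrow> bool" where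
  "leaves_invariant M \<phi> U \<longleftrightarrow> (\<forall>t. \<forall>x\<in>M. \<phi> (U t x) = \<phi> x)"

text \<open>The modular automorphism group of a normal faithful state, in the sense of Takesaki's
  theorem: the unique (on \<open>M\<close>) weak* continuous group of *-automorphisms which leaves \<open>\<phi>\<close> invariant
  and for which \<open>\<phi>\<close> satisfies the KMS (modular) condition. The sign convention is that of
  \<open>\<sigma>\<^sub>t(x) = \<rho>\<^sup>i\<^sup>t x \<rho>\<^sup>-\<^sup>i\<^sup>t\<close> for \<open>\<phi> = Tr(\<rho> \<cdot>)\<close>.\<close>

definition is_modular_group :: "('h::chilbert_space \<Rightarrow>\<^sub>L 'h) set \<Rightarrow>
    (('h \<Rightarrow>\<^sub>L 'h) \<Rightarrow> complex) \<Rightarrow> (real \<Rightarrow> ('h \<Rightarrow>\<^sub>L 'h) \<Rightarrow> ('h \<Rightarrow>\<^sub>L 'h)) \<Rightarrow> bool" where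
  "is_modular_group M \<phi> \<sigma> \<longleftrightarrow>
    weak_star_continuous_automorphism_group M \<sigma> \<and> leaves_invariant M \<phi> \<sigma> \<and>
    (\<forall>x\<in>M. \<forall>y\<in>M. \<exists>F :: complex \<Rightarrow> complex.
       continuous_on {z. 0 \<le> Im z \<and> Im z \<le> 1} F \<and>
       bounded (F ` {z. 0 \<le> Im z \<and> Im z \<le> 1}) \<and>
       F holomorphic_on {z. 0 < Im z \<and> Im z < 1} \<and>
       (\<forall>t::real. F (of_real t) = \<phi> (\<sigma> t x o\<^sub>L y) \<and> F (of_real t + \<i>) = \<phi> (y o\<^sub>L \<sigma> t x)))"


section \<open>Markov maps\<close>

text \<open>Positivity of an \<open>n \<times> n\<close> matrix of operators on \<open>H\<close>, as an operator on \<open>H\<^sup>n\<close>.\<close>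

definition positive_operator_matrix :: "nat \<Rightarrow> (nat \<Rightarrow> nat \<Rightarrow> 'h::chilbert_space \<Rightarrow>\<^sub>L 'h) \<Rightarrow> bool" where
  "positive_operator_matrix n a \<longleftrightarrow>
    (\<forall>\<xi> :: nat \<Rightarrow> 'h. (\<Sum>i<n. \<Sum>j<n. cinner (\<xi> i) (blinfun_apply (a i j) (\<xi> j))) \<in> \<real>\<^sub>\<ge>\<^sub>0)"

definition completely_positive :: "('h::chilbert_space \<Rightarrow>\<^sub>L 'h) set \<Rightarrow> ('k::chilbert_space \<Rightarrow>\<^sub>L 'k) set \<Rightarrow>
    (('h \<Rightarrow>\<^sub>L 'h) \<Rightarrow> ('k \<Rightarrow>\<^sub>L 'k)) \<Rightarrow> bool" where
  "completely_positive M N T \<longleftrightarrow> T \<in> M \<rightarrow> N \<and> linear_on_vna M T \<and>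
    (\<forall>n a. (\<forall>i<n. \<forall>j<n. a i j \<in> M) \<longrightarrow> positive_operator_matrix n a \<longrightarrow>
       positive_operator_matrix n (\<lambda>i j. T (a i j)))"

text \<open>Modular groups of normal faithful states exist and are unique (as maps on the algebra),
  so the existential quantifier merely names \<open>\<sigma>\<^sup>\<phi>\<close> and \<open>\<sigma>\<^sup>\<psi>\<close>.\<close>

definition markov_map :: "('h::chilbert_space \<Rightarrow>\<^sub>L 'h) set \<Rightarrow> (('h \<Rightarrow>\<^sub>L 'h) \<Rightarrow> complex) \<Rightarrow>
    ('k::chilbert_space \<Rightarrow>\<^sub>L 'k) set \<Rightarrow> (('k \<Rightarrow>\<^sub>L 'k) \<Rightarrow> complex) \<Rightarrow>
    (('h \<Rightarrow>\<^sub>L 'h) \<Rightarrow> ('k \<Rightarrow>\<^sub>L 'k)) \<Rightarrow> bool" where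
  "markov_map M \<phi> N \<psi> T \<longleftrightarrow>
    completely_positive M N T \<and>
    T id_blinfun = id_blinfun \<and>
    (\<forall>x\<in>M. \<psi> (T x) = \<phi> x) \<and>
    (\<exists>\<sigma> \<sigma>'. is_modular_group M \<phi> \<sigma> \<and> is_modular_group N \<psi> \<sigma>' \<and>
       (\<forall>t. \<forall>x\<in>M. T (\<sigma> t x) = \<sigma>' t (T x)))"

text \<open>\<open>S = T\<^sup>*\<close>; faithfulness of \<open>\<phi>\<close> makes \<open>S\<close> unique on \<open>N\<close>.\<close>

definition is_markov_adjoint :: "('h::chilbert_space \<Rightarrow>\<^sub>L 'h) set \<Rightarrow> (('h \<Rightarrow>\<^sub>L 'h) \<Rightarrow> complex) \<Rightarrow>
    ('k::chilbert_space \<Rightarrow>\<^sub>L 'k) set \<Rightarrow> (('k \<Rightarrow>\<^sub>L 'k) \<Rightarrow> complex) \<Rightarrow>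
    (('h \<Rightarrow>\<^sub>L 'h) \<Rightarrow> ('k \<Rightarrow>\<^sub>L 'k)) \<Rightarrow> (('k \<Rightarrow>\<^sub>L 'k) \<Rightarrow> ('h \<Rightarrow>\<^sub>L 'h)) \<Rightarrow> bool" where
  "is_markov_adjoint M \<phi> N \<psi> T S \<longleftrightarrow> S \<in> N \<rightarrow> M \<and> linear_on_vna N S \<and>
    (\<forall>x\<in>M. \<forall>y\<in>N. \<phi> (S y o\<^sub>L x) = \<psi> (y o\<^sub>L T x))"

definition selfadjoint_markov_map :: "('h::chilbert_space \<Rightarrow>\<^sub>L 'h) set \<Rightarrow>
    (('h \<Rightarrow>\<^sub>L 'h) \<Rightarrow> complex) \<Rightarrow> (('h \<Rightarrow>\<^sub>L 'h) \<Rightarrow> ('h \<Rightarrow>\<^sub>L 'h)) \<Rightarrow> bool" where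
  "selfadjoint_markov_map M \<phi> T \<longleftrightarrow> markov_map M \<phi> M \<phi> T \<and> is_markov_adjoint M \<phi> M \<phi> T T"

text \<open>The type argument is the Hilbert space on which the dilating algebra \<open>N\<close> acts, since HOL cannot
  quantify existentially over types. Passing to a larger (infinite) Hilbert dimension by
  amplification \<open>N \<otimes> 1\<close> is always possible. Conversely \<open>N\<close> can be replaced by the subalgebra generated
  by the \<open>U\<^sub>t(J(M))\<close>, in its standard representation; for \<open>M\<close> weak* generated by a group \<open>G\<close> this acts on
  a space of dimension at most that of \<open>\<ell>\<^sup>2(G \<times> \<nat>)\<close>. So \<open>\<ell>\<^sup>2(G \<times> \<nat>)\<close> is no restriction for \<open>M = VN(G)\<close>.\<close>

definition dilatable :: "'k::chilbert_space itself \<Rightarrow> ('h::chilbert_space \<Rightarrow>\<^sub>L 'h) set \<Rightarrow>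
    (('h \<Rightarrow>\<^sub>L 'h) \<Rightarrow> complex) \<Rightarrow> (real \<Rightarrow> ('h \<Rightarrow>\<^sub>L 'h) \<Rightarrow> ('h \<Rightarrow>\<^sub>L 'h)) \<Rightarrow> bool" where
  "dilatable (_ :: 'k itself) M \<phi> T \<longleftrightarrow>
    (\<exists>(N :: ('k \<Rightarrow>\<^sub>L 'k) set) \<psi> U J E.
       von_neumann_algebra N \<and> normal_faithful_state N \<psi> \<and>
       weak_star_continuous_automorphism_group N U \<and> leaves_invariant N \<psi> U \<and>
       markov_map M \<phi> N \<psi> J \<and> star_homomorphism M N J \<and> inj_on J M \<and>
       is_markov_adjoint M \<phi> N \<psi> J E \<and>
       (\<forall>t\<ge>0. \<forall>x\<in>M. T t x = E (U t (J x))))"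


section \<open>Group von Neumann algebras\<close>

text \<open>A discrete group is a type of class \<open>group_add\<close>: a not necessarily commutative group,
  in additive notation.\<close>

lift_definition translate :: "'g::group_add \<Rightarrow> 'g ell2 \<Rightarrow> 'g ell2" is "\<lambda>s f t. f (- s + t)"
proof -
  fix s :: 'g and f :: "'g \<Rightarrow> complex"
  assume f: "(\<lambda>i. (cmod (f i))\<^sup>2) summable_on UNIV"
  have "bij (\<lambda>t. - s + t)" by (rule bij_betw_byWitness[where f' = "\<lambda>t. s + t"]) (auto simp: add.assoc[symmetric])
  then show "(\<lambda>t. (cmod (f (- s + t)))\<^sup>2) summable_on UNIV"
    using summable_on_reindex_bij_betw[of "\<lambda>t. - s + t" UNIV UNIV "\<lambda>i. (cmod (f i))\<^sup>2"] f by simp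
qed

lemma norm_translate: "norm (translate s f) = norm f"
proof -
  have "bij (\<lambda>t. - s + t)" by (rule bij_betw_byWitness[where f' = "\<lambda>t. s + t"]) (auto simp: add.assoc[symmetric])
  then have "(norm (translate s f))\<^sup>2 = (norm f)\<^sup>2"
    unfolding norm_ell2_square translate.rep_eq
    using infsum_reindex_bij_betw[of "\<lambda>t. - s + t" UNIV UNIV "\<lambda>i. (cmod (Rep_ell2 f i))\<^sup>2"] by simp
  then show ?thesis by simp
qed

lemma translate_basis_vector: "translate s (basis_vector t) = basis_vector (s + t)"
  by transfer (auto simp: fun_eq_iff add.assoc[symmetric])

lift_definition left_translation :: "'g::group_add \<Rightarrow> 'g ell2 \<Rightarrow>\<^sub>L 'g ell2" is translate
proof -
  fix s :: 'g
  show "bounded_linear (translate s)"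
  proof
    show "translate s (f + g) = translate s f + translate s g" for f g by transfer simp
    show "translate s (r *\<^sub>R f) = r *\<^sub>R translate s f" for r f by transfer simp
    show "\<exists>K. \<forall>f. norm (translate s f) \<le> norm f * K"
      by (rule exI[of _ 1]) (simp add: norm_translate)
  qed
qed

definition group_vna :: "('g::group_add ell2 \<Rightarrow>\<^sub>L 'g ell2) set" where
  "group_vna = generated_vna (range left_translation)"

definition group_trace :: "('g::group_add ell2 \<Rightarrow>\<^sub>L 'g ell2) \<Rightarrow> complex" where
  "group_trace x = cinner (basis_vector 0) (blinfun_apply x (basis_vector 0))"

definition fourier_multiplier ::
  "(('g::group_add ell2 \<Rightarrow>\<^sub>L 'g ell2) \<Rightarrow> ('g ell2 \<Rightarrow>\<^sub>L 'g ell2)) \<Rightarrow> bool" where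
  "fourier_multiplier T \<longleftrightarrow> normal_map group_vna group_vna T \<and>
    (\<exists>a :: 'g \<Rightarrow> complex. \<forall>s. T (left_translation s) = scale_operator (a s) (left_translation s))"

end

theory Submission
  imports Defs "HOL-Library.Poly_Mapping" "HOL-Library.Equipollence" "HOL-Library.Product_Plus"
begin

text \<open>Selfadjointness forces \<open>T\<^sub>t(\<lambda>\<^sub>s) = e\<^bsup>-t\<psi>(s)\<^esup>\<lambda>\<^sub>s\<close> with \<open>\<psi>\<close> real, and complete positivity makes \<open>\<psi>\<close>
  conditionally negative definite, so \<open>\<psi>(s) = \<parallel>b(s)\<parallel>\<^sup>2\<close> for a cocycle \<open>b\<close> of an orthogonal representation
  of \<open>G\<close> on some \<open>H\<close>. Let \<open>\<Gamma> = L\<^sup>2(\<real>, H) \<rtimes> G\<close>. The function that is \<open>e\<^bsup>-\<parallel>h\<parallel>\<^sup>2\<^esup>\<close> at \<open>(h, e)\<close> and \<open>0\<close> at \<open>(h, s)\<close> with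
  \<open>s \<noteq> e\<close> is a character of \<open>\<Gamma>\<close>; its GNS representation generates the crossed product of a Gaussian
  algebra by \<open>G\<close>. The maps \<open>\<theta>\<^sub>t(h, s) = (S\<^sub>t h + 1\<^bsub>[0,t]\<^esub> \<otimes> b(s), s)\<close>, with \<open>S\<^sub>t\<close> the shift, form a
  one-parameter group of automorphisms of \<open>\<Gamma>\<close> preserving the character, hence act on the algebra, and
  the conditional expectation onto \<open>VN(G)\<close> maps \<open>\<theta>\<^sub>t(0, s)\<close> to \<open>e\<^bsup>-t\<psi>(s)\<^esup>\<lambda>\<^sub>s\<close>.

  The algebra is realized as the commutant of right multiplication by \<open>\<Gamma>\<close>, which makes membership
  questions trivial; the cyclic vector is tracial for the whole commutant. Fourier coefficients
  determine the elements of \<open>VN(G)\<close> and \<open>T\<^sub>t\<close> acts on them by multiplication, so the dilation identity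
  need not be extended from the \<open>\<lambda>\<^sub>s\<close> by a density argument.\<close>

section \<open>Complex Hilbert spaces\<close>

text \<open>The dilating Hilbert space is prescribed: it has to be \<open>ell2\<close> over
  \<open>'g \<times> nat\<close>. The factor G x Z in the labels and the cardinal estimates adjust
  the GNS space to exactly this dimension. The noise group is not L^2(R, H) itself but the free
  abelian group on symbols for 1_[a,b] tensor (delta_s - delta_r). There the shift and the action of
  G are strict, whereas on a space built from a Gram matrix they exist only after extending
  isometries. The price is that relations such as additivity of increments hold only for the
  represented vectors. The maps \<theta>_t form a group because 1_[0,t] + S_t 1_[0,t'] = 1_[0,t+t'],
  and they are multiplicative because b is a cocycle. The Gaussian e^(-|h|^2) carries no factor 1/2,
  so that |1_[0,t] tensor b(s)|^2 = t \<psi>(s) is already the required exponent. Since both states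
  are traces, their modular groups are trivial and the modular conditions hold at once. Weak*
  continuity of T_t excludes symbols that vanish for t > 0.\<close>

text \<open>Riesz representation of a functional given by its graph \<open>S\<close>. By scaling (w,
  r), the bound amounts to r^2 <= C |w|^2; in the stated form it bounds |w|^2 - 2 r from below, and
  the limit of a minimizing sequence is the representing vector.\<close>

lemma represent_functional:
  fixes S :: "('h::{real_inner,complete_space} \<times> real) set"
  assumes sub: "subspace S" and bd: "\<And>w r. (w, r) \<in> S \<Longrightarrow> 2 * r \<le> C + (norm w)\<^sup>2"
  shows "\<exists>v\<in>closure (fst ` S). (\<forall>(w, r)\<in>S. inner v w = r) \<and> (norm v)\<^sup>2 \<le> C"
proof -
  define g :: "'h \<times> real \<Rightarrow> real" where "g z = (norm (fst z))\<^sup>2 - 2 * snd z" for z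
  have lower: "- C \<le> g z" if "z \<in> S" for z
    using bd[of "fst z" "snd z"] that by (simp add: g_def)
  have bdd: "bdd_below (g ` S)" by (rule bdd_belowI2[of _ "- C"]) (rule lower)
  have ne: "S \<noteq> {}" using subspace_0[OF sub] by auto
  define m where "m = Inf (g ` S)"
  have m_le: "m \<le> g z" if "z \<in> S" for z unfolding m_def using that bdd by (intro cINF_lower)
  have "\<exists>z\<in>S. g z < m + 1 / real (Suc n)" for n
    using cInf_lessD[of "g ` S" "m + 1 / real (Suc n)"] ne by (auto simp: m_def)
  then obtain z where z: "\<And>n. z n \<in> S" "\<And>n. g (z n) < m + 1 / real (Suc n)" by metis
  have glim: "(\<lambda>n. g (z n)) \<longlonglongrightarrow> m"
  proof (rule tendsto_sandwich[of "\<lambda>_. m" _ _ "\<lambda>n. m + 1 / real (Suc n)"])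
    show "(\<lambda>n. m + 1 / real (Suc n)) \<longlonglongrightarrow> m"
      using tendsto_add[OF tendsto_const LIMSEQ_inverse_real_of_nat, of m] by (simp add: inverse_eq_divide)
    show "\<forall>\<^sub>F n in sequentially. m \<le> g (z n)" by (simp add: m_le z)
    show "\<forall>\<^sub>F n in sequentially. g (z n) \<le> m + 1 / real (Suc n)"
      using z(2) by (auto intro!: always_eventually simp only: less_imp_le)
  qed simp
  \<comment> \<open>Parallelogram law: the midpoint of two near-minimizers lies in \<open>S\<close>,
    so its value is at least \<open>m\<close>; the linear terms cancel.\<close>
  have par: "(norm (fst (z i) - fst (z j)))\<^sup>2 \<le> 2 * g (z i) + 2 * g (z j) - 4 * m" for i j
  proof -
    have "(1/2) *\<^sub>R (z i + z j) \<in> S" by (intro subspace_scale subspace_add sub z)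
    then have "m \<le> g ((1/2) *\<^sub>R (z i + z j))" by (rule m_le)
    moreover have "(norm (fst (z i) - fst (z j)))\<^sup>2 = 2 * g (z i) + 2 * g (z j) - 4 * g ((1/2) *\<^sub>R (z i + z j))"
      by (simp add: g_def power2_norm_eq_inner inner_diff_left inner_diff_right inner_add_left inner_add_right
          inner_commute algebra_simps)
    ultimately show ?thesis by simp
  qed
  have "Cauchy (\<lambda>n. fst (z n))"
  proof (rule CauchyI)
    fix e :: real assume "e > 0"
    then have "e\<^sup>2 / 4 > 0" by simp
    then obtain M where M: "\<And>n. n \<ge> M \<Longrightarrow> \<bar>g (z n) - m\<bar> < e\<^sup>2 / 4"
      using glim[unfolded LIMSEQ_iff real_norm_def] by blast
    have "norm (fst (z i) - fst (z j)) < e" if "i \<ge> M" "j \<ge> M" for i j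
    proof (rule power2_less_imp_less)
      show "(norm (fst (z i) - fst (z j)))\<^sup>2 < e\<^sup>2"
        using par[of i j] M[OF that(1)] M[OF that(2)] by linarith
    qed (use \<open>e > 0\<close> in simp)
    then show "\<exists>M. \<forall>m\<ge>M. \<forall>n\<ge>M. norm (fst (z m) - fst (z n)) < e" by blast
  qed
  then obtain v where v: "(\<lambda>n. fst (z n)) \<longlonglongrightarrow> v"
    unfolding Cauchy_convergent_iff convergent_def by blast
  have rep: "inner v w = r" if wr: "(w, r) \<in> S" for w r
  proof -
    \<comment> \<open>First variation: the competitors \<open>z n\<close> + \<tau> (w, r) have value
      at least \<open>m\<close>; then n tends to infinity.\<close>
    have nn: "0 \<le> 2 * \<tau> * (inner v w - r) + \<tau>\<^sup>2 * (norm w)\<^sup>2" for \<tau>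
    proof (rule tendsto_le[OF sequentially_bot])
      show "(\<lambda>n. (g (z n) - m) + 2 * \<tau> * (inner (fst (z n)) w - r) + \<tau>\<^sup>2 * (norm w)\<^sup>2)
          \<longlonglongrightarrow> 2 * \<tau> * (inner v w - r) + \<tau>\<^sup>2 * (norm w)\<^sup>2"
        using tendsto_add[OF tendsto_add[OF tendsto_diff[OF glim tendsto_const[of m]]
          tendsto_mult[OF tendsto_const[of "2*\<tau>"] tendsto_diff[OF tendsto_inner[OF v tendsto_const[of w]] tendsto_const[of r]]]]
          tendsto_const[of "\<tau>\<^sup>2 * (norm w)\<^sup>2"]] by simp
      show "(\<lambda>n. 0) \<longlonglongrightarrow> (0::real)" by simp
      have "0 \<le> (g (z n) - m) + 2 * \<tau> * (inner (fst (z n)) w - r) + \<tau>\<^sup>2 * (norm w)\<^sup>2" for n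
      proof -
        have "z n + \<tau> *\<^sub>R (w, r) \<in> S" by (intro subspace_scale subspace_add sub z wr)
        from m_le[OF this] show ?thesis
          unfolding g_def power2_norm_eq_inner
          by (simp add: inner_add_left inner_add_right inner_commute algebra_simps power2_eq_square)
      qed
      then show "\<forall>\<^sub>F n in sequentially. 0 \<le> (g (z n) - m) + 2 * \<tau> * (inner (fst (z n)) w - r) + \<tau>\<^sup>2 * (norm w)\<^sup>2"
        by simp
    qed
    define d where "d = inner v w - r"
    define q where "q = (norm w)\<^sup>2"
    have "d = 0"
    proof (rule ccontr)
      assume "d \<noteq> 0"
      have "q \<ge> 0" by (simp add: q_def)
      \<comment> \<open>A nearly optimal \<tau>; the \<open>+ 1\<close> keeps the denominator
        positive when \<open>w\<close> is zero.\<close>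
      have "0 \<le> 2 * (- d / (q + 1)) * d + (- d / (q + 1))\<^sup>2 * q"
        using nn[of "- d / (q + 1)"] by (simp add: d_def q_def)
      also have "\<dots> = - (d\<^sup>2 * (q + 2) / (q + 1)\<^sup>2)"
        using \<open>q \<ge> 0\<close> by (simp add: divide_simps power2_eq_square) (simp add: algebra_simps)
      also have "\<dots> < 0" using \<open>d \<noteq> 0\<close> \<open>q \<ge> 0\<close> by simp
      finally show False by simp
    qed
    then show ?thesis by (simp add: d_def)
  qed
  have "(norm v)\<^sup>2 \<le> C"
  proof -
    \<comment> \<open>On \<open>S\<close> the second component is now the inner product with
      \<open>v\<close>, so the infimum \<open>m\<close> equals -|v|^2.\<close>
    have "g (z n) = (norm (fst (z n)))\<^sup>2 - 2 * inner v (fst (z n))" for n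
      using rep[of "fst (z n)" "snd (z n)"] z(1)[of n] by (simp add: g_def)
    moreover have "(\<lambda>n. (norm (fst (z n)))\<^sup>2 - 2 * inner v (fst (z n))) \<longlonglongrightarrow> (norm v)\<^sup>2 - 2 * inner v v"
      by (intro tendsto_intros v)
    ultimately have "m = (norm v)\<^sup>2 - 2 * inner v v" using glim LIMSEQ_unique by simp
    moreover have "- C \<le> m" unfolding m_def using lower ne by (intro cINF_greatest) auto
    ultimately show ?thesis by (simp add: power2_norm_eq_inner)
  qed
  moreover have "v \<in> closure (fst ` S)"
    unfolding closure_sequential using v z(1) by (intro exI[of _ "\<lambda>n. fst (z n)"]) auto
  ultimately show ?thesis using rep by blast
qed

lemma subspace_closure:
  fixes S :: "'a::real_normed_vector set"
  assumes "subspace S"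
  shows "subspace (closure S)"
proof (rule subspaceI)
  show "0 \<in> closure S" using subspace_0[OF assms] closure_subset by blast
  fix x y assume "x \<in> closure S" "y \<in> closure S"
  then obtain X Y where "\<And>n. X n \<in> S" "X \<longlonglongrightarrow> x" "\<And>n. Y n \<in> S" "Y \<longlonglongrightarrow> y"
    unfolding closure_sequential by blast
  then show "x + y \<in> closure S"
    unfolding closure_sequential
    by (intro exI[of _ "\<lambda>n. X n + Y n"]) (auto intro: tendsto_add subspace_add[OF assms])
next
  fix c x assume "x \<in> closure S"
  then obtain X where "\<And>n. X n \<in> S" "X \<longlonglongrightarrow> x"
    unfolding closure_sequential by blast
  then show "c *\<^sub>R x \<in> closure S"
    unfolding closure_sequential
    by (intro exI[of _ "\<lambda>n. c *\<^sub>R X n"]) (auto intro: tendsto_intros subspace_scale[OF assms])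
qed

text \<open>The vector of the closure that represents <v, .> on \<open>span A\<close> is the
  orthogonal projection of v. The remainder is orthogonal to \<open>A\<close>, hence zero.\<close>

lemma closure_eq_UNIV_if_orthogonal_zero:
  fixes A :: "'h::{real_inner,complete_space} set"
  assumes "\<And>v. (\<And>a. a \<in> A \<Longrightarrow> inner a v = 0) \<Longrightarrow> v = 0"
  shows "closure (span A) = UNIV"
proof -
  have "v \<in> closure (span A)" for v
  proof -
    let ?S = "(\<lambda>w. (w, inner v w)) ` span A"
    have "subspace ?S"
      by (intro linear_subspace_image linearI subspace_span) (auto simp: inner_add_right)
    moreover have "2 * r \<le> (norm v)\<^sup>2 + (norm w)\<^sup>2" if "(w, r) \<in> ?S" for w r
      using that inner_ge_zero[of "v - w"]
      by (auto simp: power2_norm_eq_inner inner_diff_left inner_diff_right inner_commute)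
    ultimately have "\<exists>p\<in>closure (fst ` ?S). (\<forall>(w, r)\<in>?S. inner p w = r) \<and> (norm p)\<^sup>2 \<le> (norm v)\<^sup>2"
      by (rule represent_functional)
    then obtain p where p: "p \<in> closure (fst ` ?S)" "\<And>w. w \<in> span A \<Longrightarrow> inner p w = inner v w"
      by auto
    have "v - p = 0"
    proof (rule assms)
      fix a assume "a \<in> A"
      then have "inner p a = inner v a" by (intro p(2)) (auto intro: span_base)
      then show "inner a (v - p) = 0" by (simp add: inner_diff_right inner_commute)
    qed
    then show ?thesis using p(1) by (simp add: image_image)
  qed
  then show ?thesis by blast
qed

text \<open>Equality of the Gram matrices makes the closed span \<open>G\<close> of the pairs (f x,
  f' x) consist of pairs of equal norm. Such a subspace is the graph of an isometry, so linear
  relations among the f x need no separate treatment.\<close>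

lemma isometric_extension:
  fixes f :: "'x \<Rightarrow> 'a::{real_inner,complete_space}" and f' :: "'x \<Rightarrow> 'b::{real_inner,complete_space}"
  assumes gram: "\<And>x y. inner (f x) (f y) = inner (f' x) (f' y)"
    and dense: "closure (span (range f)) = UNIV"
  obtains u :: "'a \<Rightarrow>\<^sub>L 'b" where "\<And>x. u (f x) = f' x" "\<And>v w. inner (u v) (u w) = inner v w"
proof -
  define G where "G = closure (span (range (\<lambda>x. (f x, f' x))))"
  have subG: "subspace G" unfolding G_def by (intro subspace_closure subspace_span)
  have iso: "norm v = norm w" if "(v, w) \<in> G" for v w
  proof -
    have "span (range (\<lambda>x. (f x, f' x))) \<subseteq> {z. norm (fst z) = norm (snd z)}"
    proof
      fix z assume "z \<in> span (range (\<lambda>x. (f x, f' x)))"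
      then have "inner (fst z) (fst y) = inner (snd z) (snd y)"
        if "y \<in> span (range (\<lambda>x. (f x, f' x)))" for y
        using that
      proof (induction z arbitrary: y rule: span_induct_alt)
        case (step c a z)
        from step(3) have "inner (fst a) (fst y) = inner (snd a) (snd y)"
        proof (induction y rule: span_induct_alt)
          case (step c b y)
          then show ?case using \<open>a \<in> range _\<close> by (auto simp: inner_add_right gram)
        qed simp
        with step show ?case by (auto simp: inner_add_left)
      qed simp
      from this[of z] \<open>z \<in> _\<close> show "z \<in> {z. norm (fst z) = norm (snd z)}"
        by (simp add: norm_eq_sqrt_inner)
    qed
    moreover have "closed {z :: 'a \<times> 'b. norm (fst z) = norm (snd z)}"
      by (intro closed_Collect_eq continuous_intros)
    ultimately have "G \<subseteq> {z. norm (fst z) = norm (snd z)}"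
      unfolding G_def by (rule closure_minimal)
    then show ?thesis using that by auto
  qed
  have uniq: "w = w'" if "(v, w) \<in> G" "(v, w') \<in> G" for v w w'
    using iso[of 0 "w - w'"] subspace_diff[OF subG that] by simp
  have "v \<in> fst ` G" for v
  proof -
    \<comment> \<open>Distances of first and second components agree, so second components form a
      Cauchy sequence and completeness supplies the limit pair.\<close>
    have "closed (fst ` G)"
      unfolding closed_sequential_limits
    proof (intro allI impI, elim conjE)
      fix X l assume X: "\<forall>n. X n \<in> fst ` G" "X \<longlonglongrightarrow> l"
      then have "\<forall>n. \<exists>y. (X n, y) \<in> G" by force
      then obtain Y where Y: "\<And>n. (X n, Y n) \<in> G" by metis
      have d: "dist (Y i) (Y j) = dist (X i) (X j)" for i j
        using iso[of "X i - X j" "Y i - Y j"] subspace_diff[OF subG Y[of i] Y[of j]]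
        by (simp add: dist_norm)
      have "Cauchy Y" using LIMSEQ_imp_Cauchy[OF X(2)] by (simp add: Cauchy_def d)
      then obtain y where "Y \<longlonglongrightarrow> y" unfolding Cauchy_convergent_iff convergent_def by blast
      then have "(\<lambda>n. (X n, Y n)) \<longlonglongrightarrow> (l, y)" by (intro tendsto_Pair X)
      moreover have "closed G" by (simp add: G_def)
      ultimately have "(l, y) \<in> G" using Y by (meson closed_sequentially)
      then show "l \<in> fst ` G" by force
    qed
    moreover have "span (range f) \<subseteq> fst ` G"
    proof (rule span_minimal)
      have "(f x, f' x) \<in> G" for x
        unfolding G_def by (rule closure_subset[THEN subsetD]) (auto intro: span_base)
      then show "range f \<subseteq> fst ` G" by force
      show "subspace (fst ` G)" by (intro linear_subspace_image subG linear_fst)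
    qed
    ultimately have "closure (span (range f)) \<subseteq> fst ` G" by (intro closure_minimal)
    then show ?thesis using dense by auto
  qed
  then have ex1: "\<exists>!w. (v, w) \<in> G" for v using uniq \<open>\<And>v. v \<in> fst ` G\<close> by force
  define T where "T v = (THE w. (v, w) \<in> G)" for v
  have T: "(v, T v) \<in> G" for v unfolding T_def by (rule theI'[OF ex1])
  have add: "T (v + w) = T v + T w" for v w
    using uniq[OF T] subspace_add[OF subG T T] by simp
  have scale: "T (r *\<^sub>R v) = r *\<^sub>R T v" for r v
    using uniq[OF T] subspace_scale[OF subG T] by simp
  have nrm: "norm (T v) = norm v" for v using iso[OF T] by simp
  have bl: "bounded_linear T"
    by (rule bounded_linear_intro[where K = 1]) (simp_all add: add scale nrm)
  have inn: "inner (T v) (T w) = inner v w" for v w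
    using nrm[of "v + w"] nrm[of v] nrm[of w]
    by (simp add: add norm_eq_sqrt_inner inner_add_left inner_add_right inner_commute)
  have "T (f x) = f' x" for x
    by (rule uniq[OF T]) (auto simp: G_def intro: span_base closure_subset[THEN subsetD])
  with that[of "Blinfun T"] show thesis by (simp add: bounded_linear_Blinfun_apply[OF bl] inn)
qed


section \<open>Complex inner products and adjoints, derived from the real theory\<close>

lemma Im_cinner: "Im (cinner v w) = - inner v (\<i> *\<^sub>C w)"
  by (simp add: inner_Re_cinner cinner_scaleC_right)

lemma inner_complex_operations:
  fixes v w :: "'h::chilbert_space"
  shows "cinner v (w + w') = cinner v w + cinner v w'"
    and "cinner (v + v') w = cinner v w + cinner v' w"
    and "cinner (r *\<^sub>R v) w = r *\<^sub>R cinner v w"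
    and "cinner v (r *\<^sub>R w) = r *\<^sub>R cinner v w"
  using cinner_commute[of "v + v'" w] cinner_commute[of v w] cinner_commute[of v' w]
  by (simp_all add: cinner_add_right scaleR_scaleC cinner_scaleC_left cinner_scaleC_right scaleR_conv_of_real)

lemma cinner_cauchy_schwarz: "cmod (cinner v w) \<le> norm v * norm w"
proof (cases "cinner v w = 0")
  case False
  \<comment> \<open>The phase that makes <v, c w> equal to its modulus, so that the real
    Cauchy-Schwarz inequality applies.\<close>
  define c where "c = cnj (cinner v w) / cmod (cinner v w)"
  have "cinner v (c *\<^sub>C w) = cmod (cinner v w)"
    using False complex_norm_square[of "cinner v w"]
    by (simp add: c_def cinner_scaleC_right divide_simps power2_eq_square mult.commute)
  then have "cmod (cinner v w) = inner v (c *\<^sub>C w)" by (simp add: inner_Re_cinner)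
  also have "\<dots> \<le> norm v * norm (c *\<^sub>C w)" by (rule norm_cauchy_schwarz)
  also have "norm (c *\<^sub>C w) = norm w" using False by (simp add: norm_scaleC c_def norm_divide)
  finally show ?thesis .
qed simp

lemma bounded_bilinear_cinner: "bounded_bilinear (cinner :: 'h::chilbert_space \<Rightarrow> 'h \<Rightarrow> complex)"
proof
  show "\<exists>K. \<forall>v w :: 'h. cmod (cinner v w) \<le> norm v * norm w * K"
    by (rule exI[of _ 1]) (simp add: cinner_cauchy_schwarz)
qed (simp_all only: inner_complex_operations)

interpretation cinner: bounded_bilinear "cinner :: 'h::chilbert_space \<Rightarrow> 'h \<Rightarrow> complex"
  by (rule bounded_bilinear_cinner)

lemma bounded_bilinear_scaleC: "bounded_bilinear (scaleC :: complex \<Rightarrow> 'h::chilbert_space \<Rightarrow> 'h)"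
proof
  show "\<exists>K. \<forall>c (v :: 'h). norm (c *\<^sub>C v) \<le> norm c * norm v * K"
    by (rule exI[of _ 1]) (simp add: norm_scaleC)
qed (simp_all add: scaleC_add_left scaleC_add_right scaleR_scaleC[where 'a = 'h] scaleC_scaleC
    mult.commute scaleR_conv_of_real)

interpretation scaleC: bounded_bilinear "scaleC :: complex \<Rightarrow> 'h::chilbert_space \<Rightarrow> 'h"
  by (rule bounded_bilinear_scaleC)

lemma scaleC_one [simp]: "1 *\<^sub>C (v :: 'h::chilbert_space) = v"
  using scaleR_scaleC[of 1 v] by simp

lemma cinner_self: "cinner v v = of_real ((norm v)\<^sup>2)"
proof (rule complex_eqI)
  show "Im (cinner v v) = Im (of_real ((norm v)\<^sup>2))"
    using arg_cong[OF cinner_commute[of v v], of Im] by simp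
qed (simp add: inner_Re_cinner power2_norm_eq_inner)

lemma cinner_ext: "(\<And>w. cinner w v = cinner w v') \<Longrightarrow> v = v'"
proof -
  assume "\<And>w. cinner w v = cinner w v'"
  then have "cinner (v - v') (v - v') = 0" by (simp only: cinner.diff_right) simp
  then show ?thesis by (simp add: cinner_self)
qed

lemma cinner_ext_left: "(\<And>w. cinner v w = cinner v' w) \<Longrightarrow> v = v'"
  by (rule cinner_ext) (simp add: cinner_commute[of _ v] cinner_commute[of _ v'])

text \<open>Unlike \<open>bounded_operators\<close>, this covers maps between different spaces, such
  as the embeddings of \<open>ell2\<close> into the dilating space.\<close>

definition complex_linear :: "('h::chilbert_space \<Rightarrow>\<^sub>L 'k::chilbert_space) \<Rightarrow> bool" where
  "complex_linear x \<longleftrightarrow> (\<forall>c v. blinfun_apply x (c *\<^sub>C v) = c *\<^sub>C blinfun_apply x v)"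

lemma complex_linearD: "complex_linear x \<Longrightarrow> blinfun_apply x (c *\<^sub>C v) = c *\<^sub>C blinfun_apply x v"
  by (simp add: complex_linear_def)

lemma bounded_operators_eq: "bounded_operators = {x. complex_linear x}"
  by (simp add: bounded_operators_def complex_linear_def)

lemma complex_linear_compose:
  "complex_linear x \<Longrightarrow> complex_linear y \<Longrightarrow> complex_linear (x o\<^sub>L y)"
  by (simp add: complex_linear_def)

text \<open>Real Riesz representation of w -> <v, x w> with C = (|v| |x|)^2 gives the adjoint and
  its bound. Complex linearity of \<open>x\<close> and \<open>Im_cinner\<close> then carry the
  identity over to the complex inner product.\<close>

lemma adjoint_exists:
  fixes x :: "'h::chilbert_space \<Rightarrow>\<^sub>L 'k::chilbert_space"
  assumes x: "complex_linear x"
  obtains y :: "'k \<Rightarrow>\<^sub>L 'h" where "complex_linear y" "\<And>v w. cinner (y v) w = cinner v (x w)"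
proof -
  have "\<exists>u. (\<forall>w. inner u w = inner v (x w)) \<and> norm u \<le> norm v * norm x" for v
  proof -
    let ?S = "range (\<lambda>w. (w, inner v (x w)))"
    have "subspace ?S"
      by (intro linear_subspace_image linearI subspace_UNIV) (auto simp: inner_add_right blinfun.bilinear_simps)
    moreover have "2 * r \<le> (norm v * norm x)\<^sup>2 + (norm w)\<^sup>2" if "(w, r) \<in> ?S" for w r
    proof -
      have "r \<le> norm v * norm (x w)" using that norm_cauchy_schwarz by auto
      also have "\<dots> \<le> (norm v * norm x) * norm w"
        using norm_blinfun[of x w] by (simp add: mult.assoc mult_left_mono)
      finally show ?thesis using sum_squares_bound[of "norm v * norm x" "norm w"] by simp
    qed
    ultimately have "\<exists>u\<in>closure (fst ` ?S). (\<forall>(w, r)\<in>?S. inner u w = r) \<and> (norm u)\<^sup>2 \<le> (norm v * norm x)\<^sup>2"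
      by (rule represent_functional)
    then obtain u where u: "\<And>w. inner u w = inner v (x w)" "(norm u)\<^sup>2 \<le> (norm v * norm x)\<^sup>2"
      by auto
    have "norm u \<le> norm v * norm x"
      by (rule power2_le_imp_le[OF u(2)]) simp
    with u(1) show ?thesis by (intro exI[of _ u]) auto
  qed
  then obtain y where y: "\<And>v w. inner (y v) w = inner v (x w)" "\<And>v. norm (y v) \<le> norm v * norm x"
    by metis
  have eqI: "u = u'" if "\<And>w. inner u w = inner u' w" for u u' :: 'h
  proof -
    have "inner (u - u') (u - u') = 0"
      by (simp add: inner_diff_left that)
    then show ?thesis by simp
  qed
  have bl: "bounded_linear y"
    by (rule bounded_linear_intro[where K = "norm x"]) (auto intro!: eqI simp: inner_add_left y)
  have *: "cinner (y v) w = cinner v (x w)" for v w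
    by (simp add: complex_eq_iff Im_cinner y complex_linearD[OF x] flip: inner_Re_cinner)
  have "y (c *\<^sub>C v) = c *\<^sub>C y v" for c v
    by (rule cinner_ext_left) (simp add: * cinner_scaleC_left)
  with that[of "Blinfun y"] * show thesis
    by (simp add: bounded_linear_Blinfun_apply[OF bl] complex_linear_def)
qed

lemma adjoint_operator_eqI:
  assumes "\<And>v w. cinner (blinfun_apply y v) w = cinner v (blinfun_apply x w)"
  shows "adjoint_operator x = y"
  unfolding adjoint_operator_def
proof (rule the_equality)
  fix y' assume "\<forall>v w. cinner (blinfun_apply y' v) w = cinner v (blinfun_apply x w)"
  then show "y' = y"
    by (intro blinfun_eqI cinner_ext_left) (simp add: assms)
qed (simp add: assms)

lemma
  assumes "x \<in> bounded_operators"
  shows cinner_adjoint_operator: "cinner (adjoint_operator x v) w = cinner v (x w)"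
    and adjoint_operator_bounded: "adjoint_operator x \<in> bounded_operators"
proof -
  obtain y where "complex_linear y" "\<And>v w. cinner (blinfun_apply y v) w = cinner v (x w)"
    using assms adjoint_exists[of x] unfolding bounded_operators_eq by blast
  moreover from this have "adjoint_operator x = y" by (intro adjoint_operator_eqI)
  ultimately show "cinner (adjoint_operator x v) w = cinner v (x w)"
    "adjoint_operator x \<in> bounded_operators"
    by (simp_all add: bounded_operators_eq)
qed

lemma cinner_adjoint_operator_right:
  "x \<in> bounded_operators \<Longrightarrow> cinner v (adjoint_operator x w) = cinner (x v) w"
  by (simp add: cinner_adjoint_operator cinner_commute[of v] cinner_commute[of "x v" w])

section \<open>Total families and operators prescribed on them\<close>

definition total_family :: "('x \<Rightarrow> 'h::chilbert_space) \<Rightarrow> bool" where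
  "total_family e \<longleftrightarrow> (\<forall>v. (\<forall>x. cinner (e x) v = 0) \<longrightarrow> v = 0)"

text \<open>\<open>span\<close> is the real span, so the complex scalars are put into the generating
  set; c = 1 and c = i recover complex orthogonality.\<close>

lemma total_family_dense:
  assumes "total_family e"
  shows "closure (span (range (\<lambda>(c, x). c *\<^sub>C e x))) = UNIV"
proof (rule closure_eq_UNIV_if_orthogonal_zero)
  fix v assume v: "\<And>a. a \<in> range (\<lambda>(c, x). c *\<^sub>C e x) \<Longrightarrow> inner a v = 0"
  have "cinner (e x) v = 0" for x
  proof -
    have *: "Re (cnj c * cinner (e x) v) = 0" for c
    proof -
      have "inner (c *\<^sub>C e x) v = 0" by (rule v) (auto simp: image_iff)
      then show ?thesis by (simp only: inner_Re_cinner cinner_scaleC_left)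
    qed
    from *[of 1] *[of \<i>] show ?thesis by (simp add: complex_eq_iff)
  qed
  then show "v = 0" using assms by (simp add: total_family_def)
qed

lemma total_family_induct:
  assumes "total_family e" "closed {v. P v}" "subspace {v. P v}" "\<And>c x. P (c *\<^sub>C e x)"
  shows "P v"
proof -
  have "closure (span (range (\<lambda>(c, x). c *\<^sub>C e x))) \<subseteq> {v. P v}"
    by (intro closure_minimal span_minimal) (use assms in auto)
  then show ?thesis using total_family_dense[OF assms(1)] by auto
qed

lemma total_family_blinfun_eqI:
  assumes "total_family e" "complex_linear a" "complex_linear b" "\<And>x. blinfun_apply a (e x) = blinfun_apply b (e x)"
  shows "a = b"
proof (rule blinfun_eqI)
  fix v
  show "blinfun_apply a v = blinfun_apply b v"
  proof (rule total_family_induct[OF assms(1)])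
    show "closed {v. blinfun_apply a v = blinfun_apply b v}"
      by (intro closed_Collect_eq continuous_intros)
    show "subspace {v. blinfun_apply a v = blinfun_apply b v}"
      by (rule subspaceI) (auto simp: blinfun.bilinear_simps)
  qed (use assms in \<open>simp add: complex_linearD\<close>)
qed

text \<open>The real extension is applied to the family c e(x), indexed by pairs (c, x). It sends c
  e(x) to c e'(x) and is therefore complex linear on a dense set.\<close>

lemma gram_extension:
  fixes e :: "'x \<Rightarrow> 'h::chilbert_space" and e' :: "'x \<Rightarrow> 'k::chilbert_space"
  assumes tot: "total_family e" and gram: "\<And>x y. cinner (e x) (e y) = cinner (e' x) (e' y)"
  shows "\<exists>u :: 'h \<Rightarrow>\<^sub>L 'k. complex_linear u \<and> (\<forall>x. u (e x) = e' x) \<and> (\<forall>v w. cinner (u v) (u w) = cinner v w)"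
proof -
  obtain u :: "'h \<Rightarrow>\<^sub>L 'k" where u: "\<And>x. u ((\<lambda>(c, x). c *\<^sub>C e x) x) = (\<lambda>(c, x). c *\<^sub>C e' x) x"
    "\<And>v w. inner (u v) (u w) = inner v w"
    by (rule isometric_extension[OF _ total_family_dense[OF tot], of "\<lambda>(c, x). c *\<^sub>C e' x"])
      (auto simp: inner_Re_cinner cinner_scaleC_left cinner_scaleC_right gram)
  have ue: "u (c *\<^sub>C e x) = c *\<^sub>C e' x" for c x using u(1)[of "(c, x)"] by simp
  have lin: "u (c *\<^sub>C v) = c *\<^sub>C u v" for c v
  proof (rule total_family_induct[OF tot])
    show "closed {v. u (c *\<^sub>C v) = c *\<^sub>C u v}"
      by (intro closed_Collect_eq continuous_intros scaleC.continuous_on)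
    show "subspace {v. u (c *\<^sub>C v) = c *\<^sub>C u v}"
      by (rule subspaceI) (auto simp: blinfun.bilinear_simps scaleC.add_right scaleC.scaleR_right)
  qed (simp add: ue scaleC_scaleC)
  have "u (e x) = e' x" for x using ue[of 1 x] by simp
  moreover have "cinner (u v) (u w) = cinner v w" for v w
    using u(2)[of v "\<i> *\<^sub>C w"] u(2)[of v w] by (simp add: complex_eq_iff Im_cinner lin flip: inner_Re_cinner)
  ultimately show ?thesis using lin by (intro exI[of _ u]) (simp add: complex_linear_def)
qed

lemma norm_diff_square:
  fixes v w :: "'h::real_inner"
  shows "(norm (v - w))\<^sup>2 = inner v v - 2 * inner v w + inner w w"
  by (simp add: power2_norm_eq_inner inner_diff_left inner_diff_right inner_commute)

section \<open>Positive definite kernels\<close>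

lemma has_sum_cinner_ell2: "((\<lambda>i. cnj (Rep_ell2 v i) * Rep_ell2 w i) has_sum cinner v w) UNIV"
proof -
  have "(\<lambda>i. cnj (Rep_ell2 v i) * Rep_ell2 w i) summable_on UNIV"
    using Rep_ell2[of v] Rep_ell2[of w] by (intro square_summable_mult) auto
  then show ?thesis unfolding cinner_ell2.rep_eq by simp
qed

lemma cinner_basis_vector: "cinner (basis_vector i) v = Rep_ell2 v i"
proof (rule has_sum_unique[OF has_sum_cinner_ell2])
  show "((\<lambda>j. cnj (Rep_ell2 (basis_vector i) j) * Rep_ell2 v j) has_sum Rep_ell2 v i) UNIV"
    by (rule has_sum_finite_neutralI[of "{i}"]) (auto simp: basis_vector.rep_eq)
qed

lemma Rep_ell2_ext: "(\<And>i. Rep_ell2 v i = Rep_ell2 w i) \<Longrightarrow> v = w"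
  by (simp add: Rep_ell2_inject[symmetric] fun_eq_iff)

lemma cinner_basis_vectors: "cinner (basis_vector i) (basis_vector j) = (if i = j then 1 else 0)"
  by (simp add: cinner_basis_vector basis_vector.rep_eq)

lemma inner_basis_vectors: "inner (basis_vector i) (basis_vector j) = (if i = j then 1 else 0)"
  by (simp add: inner_Re_cinner cinner_basis_vectors)

lemma total_family_basis_vector: "total_family basis_vector"
  unfolding total_family_def cinner_basis_vector
  by (auto intro: Rep_ell2_ext simp: zero_ell2.rep_eq)

definition psd_kernel :: "('x \<Rightarrow> 'x \<Rightarrow> real) \<Rightarrow> bool" where
  "psd_kernel k \<longleftrightarrow> (\<forall>x y. k x y = k y x) \<and>
    (\<forall>n x c. 0 \<le> (\<Sum>i<n::nat. \<Sum>j<n. c i * c j * k (x i) (x j)))"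

lemma psd_kernelI:
  assumes "\<And>x y. k x y = k y x"
    and "\<And>n x c. 0 \<le> (\<Sum>i<n::nat. \<Sum>j<n. c i * c j * k (x i) (x j))"
  shows "psd_kernel k"
  using assms by (auto simp: psd_kernel_def)

lemma psd_kernel_sym: "psd_kernel k \<Longrightarrow> k x y = k y x"
  by (simp add: psd_kernel_def)

lemma psd_kernelD: "psd_kernel k \<Longrightarrow> 0 \<le> (\<Sum>i<n::nat. \<Sum>j<n. c i * c j * k (x i) (x j))"
  by (simp add: psd_kernel_def)

lemma psd_kernel_finite:
  assumes "psd_kernel k" "finite t"
  shows "0 \<le> (\<Sum>a\<in>t. \<Sum>b\<in>t. c a * c b * k (g a) (g b))"
proof -
  obtain h where h: "bij_betw h {..<card t} t"
    using ex_bij_betw_nat_finite[OF assms(2)] by (auto simp: atLeast0LessThan)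
  have "(\<Sum>a\<in>t. \<Sum>b\<in>t. c a * c b * k (g a) (g b))
      = (\<Sum>i<card t. \<Sum>j<card t. c (h i) * c (h j) * k (g (h i)) (g (h j)))"
    by (simp add: sum.reindex_bij_betw[OF h, symmetric])
  then show ?thesis using psd_kernelD[OF assms(1), of "c \<circ> h" "g \<circ> h" "card t"] by simp
qed

text \<open>Positivity at the points \<open>g a\<close> and the further point \<open>x\<close> with
  coefficient -1. This is the bound that \<open>represent_functional\<close> asks for when a Gram
  family is extended by one vector.\<close>

lemma psd_kernel_insert:
  assumes k: "psd_kernel k" and t: "finite t"
  shows "2 * (\<Sum>a\<in>t. c a * k x (g a)) \<le> k x x + (\<Sum>a\<in>t. \<Sum>b\<in>t. c a * c b * k (g a) (g b))"
proof -
  define c' where "c' = case_option (-1) c"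
  define g' where "g' = case_option x g"
  have "(\<Sum>a\<in>insert None (Some ` t). \<Sum>b\<in>insert None (Some ` t). c' a * c' b * k (g' a) (g' b))
      = k x x - (\<Sum>a\<in>t. c a * k x (g a)) - (\<Sum>a\<in>t. c a * k (g a) x)
        + (\<Sum>a\<in>t. \<Sum>b\<in>t. c a * c b * k (g a) (g b))"
    using t by (simp add: sum.reindex c'_def g'_def sum.distrib sum_negf sum_subtractf)
  also have "(\<Sum>a\<in>t. c a * k (g a) x) = (\<Sum>a\<in>t. c a * k x (g a))"
    by (simp add: psd_kernel_sym[OF k, of _ x])
  finally show ?thesis
    using psd_kernel_finite[OF k, of "insert None (Some ` t)" c' g'] t by simp
qed

lemma inner_sum_scaleR:
  "inner (\<Sum>a\<in>s. c a *\<^sub>R f a) (\<Sum>b\<in>t. d b *\<^sub>R g b) = (\<Sum>a\<in>s. \<Sum>b\<in>t. c a * d b * inner (f a) (g b))"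
  unfolding inner_sum_left by (simp add: inner_sum_right sum_distrib_left mult_ac)

lemma psd_kernel_gram:
  fixes b :: "'x \<Rightarrow> 'h::real_inner"
  shows "psd_kernel (\<lambda>x y. inner (b x) (b y))"
proof (rule psd_kernelI)
  fix n :: nat and x :: "nat \<Rightarrow> 'x" and c
  have "(\<Sum>i<n. \<Sum>j<n. c i * c j * inner (b (x i)) (b (x j)))
      = inner (\<Sum>i<n. c i *\<^sub>R b (x i)) (\<Sum>j<n. c j *\<^sub>R b (x j))"
    by (simp add: inner_sum_scaleR)
  then show "0 \<le> (\<Sum>i<n. \<Sum>j<n. c i * c j * inner (b (x i)) (b (x j)))" by simp
qed (rule inner_commute)

lemma psd_kernel_rescale:
  assumes "psd_kernel k"
  shows "psd_kernel (\<lambda>x y. g x * g y * k x y)"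
proof (rule psd_kernelI)
  fix n :: nat and x c
  show "0 \<le> (\<Sum>i<n. \<Sum>j<n. c i * c j * (g (x i) * g (x j) * k (x i) (x j)))"
    using psd_kernelD[OF assms, of "\<lambda>i. c i * g (x i)" x n] by (simp add: mult_ac)
qed (simp add: psd_kernel_sym[OF assms] mult_ac)

lemma psd_kernel_add:
  assumes "psd_kernel k" "psd_kernel l"
  shows "psd_kernel (\<lambda>x y. k x y + l x y)"
proof (rule psd_kernelI)
  fix n :: nat and x c
  show "0 \<le> (\<Sum>i<n. \<Sum>j<n. c i * c j * (k (x i) (x j) + l (x i) (x j)))"
    using psd_kernelD[OF assms(1), of c x n] psd_kernelD[OF assms(2), of c x n]
    by (simp add: distrib_left sum.distrib)
qed (simp add: psd_kernel_sym[OF assms(1)] psd_kernel_sym[OF assms(2)])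

lemma psd_kernel_scale:
  assumes "psd_kernel k" "r \<ge> 0"
  shows "psd_kernel (\<lambda>x y. r * k x y)"
  using psd_kernel_rescale[OF assms(1), of "\<lambda>_. sqrt r"] assms(2) by simp

lemma psd_kernel_sum:
  fixes m :: nat
  assumes "\<And>n. psd_kernel (k n)"
  shows "psd_kernel (\<lambda>x y. \<Sum>n<m. k n x y)"
proof (induction m)
  case 0
  then show ?case by (simp add: psd_kernel_def)
qed (simp add: psd_kernel_add assms)

lemma psd_kernel_lim:
  assumes "\<And>m. psd_kernel (k m)" "\<And>x y. (\<lambda>m. k m x y) \<longlonglongrightarrow> l x y"
  shows "psd_kernel l"
proof (rule psd_kernelI)
  show "l x y = l y x" for x y
    using LIMSEQ_unique[OF assms(2)[of x y]] assms(2)[of y x] by (simp add: psd_kernel_sym[OF assms(1), of _ x y])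
  fix n :: nat and x c
  show "0 \<le> (\<Sum>i<n. \<Sum>j<n. c i * c j * l (x i) (x j))"
  proof (rule tendsto_lowerbound)
    show "(\<lambda>m. \<Sum>i<n. \<Sum>j<n. c i * c j * k m (x i) (x j)) \<longlonglongrightarrow> (\<Sum>i<n. \<Sum>j<n. c i * c j * l (x i) (x j))"
      by (intro tendsto_intros assms)
  qed (simp_all add: psd_kernelD[OF assms(1)])
qed

lemma has_sum_sum:
  fixes f :: "'a \<Rightarrow> 'b \<Rightarrow> 'c::topological_comm_monoid_add"
  assumes "\<And>a. a \<in> A \<Longrightarrow> (f a has_sum s a) B"
  shows "((\<lambda>b. \<Sum>a\<in>A. f a b) has_sum (\<Sum>a\<in>A. s a)) B"
  using assms by (induction A rule: infinite_finite_induct) (auto intro: has_sum_add)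

text \<open>Schur product, coordinate by coordinate: the real part of cnj(\<beta>_i) \<beta>_j is Re
  Re + Im Im, so each coordinate contributes two rescalings of \<open>k\<close>.\<close>

lemma psd_kernel_mult_gram:
  fixes b :: "'x \<Rightarrow> 'i ell2"
  assumes "psd_kernel k"
  shows "psd_kernel (\<lambda>x y. inner (b x) (b y) * k x y)"
proof (rule psd_kernelI)
  fix n :: nat and x :: "nat \<Rightarrow> 'x" and c
  define \<beta> where "\<beta> i m = Rep_ell2 (b (x i)) m" for i m
  let ?S = "\<Sum>i<n. \<Sum>j<n. c i * c j * (inner (b (x i)) (b (x j)) * k (x i) (x j))"
  have "((\<lambda>m. \<Sum>i<n. \<Sum>j<n. (c i * c j * k (x i) (x j)) * Re (cnj (\<beta> i m) * \<beta> j m)) has_sum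
      (\<Sum>i<n. \<Sum>j<n. (c i * c j * k (x i) (x j)) * inner (b (x i)) (b (x j)))) UNIV"
    unfolding inner_Re_cinner \<beta>_def
    by (intro has_sum_sum has_sum_cmult_right has_sum_Re has_sum_cinner_ell2)
  moreover have "0 \<le> (\<Sum>i<n. \<Sum>j<n. (c i * c j * k (x i) (x j)) * Re (cnj (\<beta> i m) * \<beta> j m))" for m
  proof -
    have "(\<Sum>i<n. \<Sum>j<n. (c i * c j * k (x i) (x j)) * Re (cnj (\<beta> i m) * \<beta> j m))
      = (\<Sum>i<n. \<Sum>j<n. (c i * Re (\<beta> i m)) * (c j * Re (\<beta> j m)) * k (x i) (x j))
        + (\<Sum>i<n. \<Sum>j<n. (c i * Im (\<beta> i m)) * (c j * Im (\<beta> j m)) * k (x i) (x j))"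
      by (simp add: algebra_simps sum.distrib)
    then show ?thesis
      using psd_kernelD[OF assms, of "\<lambda>i. c i * Re (\<beta> i m)" x n]
        psd_kernelD[OF assms, of "\<lambda>i. c i * Im (\<beta> i m)" x n] by simp
  qed
  ultimately have "0 \<le> (\<Sum>i<n. \<Sum>j<n. (c i * c j * k (x i) (x j)) * inner (b (x i)) (b (x j)))"
    by (rule has_sum_nonneg)
  then show "0 \<le> ?S" by (simp add: mult_ac)
qed (simp add: psd_kernel_sym[OF assms] inner_commute)

lemma psd_kernel_exp_gram:
  fixes b :: "'x \<Rightarrow> 'i ell2"
  shows "psd_kernel (\<lambda>x y. exp (inner (b x) (b y)))"
proof (rule psd_kernel_lim)
  have "psd_kernel (\<lambda>x y. inner (b x) (b y) ^ n)" for n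
  proof (induction n)
    case 0
    have "psd_kernel (\<lambda>(x::'x) (y::'x). inner (1::real) 1)" by (rule psd_kernel_gram)
    then show ?case by simp
  qed (simp add: psd_kernel_mult_gram)
  then have "psd_kernel (\<lambda>x y. inverse (fact n) * inner (b x) (b y) ^ n)" for n
    by (intro psd_kernel_scale) simp_all
  then show "psd_kernel (\<lambda>x y. \<Sum>n<m. inverse (fact n) * inner (b x) (b y) ^ n)" for m
    by (rule psd_kernel_sum)
  show "(\<lambda>m. \<Sum>n<m. inverse (fact n) * inner (b x) (b y) ^ n) \<longlonglongrightarrow> exp (inner (b x) (b y))" for x y
    using exp_converges[of "inner (b x) (b y)"] by (simp add: sums_def)
qed

text \<open>Expanding the square leaves exp(2 <b x, b y>) times a factor in x and a factor in y; the
  scaling by sqrt 2 absorbs the 2.\<close>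

lemma psd_kernel_gaussian:
  fixes b :: "'x \<Rightarrow> 'i ell2"
  shows "psd_kernel (\<lambda>x y. exp (- (norm (b x - b y))\<^sup>2))"
proof -
  have "exp (- (norm (b x - b y))\<^sup>2) = exp (- (norm (b x))\<^sup>2) * exp (- (norm (b y))\<^sup>2)
      * exp (inner (sqrt 2 *\<^sub>R b x) (sqrt 2 *\<^sub>R b y))" for x y
    by (simp add: power2_norm_eq_inner inner_diff_left inner_diff_right inner_commute flip: exp_add)
  then show ?thesis
    using psd_kernel_rescale[OF psd_kernel_exp_gram[of "\<lambda>x. sqrt 2 *\<^sub>R b x"]] by simp
qed

text \<open>The vectors of the Gram representation are chosen one after the other; the basis vector with
  index \<open>x\<close> is used only if the vector of \<open>x\<close> does not lie in the closed span of the previous ones.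
  The set \<open>B\<close> of used indices then labels an orthonormal basis of the closed span.\<close>

theorem gram_representation:
  fixes k :: "'x \<Rightarrow> 'x \<Rightarrow> real"
  assumes k: "psd_kernel k"
  obtains f :: "'x \<Rightarrow> 'x ell2" and B where "\<And>x y. inner (f x) (f y) = k x y"
    "\<And>x. f x \<in> closure (span (basis_vector ` B))"
    "\<And>b. b \<in> B \<Longrightarrow> basis_vector b \<in> closure (span (range f))"
proof -
  \<comment> \<open>A triple (x, v, b) assigns the vector \<open>v\<close> to \<open>x\<close>, and
    \<open>b\<close> records whether \<open>basis_vector x\<close> has been used for it.\<close>
  define I :: "('x \<times> 'x ell2 \<times> bool) set \<Rightarrow> 'x set" where "I A = {x. \<exists>v. (x, v, True) \<in> A}" for A
  define V :: "('x \<times> 'x ell2 \<times> bool) set \<Rightarrow> 'x ell2 set" where "V A = (fst \<circ> snd) ` A" for A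
  define \<A> where "\<A> = {A. (\<forall>(x, v, b)\<in>A. \<forall>(y, w, c)\<in>A. inner v w = k x y) \<and>
    V A \<subseteq> closure (span (basis_vector ` I A)) \<and> basis_vector ` I A \<subseteq> closure (span (V A))}"
  have cl_mono: "closure (span S) \<subseteq> closure (span S')" if "S \<subseteq> S'" for S S' :: "'x ell2 set"
    by (intro closure_mono span_mono that)
  have "\<exists>M\<in>\<A>. \<forall>X\<in>\<A>. M \<subseteq> X \<longrightarrow> X = M"
  proof (rule subset_Zorn')
    fix C assume C: "subset.chain \<A> C"
    then have CA: "\<And>A. A \<in> C \<Longrightarrow> A \<in> \<A>" and ch: "\<And>A A'. A \<in> C \<Longrightarrow> A' \<in> C \<Longrightarrow> A \<subseteq> A' \<or> A' \<subseteq> A"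
      by (auto simp: subset_chain_def)
    have up: "V A \<subseteq> V (\<Union>C)" "I A \<subseteq> I (\<Union>C)" if "A \<in> C" for A
      using that by (auto simp: V_def I_def)
    have "inner v w = k x y" if in_C: "(x, v, b) \<in> A" "A \<in> C" "(y, w, c) \<in> A'" "A' \<in> C" for x v b y w c A A'
    proof -
      obtain D where "D \<in> C" "(x, v, b) \<in> D" "(y, w, c) \<in> D"
        using in_C ch[of A A'] by blast
      then show ?thesis using CA[of D] by (fastforce simp: \<A>_def)
    qed
    moreover have "V (\<Union>C) \<subseteq> closure (span (basis_vector ` I (\<Union>C)))"
    proof
      fix v assume "v \<in> V (\<Union>C)"
      then obtain A where "A \<in> C" "v \<in> V A" by (auto simp: V_def)
      then show "v \<in> closure (span (basis_vector ` I (\<Union>C)))"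
        using CA[of A] cl_mono[OF image_mono[OF up(2)], of A basis_vector] by (auto simp: \<A>_def)
    qed
    moreover have "basis_vector ` I (\<Union>C) \<subseteq> closure (span (V (\<Union>C)))"
    proof
      fix v :: "'x ell2" assume "v \<in> basis_vector ` I (\<Union>C)"
      then obtain A where "A \<in> C" "v \<in> basis_vector ` I A" by (auto simp: I_def)
      then show "v \<in> closure (span (V (\<Union>C)))"
        using CA[of A] cl_mono[OF up(1), of A] by (auto simp: \<A>_def)
    qed
    ultimately show "\<Union>C \<in> \<A>" by (fastforce simp: \<A>_def)
  qed
  then obtain M where M: "M \<in> \<A>" and max: "\<And>X. X \<in> \<A> \<Longrightarrow> M \<subseteq> X \<Longrightarrow> X = M" by blast
  have M1: "inner v w = k x y" if "(x, v, b) \<in> M" "(y, w, c) \<in> M" for x v b y w c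
    using M that by (fastforce simp: \<A>_def)
  have M2: "V M \<subseteq> closure (span (basis_vector ` I M))" and M3: "basis_vector ` I M \<subseteq> closure (span (V M))"
    using M by (auto simp: \<A>_def)
  have dom: "\<exists>v b. (x, v, b) \<in> M" for x
  proof (rule ccontr)
    assume no: "\<nexists>v b. (x, v, b) \<in> M"
    \<comment> \<open>Generates the graph of the functional that the vector of the new point
      \<open>x\<close> has to induce on the vectors chosen so far.\<close>
    define Q where "Q = (\<lambda>(y, v, b). (v, k x y)) ` M"
    have bound: "2 * r \<le> k x x + (norm w)\<^sup>2" if "(w, r) \<in> span Q" for w r
    proof -
      have "\<exists>t c. (w, r) = (\<Sum>a\<in>t. c a *\<^sub>R a) \<and> finite t \<and> t \<subseteq> Q"
        using that by (simp only: span_explicit mem_Collect_eq)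
      then obtain t c where t: "finite t" "t \<subseteq> Q" and wr: "(w, r) = (\<Sum>a\<in>t. c a *\<^sub>R a)"
        by (elim exE conjE)
      have "\<forall>a\<in>t. \<exists>y b. (y, fst a, b) \<in> M \<and> snd a = k x y"
      proof
        fix a assume "a \<in> t"
        then have "a \<in> Q" using t by blast
        then show "\<exists>y b. (y, fst a, b) \<in> M \<and> snd a = k x y" by (force simp: Q_def)
      qed
      then obtain g where g: "\<And>a. a \<in> t \<Longrightarrow> \<exists>b. (g a, fst a, b) \<in> M" "\<And>a. a \<in> t \<Longrightarrow> snd a = k x (g a)"
        by metis
      have w: "w = (\<Sum>a\<in>t. c a *\<^sub>R fst a)" using arg_cong[OF wr, of fst] by (simp add: fst_sum)
      have r: "r = (\<Sum>a\<in>t. c a * k x (g a))" using arg_cong[OF wr, of snd] g(2) by (simp add: snd_sum)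
      have "(norm w)\<^sup>2 = (\<Sum>a\<in>t. \<Sum>b\<in>t. c a * c b * inner (fst a) (fst b))"
        unfolding w power2_norm_eq_inner by (simp add: inner_sum_scaleR)
      also have "\<dots> = (\<Sum>a\<in>t. \<Sum>b\<in>t. c a * c b * k (g a) (g b))"
        using g(1) M1 by (intro sum.cong refl) metis
      finally show ?thesis using psd_kernel_insert[OF k t(1), of c x g] r by simp
    qed
    have "\<exists>v\<in>closure (fst ` span Q). (\<forall>(w, r)\<in>span Q. inner v w = r) \<and> (norm v)\<^sup>2 \<le> k x x"
      by (rule represent_functional[OF subspace_span bound])
    then obtain v where v: "v \<in> closure (fst ` span Q)" "\<forall>(w, r)\<in>span Q. inner v w = r" "(norm v)\<^sup>2 \<le> k x x"
      by (elim bexE conjE)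
    have "fst ` span Q = span (fst ` Q)" by (rule linear_span_image[symmetric]) (rule linear_fst)
    also have "fst ` Q = V M" by (force simp: Q_def V_def)
    finally have vV: "v \<in> closure (span (V M))" using v(1) by simp
    have vM: "inner v w = k x y" if "(y, w, b) \<in> M" for y w b
      using v(2) span_base[of "(w, k x y)" Q] that by (force simp: Q_def)
    have clos: "closure (span (V M)) \<subseteq> closure (span (basis_vector ` I M))"
      by (intro closure_minimal span_minimal M2 subspace_closure subspace_span) simp
    have perp: "inner (basis_vector x) u = 0" if "u \<in> closure (span (basis_vector ` I M))" for u
    proof -
      have "closure (span (basis_vector ` I M)) \<subseteq> {u. inner (basis_vector x) u = 0}"
      proof (intro closure_minimal span_minimal)
        show "closed {u. inner (basis_vector x) u = 0}"
          by (intro closed_Collect_eq continuous_intros)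
        show "subspace {u. inner (basis_vector x) u = 0}"
          by (rule subspaceI) (auto simp: inner_add_right)
        show "basis_vector ` I M \<subseteq> {u. inner (basis_vector x) u = 0}"
          using no by (auto simp: inner_basis_vectors I_def)
      qed
      with that show ?thesis by auto
    qed
    \<comment> \<open>\<open>v\<close> is the part of the new vector inside the closed span so far.
      The squared length still missing is supplied by the fresh \<open>basis_vector x\<close>,
      orthogonal to that span because \<open>x\<close> is not yet in the domain of
      \<open>M\<close>.\<close>
    define d where "d = sqrt (k x x - (norm v)\<^sup>2)"
    define u where "u = v + d *\<^sub>R basis_vector x"
    have d2: "d * d = k x x - inner v v" using v(3) by (simp add: d_def power2_norm_eq_inner)
    define M' where "M' = insert (x, u, d \<noteq> 0) M"
    have uM: "inner u w = k x y" if "(y, w, b) \<in> M" for y w b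
    proof -
      have "w \<in> V M" using that by (force simp: V_def)
      then show ?thesis using vM[OF that] perp[of w] M2 by (auto simp: u_def inner_add_left)
    qed
    have uM': "inner w u = k y x" if "(y, w, b) \<in> M" for y w b
      unfolding inner_commute[of w u] psd_kernel_sym[OF k, of y x] by (rule uM[OF that])
    have uu: "inner u u = k x x"
      using perp[of v] vV clos d2
      by (auto simp: u_def inner_add_left inner_add_right inner_basis_vectors inner_commute)
    have I': "I M' = (if d = 0 then I M else insert x (I M))" by (auto simp: I_def M'_def)
    have V': "V M' = insert u (V M)" by (simp add: V_def M'_def)
    have "M' \<in> \<A>"
      unfolding \<A>_def mem_Collect_eq
    proof (intro conjI)
      show "\<forall>(x, v, b)\<in>M'. \<forall>(y, w, c)\<in>M'. inner v w = k x y"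
        using M1 uM uM' uu by (auto simp only: M'_def ball_simps prod.case insert_iff prod.inject)
      have mono: "closure (span (basis_vector ` I M)) \<subseteq> closure (span (basis_vector ` I M'))"
        by (rule cl_mono) (auto simp: I')
      have "d *\<^sub>R basis_vector x \<in> closure (span (basis_vector ` I M'))"
        by (rule closure_subset[THEN subsetD], cases "d = 0")
          (simp_all add: I' span_zero span_scale span_base)
      then have "u \<in> closure (span (basis_vector ` I M'))"
        unfolding u_def using vV clos mono by (intro subspace_add subspace_closure subspace_span) auto
      then show "V M' \<subseteq> closure (span (basis_vector ` I M'))" using M2 mono by (auto simp: V')
      have mono2: "closure (span (V M)) \<subseteq> closure (span (V M'))" by (rule cl_mono) (auto simp: V')
      have "basis_vector x \<in> closure (span (V M'))" if "d \<noteq> 0"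
      proof -
        have "basis_vector x = (1 / d) *\<^sub>R (u - v)" using that by (simp add: u_def)
        moreover have "u \<in> closure (span (V M'))"
          by (rule closure_subset[THEN subsetD]) (simp add: V' span_base)
        moreover have "v \<in> closure (span (V M'))" using vV mono2 by blast
        ultimately show ?thesis
          by (simp only:) (intro subspace_scale subspace_diff subspace_closure subspace_span)
      qed
      then show "basis_vector ` I M' \<subseteq> closure (span (V M'))" using M3 mono2 by (auto simp: I')
    qed
    then have "M' = M" by (rule max) (auto simp: M'_def)
    then show False using no by (auto simp: M'_def)
  qed
  define f where "f x = (SOME v. \<exists>b. (x, v, b) \<in> M)" for x
  have f: "\<exists>b. (x, f x, b) \<in> M" for x unfolding f_def by (rule someI_ex) (rule dom)
  have fM: "v = f x" if "(x, v, b) \<in> M" for x v b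
  proof -
    obtain b' where "(x, f x, b') \<in> M" using f by blast
    then have "inner (v - f x) (v - f x) = 0"
      using M1[OF that that] M1[OF that, of x "f x" b'] M1[of x "f x" b' x "f x" b']
      by (simp add: inner_diff_left inner_diff_right inner_commute)
    then show ?thesis by simp
  qed
  have V: "V M = range f"
  proof (intro equalityI subsetI)
    fix v assume "v \<in> V M"
    then obtain x b where "(x, v, b) \<in> M" by (force simp: V_def)
    then show "v \<in> range f" by (auto dest: fM)
  next
    fix v assume "v \<in> range f"
    then obtain x where "v = f x" by blast
    moreover obtain b where "(x, f x, b) \<in> M" using f by blast
    ultimately have "(x, v, b) \<in> M" by simp
    then show "v \<in> V M" by (force simp: V_def)
  qed
  show thesis
  proof (rule that)
    show "inner (f x) (f y) = k x y" for x y
    proof -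
      obtain b c where "(x, f x, b) \<in> M" "(y, f y, c) \<in> M" using f by blast
      then show ?thesis by (rule M1)
    qed
    show "f x \<in> closure (span (basis_vector ` I M))" for x using M2 V by blast
    show "basis_vector b \<in> closure (span (range f))" if "b \<in> I M" for b
      using M3 that unfolding V by blast
  qed
qed

lemma gram_vectors:
  assumes "psd_kernel k"
  shows "\<exists>f :: 'x \<Rightarrow> 'x ell2. \<forall>x y. inner (f x) (f y) = k x y"
  by (rule gram_representation[OF assms]) blast

lemma psd_kernel_pullback: "psd_kernel k \<Longrightarrow> psd_kernel (\<lambda>x y. k (h x) (h y))"
  by (rule psd_kernelI) (rule psd_kernel_sym, assumption, rule psd_kernelD)

lemma psd_kernel_mult:
  assumes "psd_kernel k" "psd_kernel l"
  shows "psd_kernel (\<lambda>x y. k x y * l x y)"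
proof -
  obtain b :: "'a \<Rightarrow> 'a ell2" where "\<And>x y. inner (b x) (b y) = k x y"
    using gram_vectors[OF assms(1)] by auto
  with psd_kernel_mult_gram[OF assms(2), of b] show ?thesis by simp
qed

section \<open>Commutants and central positive definite functions\<close>

lemma adjoint_operator_compose:
  assumes "x \<in> bounded_operators" "y \<in> bounded_operators"
  shows "adjoint_operator (x o\<^sub>L y) = adjoint_operator y o\<^sub>L adjoint_operator x"
  by (rule adjoint_operator_eqI) (simp add: cinner_adjoint_operator assms)

lemma adjoint_operator_adjoint:
  "x \<in> bounded_operators \<Longrightarrow> adjoint_operator (adjoint_operator x) = x"
  by (rule adjoint_operator_eqI) (simp add: cinner_adjoint_operator_right)

lemma commutant_antimono: "S \<subseteq> S' \<Longrightarrow> commutant S' \<subseteq> commutant S"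
  by (auto simp: commutant_def)

lemma subset_bicommutant: "S \<subseteq> bounded_operators \<Longrightarrow> S \<subseteq> commutant (commutant S)"
  by (auto simp: commutant_def)

lemma commutant_bounded: "commutant S \<subseteq> bounded_operators"
  by (auto simp: commutant_def)

lemma triple_commutant: "S \<subseteq> bounded_operators \<Longrightarrow> commutant (commutant (commutant S)) = commutant S"
  by (intro equalityI commutant_antimono subset_bicommutant commutant_bounded)

lemma von_neumann_algebra_commutant:
  assumes S: "S \<subseteq> bounded_operators" "\<And>y. y \<in> S \<Longrightarrow> adjoint_operator y \<in> S"
  shows "von_neumann_algebra (commutant S)"
  unfolding von_neumann_algebra_def
proof (intro conjI ballI)
  fix x assume x: "x \<in> commutant S"
  then have xb: "x \<in> bounded_operators" using commutant_bounded by blast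
  have "adjoint_operator x o\<^sub>L y = y o\<^sub>L adjoint_operator x" if "y \<in> S" for y
  proof -
    have y: "y \<in> bounded_operators" "adjoint_operator y \<in> bounded_operators"
      using that S(1) adjoint_operator_bounded by auto
    have "adjoint_operator y o\<^sub>L x = x o\<^sub>L adjoint_operator y"
      using x S(2)[OF that] by (simp add: commutant_def)
    then have "adjoint_operator (adjoint_operator y o\<^sub>L x) = adjoint_operator (x o\<^sub>L adjoint_operator y)"
      by simp
    then show ?thesis using xb y by (simp add: adjoint_operator_compose adjoint_operator_adjoint)
  qed
  then show "adjoint_operator x \<in> commutant S"
    using adjoint_operator_bounded[OF xb] by (simp add: commutant_def)
qed (use commutant_bounded triple_commutant[OF S(1)] in blast)+

definition vector_state :: "'h::chilbert_space \<Rightarrow> ('h \<Rightarrow>\<^sub>L 'h) \<Rightarrow> complex" where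
  "vector_state v x = cinner v (blinfun_apply x v)"

lemma vector_functional_predual: "(\<lambda>x. cinner v (blinfun_apply x w)) \<in> predual M"
proof -
  have s: "summable (\<lambda>n. (norm (if n = 0 then u else 0))\<^sup>2)" for u :: 'a
    by (rule summable_finite[of "{0}"]) auto
  have "cinner v (blinfun_apply x w) = suminf (\<lambda>n::nat. cinner (if n = 0 then v else 0) (blinfun_apply x (if n = 0 then w else 0)))" for x
    by (subst suminf_finite[of "{0}"]) (auto simp: cinner.zero_left)
  then show ?thesis
    unfolding predual_def mem_Collect_eq
    by (intro exI[of _ "\<lambda>n. if n = 0 then v else 0"] exI[of _ "\<lambda>n. if n = 0 then w else 0"] conjI s ballI)
qed

lemma vector_state_predual: "vector_state v \<in> predual M"
  using vector_functional_predual[of v v M] by (simp only: vector_state_def[abs_def])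

text \<open>Right multiplication by the elements of a group with a central positive definite function is
  implemented by unitaries \<open>\<rho>\<close> on the GNS space. On the commutant of these unitaries the vector
  state of the cyclic vector is a faithful trace. The group laws are only required up to equality
  of the vectors in the GNS space.\<close>

locale central_gram =
  fixes e :: "'x \<Rightarrow> 'h::chilbert_space" and mul :: "'x \<Rightarrow> 'x \<Rightarrow> 'x" and inv :: "'x \<Rightarrow> 'x" and one :: 'x
  assumes total: "total_family e"
    and gram_mul: "cinner (e (mul y x)) (e (mul z x)) = cinner (e y) (e z)"
    and mul_inv: "e (mul (mul y x) (inv x)) = e y"
    and mul_one: "e (mul one x) = e x"
    and inv_inv: "inv (inv x) = x"
    and gram_inv: "cinner (e (inv x)) (e (inv y)) = cinner (e y) (e x)"
    and norm_one: "cinner (e one) (e one) = 1"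
begin

definition \<rho> :: "'x \<Rightarrow> 'h \<Rightarrow>\<^sub>L 'h" where
  "\<rho> x = (SOME r. complex_linear r \<and> (\<forall>y. r (e y) = e (mul y x)) \<and> (\<forall>v w. cinner (r v) (r w) = cinner v w))"

lemma \<rho>_linear: "complex_linear (\<rho> x)" and \<rho>_e: "\<rho> x (e y) = e (mul y x)"
  and \<rho>_isometry: "cinner (\<rho> x v) (\<rho> x w) = cinner v w"
proof -
  have "\<exists>r :: 'h \<Rightarrow>\<^sub>L 'h. complex_linear r \<and> (\<forall>y. r (e y) = e (mul y x)) \<and> (\<forall>v w. cinner (r v) (r w) = cinner v w)"
    by (rule gram_extension[OF total]) (simp add: gram_mul)
  from someI_ex[OF this] show "complex_linear (\<rho> x)" "\<rho> x (e y) = e (mul y x)"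
    "cinner (\<rho> x v) (\<rho> x w) = cinner v w"
    unfolding \<rho>_def[symmetric] by blast+
qed

lemma \<rho>_inv: "\<rho> x (\<rho> (inv x) v) = v"
proof -
  have "\<rho> x o\<^sub>L \<rho> (inv x) = id_blinfun"
    by (rule total_family_blinfun_eqI[OF total complex_linear_compose[OF \<rho>_linear \<rho>_linear]])
      (use mul_inv[of _ "inv x"] in \<open>simp_all add: \<rho>_e inv_inv complex_linear_def\<close>)
  from arg_cong[OF this, of "\<lambda>a. blinfun_apply a v"] show ?thesis by simp
qed

lemma \<rho>_adjoint: "cinner (\<rho> (inv x) v) w = cinner v (\<rho> x w)"
  using \<rho>_isometry[of x "\<rho> (inv x) v" w] by (simp add: \<rho>_inv)

lemma \<rho>_one: "\<rho> x (e one) = e x"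
  by (simp add: \<rho>_e mul_one)

definition N :: "('h \<Rightarrow>\<^sub>L 'h) set" where "N = commutant (range \<rho>)"

lemma N_iff: "x \<in> N \<longleftrightarrow> complex_linear x \<and> (\<forall>y v. x (\<rho> y v) = \<rho> y (x v))"
proof -
  have "x o\<^sub>L \<rho> y = \<rho> y o\<^sub>L x \<longleftrightarrow> (\<forall>v. x (\<rho> y v) = \<rho> y (x v))" for y
    by (metis blinfun_apply_blinfun_compose blinfun_eqI)
  then show ?thesis unfolding N_def commutant_def bounded_operators_eq by simp
qed

lemma N_bounded: "x \<in> N \<Longrightarrow> x \<in> bounded_operators"
  by (simp add: N_iff bounded_operators_eq)

lemma von_neumann_algebra_N: "von_neumann_algebra N"
  unfolding N_def
proof (rule von_neumann_algebra_commutant)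
  have "adjoint_operator (\<rho> x) = \<rho> (inv x)" for x
    by (rule adjoint_operator_eqI) (rule \<rho>_adjoint)
  then show "adjoint_operator y \<in> range \<rho>" if "y \<in> range \<rho>" for y using that by auto
qed (auto simp: bounded_operators_eq \<rho>_linear)

lemma N_compose: "x \<in> N \<Longrightarrow> y \<in> N \<Longrightarrow> x o\<^sub>L y \<in> N"
  by (simp add: N_iff complex_linear_compose)

text \<open>The cyclic vector separates \<open>N\<close>: the operators \<open>\<rho> z\<close>,
  with which \<open>N\<close> commutes, move it to every \<open>e z\<close>.\<close>

lemma N_eqI:
  assumes "x \<in> N" "y \<in> N" "x (e one) = y (e one)"
  shows "x = y"
proof (rule total_family_blinfun_eqI[OF total])
  fix z
  show "x (e z) = y (e z)"
    using assms unfolding N_iff \<rho>_one[of z, symmetric] by simp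
qed (use assms in \<open>auto simp: N_iff\<close>)

text \<open>The modular conjugation of the trace. It is antilinear, so it comes from the real
  extension theorem and its values are recorded with the scalars.\<close>

definition J :: "'h \<Rightarrow>\<^sub>L 'h" where
  "J = (SOME j. \<forall>c x. blinfun_apply j (c *\<^sub>C e x) = cnj c *\<^sub>C e (inv x))"

lemma J_e: "J (c *\<^sub>C e x) = cnj c *\<^sub>C e (inv x)"
proof -
  have "inner (c *\<^sub>C e x) (d *\<^sub>C e y) = inner (cnj c *\<^sub>C e (inv x)) (cnj d *\<^sub>C e (inv y))" for c d x y
    unfolding inner_Re_cinner cinner_scaleC_left cinner_scaleC_right gram_inv
    by (subst cinner_commute[of "e x"]) (simp add: algebra_simps)
  then obtain j :: "'h \<Rightarrow>\<^sub>L 'h" where "\<And>z. j ((\<lambda>(c, x). c *\<^sub>C e x) z) = (\<lambda>(c, x). cnj c *\<^sub>C e (inv x)) z"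
    using isometric_extension[OF _ total_family_dense[OF total], of "\<lambda>(c, x). cnj c *\<^sub>C e (inv x)"]
    by (metis (no_types, lifting) case_prod_beta)
  then have "\<exists>j :: 'h \<Rightarrow>\<^sub>L 'h. \<forall>c x. j (c *\<^sub>C e x) = cnj c *\<^sub>C e (inv x)" by (intro exI[of _ j]) force
  from someI_ex[OF this] show ?thesis unfolding J_def[symmetric] by blast
qed

text \<open>Each side is continuous and bilinear in (v, w), since \<open>J\<close> and the first
  slot of \<open>cinner\<close> are both antilinear. On generators the equation is
  \<open>gram_inv\<close>.\<close>

lemma J_swap: "cinner (J v) w = cinner (J w) v"
proof (rule total_family_induct[OF total, of "\<lambda>v. cinner (J v) w = cinner (J w) v"])
  show "cinner (J (c *\<^sub>C e x)) w = cinner (J w) (c *\<^sub>C e x)" for c x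
  proof (rule total_family_induct[OF total, of "\<lambda>w. cinner (J (c *\<^sub>C e x)) w = cinner (J w) (c *\<^sub>C e x)"])
    show "cinner (J (c *\<^sub>C e x)) (d *\<^sub>C e y) = cinner (J (d *\<^sub>C e y)) (c *\<^sub>C e x)" for d y
      using gram_inv[of x "inv y"]
      by (simp add: J_e cinner_scaleC_left cinner_scaleC_right inv_inv mult_ac)
    show "closed {w. cinner (J (c *\<^sub>C e x)) w = cinner (J w) (c *\<^sub>C e x)}"
      by (intro closed_Collect_eq cinner.continuous_on continuous_intros)
    show "subspace {w. cinner (J (c *\<^sub>C e x)) w = cinner (J w) (c *\<^sub>C e x)}"
      by (rule subspaceI) (auto simp: blinfun.bilinear_simps cinner.add_left cinner.add_right
          cinner.scaleR_left cinner.scaleR_right)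
  qed
  show "closed {v. cinner (J v) w = cinner (J w) v}"
    by (intro closed_Collect_eq cinner.continuous_on continuous_intros)
  show "subspace {v. cinner (J v) w = cinner (J w) v}"
    by (rule subspaceI) (auto simp: blinfun.bilinear_simps cinner.add_left cinner.add_right
        cinner.scaleR_left cinner.scaleR_right)
qed

text \<open>The family \<open>r\<close> is left open so that the argument serves twice: with right
  multiplications for elements of \<open>N\<close>, and with left translations for operators
  commuting with those.\<close>

lemma adjoint_one_eq_J:
  assumes x: "x \<in> bounded_operators"
    and r: "\<And>y. r y (e one) = e y" "\<And>y v w. cinner (r (inv y) v) w = cinner v (r y w)"
    and comm: "\<And>y. x (e y) = r y (x (e one))"
  shows "adjoint_operator x (e one) = J (x (e one))"
proof -
  have "cinner (e y) (adjoint_operator x (e one)) = cinner (e y) (J (x (e one)))" for y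
  proof -
    have "cinner (J (x (e one))) (e y) = cinner (J (1 *\<^sub>C e y)) (x (e one))"
      using J_swap[of "x (e one)" "e y"] by simp
    also have "\<dots> = cinner (e (inv y)) (x (e one))" by (simp only: J_e) simp
    also have "\<dots> = cinner (e one) (r y (x (e one)))" using r(2)[of y "e one"] by (simp add: r(1))
    also have "\<dots> = cinner (adjoint_operator x (e one)) (e y)"
      by (simp only: cinner_adjoint_operator[OF x] comm[of y])
    finally show ?thesis
      unfolding cinner_commute[of "e y" "adjoint_operator x (e one)"] cinner_commute[of "e y" "J (x (e one))"]
      by (rule arg_cong[OF sym])
  qed
  then have "\<forall>y. cinner (e y) (adjoint_operator x (e one) - J (x (e one))) = 0"
    by (simp only: cinner.diff_right diff_self simp_thms)
  then have "adjoint_operator x (e one) - J (x (e one)) = 0"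
    using total unfolding total_family_def by blast
  then show ?thesis by simp
qed

text \<open>With \<Omega> the cyclic vector, <\<Omega>, x y \<Omega>> = <J x \<Omega>, y \<Omega>>,
  and \<open>J_swap\<close> exchanges x and y.\<close>

lemma vector_state_commute:
  assumes "adjoint_operator x (e one) = J (x (e one))" "x \<in> bounded_operators"
    and "adjoint_operator y (e one) = J (y (e one))" "y \<in> bounded_operators"
  shows "cinner (e one) (x (y (e one))) = cinner (e one) (y (x (e one)))"
proof -
  have "cinner (e one) (x (y (e one))) = cinner (J (x (e one))) (y (e one))"
    using cinner_adjoint_operator[OF assms(2), of "e one"] assms(1) by simp
  also have "\<dots> = cinner (J (y (e one))) (x (e one))" by (rule J_swap)
  also have "\<dots> = cinner (e one) (y (x (e one)))"
    using cinner_adjoint_operator[OF assms(4), of "e one"] assms(3) by simp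
  finally show ?thesis .
qed

lemma adjoint_one_N: "x \<in> N \<Longrightarrow> adjoint_operator x (e one) = J (x (e one))"
proof (rule adjoint_one_eq_J[of x \<rho>])
  assume x: "x \<in> N"
  show "x (e y) = \<rho> y (x (e one))" for y
    using x unfolding N_iff \<rho>_one[of y, symmetric] by simp
qed (simp_all add: N_bounded \<rho>_one \<rho>_adjoint)

lemma trace_N:
  "x \<in> N \<Longrightarrow> y \<in> N \<Longrightarrow> vector_state (e one) (x o\<^sub>L y) = vector_state (e one) (y o\<^sub>L x)"
  by (simp add: vector_state_def vector_state_commute adjoint_one_N N_bounded)

lemma normal_faithful_state_N: "normal_faithful_state N (vector_state (e one))"
proof -
  have *: "vector_state (e one) (adjoint_operator x o\<^sub>L x) = of_real ((norm (x (e one)))\<^sup>2)" if "x \<in> N" for x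
    using that by (simp add: vector_state_def cinner_adjoint_operator_right N_bounded cinner_self)
  have "x = 0" if "x \<in> N" "vector_state (e one) (adjoint_operator x o\<^sub>L x) = 0" for x
  proof (rule N_eqI)
    show "0 \<in> N" by (simp add: N_iff complex_linear_def scaleC.zero_right)
    show "x (e one) = blinfun_apply 0 (e one)" using that *[OF that(1)] by simp
  qed fact
  then show ?thesis
    unfolding normal_faithful_state_def
    by (auto simp: * norm_one vector_state_predual vector_state_def[of _ id_blinfun] simp del: of_real_power)
qed

text \<open>For a trace the KMS condition of the trivial flow is met by a constant function.\<close>

lemma modular_group_N: "is_modular_group N (vector_state (e one)) (\<lambda>t x. x)"
  unfolding is_modular_group_def
proof (intro conjI ballI)
  show "weak_star_continuous_automorphism_group N (\<lambda>t x. x)"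
    by (auto simp: weak_star_continuous_automorphism_group_def star_automorphism_def
        star_homomorphism_def linear_on_vna_def bij_betw_def)
  show "leaves_invariant N (vector_state (e one)) (\<lambda>t x. x)" by (simp add: leaves_invariant_def)
  fix x y assume "x \<in> N" "y \<in> N"
  let ?F = "\<lambda>_::complex. vector_state (e one) (x o\<^sub>L y)"
  show "\<exists>F. continuous_on {z. 0 \<le> Im z \<and> Im z \<le> 1} F \<and> bounded (F ` {z. 0 \<le> Im z \<and> Im z \<le> 1}) \<and>
      F holomorphic_on {z. 0 < Im z \<and> Im z < 1} \<and>
      (\<forall>t::real. F (of_real t) = vector_state (e one) (x o\<^sub>L y) \<and>
        F (of_real t + \<i>) = vector_state (e one) (y o\<^sub>L x))"
  proof (intro exI[of _ ?F] conjI allI)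
    show "bounded (?F ` {z. 0 \<le> Im z \<and> Im z \<le> 1})"
      by (rule bounded_subset[of "{vector_state (e one) (x o\<^sub>L y)}"]) auto
    show "vector_state (e one) (x o\<^sub>L y) = vector_state (e one) (y o\<^sub>L x)"
      by (intro trace_N \<open>x \<in> N\<close> \<open>y \<in> N\<close>)
  qed simp_all
qed

end

section \<open>VN(G) as the commutant of the right translations, the case of the delta function at
  the neutral element\<close>

interpretation vn: central_gram "basis_vector :: 'g::group_add \<Rightarrow> 'g ell2" "(+)" uminus 0
proof
  show "cinner (basis_vector (- x)) (basis_vector (- y)) = cinner (basis_vector y) (basis_vector x)" for x y :: 'g
    by (simp add: cinner_basis_vectors eq_commute)
qed (simp_all add: total_family_basis_vector cinner_basis_vectors add.assoc)

lemma left_translation_basis_vector: "left_translation s (basis_vector t) = basis_vector (s + t)"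
  by (simp add: left_translation.rep_eq translate_basis_vector)

lemma complex_linear_left_translation: "complex_linear (left_translation s)"
  unfolding complex_linear_def left_translation.rep_eq by transfer simp

lemma left_translation_compose: "left_translation s o\<^sub>L left_translation t = left_translation (s + t)"
  by (rule total_family_blinfun_eqI[OF total_family_basis_vector])
    (simp_all add: complex_linear_left_translation complex_linear_compose left_translation_basis_vector add.assoc)

lemma left_translation_zero: "left_translation 0 = id_blinfun"
  by (rule total_family_blinfun_eqI[OF total_family_basis_vector])
    (simp_all add: complex_linear_left_translation left_translation_basis_vector, simp add: complex_linear_def)

lemma cinner_left_translation: "cinner (left_translation (- s) v) w = cinner v (left_translation s w)"
proof -
  have "cinner (left_translation s u) (left_translation s w) = cinner u w" for u
  proof -
    have nrm: "inner (left_translation s u) (left_translation s w) = inner u w" for u w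
    proof -
      have "norm (left_translation s u) = norm u" for u
        by (simp add: left_translation.rep_eq norm_translate)
      from this[of "u + w"] this[of u] this[of w] show ?thesis
        by (simp add: blinfun.add_right norm_eq_sqrt_inner inner_add_left inner_add_right inner_commute)
    qed
    then show ?thesis using nrm[of u "\<i> *\<^sub>C w"]
      by (simp add: complex_eq_iff Im_cinner complex_linearD[OF complex_linear_left_translation] flip: inner_Re_cinner)
  qed
  from this[of "left_translation (- s) v"] left_translation_compose[of s "- s"] show ?thesis
    by (metis blinfun_apply_blinfun_compose id_blinfun.rep_eq left_translation_zero right_minus)
qed

lemma left_translation_N: "left_translation s \<in> vn.N"
proof -
  have "left_translation s o\<^sub>L vn.\<rho> t = vn.\<rho> t o\<^sub>L left_translation s" for t
    by (rule total_family_blinfun_eqI[OF total_family_basis_vector])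
      (simp_all add: complex_linear_left_translation vn.\<rho>_linear complex_linear_compose
        left_translation_basis_vector vn.\<rho>_e add.assoc)
  then show ?thesis
    unfolding vn.N_iff using complex_linear_left_translation by (metis blinfun_apply_blinfun_compose)
qed

text \<open>With \<open>\<Omega>\<close> the cyclic vector, both \<open>x\<^sup>*\<Omega> = J x\<Omega>\<close> and \<open>y\<^sup>*\<Omega> = J y\<Omega>\<close> hold, whence \<open>xy\<close> and \<open>yx\<close> have the same
  vector state; the other matrix coefficients follow by translating \<open>x\<close>.\<close>

lemma N_commutes_commutant_left:
  assumes x: "x \<in> vn.N" and y: "y \<in> commutant (range (left_translation :: 'g::group_add \<Rightarrow> _))"
  shows "x o\<^sub>L y = y o\<^sub>L x"
proof -
  have yb: "y \<in> bounded_operators" using y commutant_bounded by blast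
  have yl: "y (left_translation s v) = left_translation s (y v)" for s v
    using y unfolding commutant_def by (metis (mono_tags, lifting) mem_Collect_eq blinfun_apply_blinfun_compose rangeI)
  have yJ: "adjoint_operator y (basis_vector 0) = vn.J (y (basis_vector 0))"
  proof (rule vn.adjoint_one_eq_J[OF yb, of left_translation])
    show "y (basis_vector s) = left_translation s (y (basis_vector 0))" for s
      using yl[of s "basis_vector 0"] by (simp add: left_translation_basis_vector)
  qed (simp_all add: left_translation_basis_vector cinner_left_translation)
  have "cinner (basis_vector s) (x (y (basis_vector t))) = cinner (basis_vector s) (y (x (basis_vector t)))" for s t
  proof -
    define z where "z = left_translation (- s) o\<^sub>L x o\<^sub>L left_translation t"
    have z: "z \<in> vn.N" unfolding z_def by (intro vn.N_compose left_translation_N x)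
    have "cinner (basis_vector 0) (z (y (basis_vector 0))) = cinner (basis_vector 0) (y (z (basis_vector 0)))"
      by (intro vn.vector_state_commute vn.adjoint_one_N vn.N_bounded z yJ yb)
    then have "cinner (left_translation s (basis_vector 0)) (x (y (left_translation t (basis_vector 0))))
        = cinner (left_translation s (basis_vector 0)) (y (x (left_translation t (basis_vector 0))))"
      using cinner_left_translation[of "- s"] by (simp add: z_def yl)
    then show ?thesis by (simp add: left_translation_basis_vector)
  qed
  then have "x (y (basis_vector t)) = y (x (basis_vector t))" for t
    by (intro Rep_ell2_ext) (simp add: cinner_basis_vector)
  then show ?thesis
    using x yb by (intro total_family_blinfun_eqI[OF total_family_basis_vector])
      (simp_all add: vn.N_iff complex_linear_compose bounded_operators_eq)
qed

text \<open>\<open>vn.N\<close> is one of the algebras in the intersection defining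
  \<open>group_vna\<close>. For any other such \<open>M\<close>, it commutes with the commutant of
  \<open>M\<close>, hence lies in the bicommutant \<open>M\<close>.\<close>

lemma group_vna_eq: "group_vna = vn.N"
proof
  show "group_vna \<subseteq> vn.N"
    unfolding group_vna_def generated_vna_def
    using vn.von_neumann_algebra_N left_translation_N by blast
  show "vn.N \<subseteq> (group_vna :: ('a ell2 \<Rightarrow>\<^sub>L 'a ell2) set)"
    unfolding group_vna_def generated_vna_def
  proof (intro subsetI InterI)
    fix x :: "'a ell2 \<Rightarrow>\<^sub>L 'a ell2" and M :: "('a ell2 \<Rightarrow>\<^sub>L 'a ell2) set"
    assume x: "x \<in> vn.N" and "M \<in> {M. von_neumann_algebra M \<and> range left_translation \<subseteq> M}"
    then have M: "commutant (commutant M) = M" "range left_translation \<subseteq> M"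
      by (auto simp: von_neumann_algebra_def)
    have "x o\<^sub>L y = y o\<^sub>L x" if "y \<in> commutant M" for y :: "'a ell2 \<Rightarrow>\<^sub>L 'a ell2"
      using N_commutes_commutant_left[OF x] commutant_antimono[OF M(2)] that by blast
    then have "x \<in> commutant (commutant M)" using vn.N_bounded[OF x] by (simp add: commutant_def)
    then show "x \<in> M" by (simp add: M(1))
  qed
qed

lemma group_trace_eq: "group_trace = vector_state (basis_vector 0)"
  by (simp add: fun_eq_iff group_trace_def vector_state_def)

section \<open>The symbol of a semigroup of multipliers\<close>

definition coefficient :: "('g::group_add ell2 \<Rightarrow>\<^sub>L 'g ell2) \<Rightarrow> 'g \<Rightarrow> complex" where
  "coefficient x s = cinner (basis_vector s) (blinfun_apply x (basis_vector 0))"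

lemma coefficient_left_translation: "coefficient (left_translation s) r = (if s = r then 1 else 0)"
  by (simp add: coefficient_def left_translation_basis_vector cinner_basis_vectors)

lemma coefficient_scale: "coefficient (scale_operator c x) s = c * coefficient x s"
  by (simp add: coefficient_def scale_operator.rep_eq cinner_scaleC_right)

lemma group_trace_left_translation: "group_trace (left_translation (- s) o\<^sub>L x) = coefficient x s"
  using cinner_left_translation[of "- s" "basis_vector 0"]
  by (simp add: group_trace_def coefficient_def left_translation_basis_vector)

lemma coefficient_eqI:
  assumes "x \<in> group_vna" "y \<in> group_vna" "\<And>s. coefficient x s = coefficient y s"
  shows "x = y"
  using assms unfolding group_vna_eq
  by (intro vn.N_eqI) (auto intro!: Rep_ell2_ext simp: coefficient_def cinner_basis_vector)

lemma left_translation_group_vna: "left_translation s \<in> group_vna"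
  by (simp add: group_vna_eq left_translation_N)

text \<open>The matrix factors as R* R, where R is the row of the unitaries \<lambda>_(s j).\<close>

lemma positive_translation_matrix:
  "positive_operator_matrix n (\<lambda>i j. left_translation (- s i + s j))"
  unfolding positive_operator_matrix_def
proof
  fix \<xi> :: "nat \<Rightarrow> 'a ell2"
  have "cinner (\<xi> i) (left_translation (- s i + s j) (\<xi> j))
      = cinner (left_translation (s i) (\<xi> i)) (left_translation (s j) (\<xi> j))" for i j
    using cinner_left_translation[of "- s i" "\<xi> i"]
    by (simp flip: left_translation_compose)
  then have "(\<Sum>i<n. \<Sum>j<n. cinner (\<xi> i) (left_translation (- s i + s j) (\<xi> j)))
      = cinner (\<Sum>i<n. left_translation (s i) (\<xi> i)) (\<Sum>j<n. left_translation (s j) (\<xi> j))"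
    by (simp add: cinner.sum_left cinner.sum_right) (rule sum.swap)
  then show "(\<Sum>i<n. \<Sum>j<n. cinner (\<xi> i) (left_translation (- s i + s j) (\<xi> j))) \<in> \<real>\<^sub>\<ge>\<^sub>0"
    by (simp add: cinner_self del: of_real_power)
qed

locale multiplier =
  fixes S :: "('g::group_add ell2 \<Rightarrow>\<^sub>L 'g ell2) \<Rightarrow> ('g ell2 \<Rightarrow>\<^sub>L 'g ell2)"
  assumes fourier: "fourier_multiplier S" and markov: "selfadjoint_markov_map group_vna group_trace S"
begin

definition a :: "'g \<Rightarrow> complex" where "a s = coefficient (S (left_translation s)) s"

lemma S_left_translation: "S (left_translation s) = scale_operator (a s) (left_translation s)"
proof -
  obtain b where "\<And>s. S (left_translation s) = scale_operator (b s) (left_translation s)"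
    using fourier by (auto simp: fourier_multiplier_def)
  then show ?thesis by (simp add: a_def coefficient_scale coefficient_left_translation)
qed

text \<open>The coefficient is a trace against \<lambda>_(-s). Selfadjointness moves
  \<open>S\<close> onto \<lambda>_(-s), where it is a scalar, so the formula reaches all of VN(G)
  directly.\<close>

lemma coefficient_S: "x \<in> group_vna \<Longrightarrow> coefficient (S x) s = a (- s) * coefficient x s"
proof -
  assume x: "x \<in> group_vna"
  have "group_trace (S (left_translation (- s)) o\<^sub>L x) = group_trace (left_translation (- s) o\<^sub>L S x)"
    using markov x left_translation_group_vna
    by (auto simp: selfadjoint_markov_map_def is_markov_adjoint_def)
  then have "coefficient (S x) s = group_trace (scale_operator (a (- s)) (left_translation (- s)) o\<^sub>L x)"
    by (simp add: group_trace_left_translation S_left_translation)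
  also have "\<dots> = a (- s) * group_trace (left_translation (- s) o\<^sub>L x)"
    by (simp add: group_trace_def scale_operator.rep_eq cinner_scaleC_right)
  finally show ?thesis by (simp add: group_trace_left_translation)
qed

lemma a_minus: "a (- s) = a s"
  using coefficient_S[OF left_translation_group_vna, of s s]
  by (simp add: coefficient_left_translation a_def)

lemma a_zero: "a 0 = 1"
proof -
  have "S id_blinfun = id_blinfun" using markov by (simp add: selfadjoint_markov_map_def markov_map_def)
  then show ?thesis
    by (simp add: a_def left_translation_zero) (simp add: coefficient_left_translation flip: left_translation_zero)
qed

lemma a_positive: "(\<Sum>i<n::nat. \<Sum>j<n. cnj (c i) * c j * a (- s i + s j)) \<in> \<real>\<^sub>\<ge>\<^sub>0"
proof -
  have "completely_positive group_vna group_vna S"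
    using markov by (simp add: selfadjoint_markov_map_def markov_map_def)
  then have "positive_operator_matrix n (\<lambda>i j. S (left_translation (- s i + s j)))"
    unfolding completely_positive_def
    by (elim conjE allE[of _ n] allE[of _ "\<lambda>i j. left_translation (- s i + s j)"])
      (simp add: positive_translation_matrix left_translation_group_vna)
  \<comment> \<open>\<lambda>_(-s i + s j) sends the basis vector at -s j to the one at -s i, so
    only the symbol and the coefficients survive in the inner products.\<close>
  then have "(\<Sum>i<n. \<Sum>j<n. cinner (c i *\<^sub>C basis_vector (- s i))
      (S (left_translation (- s i + s j)) (c j *\<^sub>C basis_vector (- s j)))) \<in> \<real>\<^sub>\<ge>\<^sub>0"
    unfolding positive_operator_matrix_def by (rule allE[of _ "\<lambda>i. c i *\<^sub>C basis_vector (- s i)"])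
  then show ?thesis
    by (simp add: S_left_translation scale_operator.rep_eq complex_linearD[OF complex_linear_left_translation]
        left_translation_basis_vector cinner_scaleC_left cinner_scaleC_right cinner_basis_vectors
        add.assoc mult_ac)
qed

lemma a_real: "a s = of_real (Re (a s))" and a_le_1: "Re (a s) \<le> 1"
proof -
  have 2: "{..<2::nat} = {0, 1}" by auto
  \<comment> \<open>Positivity at the two points 0 and s, with coefficients (1, 1) here and (1, -1)
    below.\<close>
  have "2 + 2 * a s \<in> \<real>\<^sub>\<ge>\<^sub>0"
    using a_positive[of "\<lambda>_. 1" "\<lambda>i. if i = 0 then 0 else s" 2]
    by (simp add: 2 a_zero a_minus add.commute)
  then have "Im (2 + 2 * a s) = 0" by (simp add: complex_nonneg_Reals_iff)
  then show "a s = of_real (Re (a s))" by (simp add: complex_eq_iff)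
  have "2 - 2 * a s \<in> \<real>\<^sub>\<ge>\<^sub>0"
    using a_positive[of "\<lambda>i. if i = 0 then 1 else -1" "\<lambda>i. if i = 0 then 0 else s" 2] by (simp add: 2 a_zero a_minus)
  then show "Re (a s) \<le> 1" by (simp add: complex_nonneg_Reals_iff)
qed

lemma psd_kernel_a: "psd_kernel (\<lambda>s r. Re (a (- s + r)))"
proof (rule psd_kernelI)
  show "Re (a (- s + r)) = Re (a (- r + s))" for s r
    using a_minus[of "- s + r"] by (simp add: minus_add)
  fix n :: nat and x :: "nat \<Rightarrow> 'g" and c :: "nat \<Rightarrow> real"
  have "Re (\<Sum>i<n. \<Sum>j<n. cnj (of_real (c i)) * of_real (c j) * a (- x i + x j)) \<ge> 0"
    using a_positive[of "\<lambda>i. of_real (c i)" x n] by (simp only: complex_nonneg_Reals_iff)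
  then show "0 \<le> (\<Sum>i<n. \<Sum>j<n. c i * c j * Re (a (- x i + x j)))"
    by (simp add: mult.assoc)
qed

end

text \<open>Nonnegativity makes \<open>f\<close> increasing. With m the floor of n t, f(n t) lies
  between m f(1) and (m + 1) f(1), so n |f(t) - t f(1)| stays bounded in n.\<close>

lemma additive_nonneg_linear:
  fixes f :: "real \<Rightarrow> real"
  assumes add: "\<And>t u. t \<ge> 0 \<Longrightarrow> u \<ge> 0 \<Longrightarrow> f (t + u) = f t + f u"
    and nonneg: "\<And>t. t \<ge> 0 \<Longrightarrow> f t \<ge> 0" and "t \<ge> 0"
  shows "f t = t * f 1"
proof -
  have f0: "f 0 = 0" using add[of 0 0] by simp
  have mult: "f (real n * u) = real n * f u" if "u \<ge> 0" for n u
    by (induction n) (use that in \<open>simp_all add: f0 add distrib_right\<close>)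
  have mono: "f u \<le> f v" if "0 \<le> u" "u \<le> v" for u v
    using add[of u "v - u"] nonneg[of "v - u"] that by simp
  have bound: "real n * \<bar>f t - t * f 1\<bar> \<le> f 1" for n
  proof -
    define m where "m = nat \<lfloor>real n * t\<rfloor>"
    have m: "real m \<le> real n * t" "real n * t \<le> real m + 1"
      using \<open>t \<ge> 0\<close> by (simp_all add: m_def)
    have "f (real m) \<le> f (real n * t)" "f (real n * t) \<le> f (real (Suc m))"
      by (intro mono; use m \<open>t \<ge> 0\<close> in simp)+
    then have "real m * f 1 \<le> real n * f t" "real n * f t \<le> (real m + 1) * f 1"
      using mult[of 1 m] mult[of 1 "Suc m"] mult[of t n] \<open>t \<ge> 0\<close> by (simp_all add: add.commute)
    moreover have "real m * f 1 \<le> real n * t * f 1" "real n * t * f 1 \<le> (real m + 1) * f 1"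
      using m nonneg[of 1] by (intro mult_right_mono; simp)+
    ultimately have "\<bar>real n * f t - real n * t * f 1\<bar> \<le> f 1" by (simp add: algebra_simps abs_le_iff)
    moreover have "real n * \<bar>f t - t * f 1\<bar> = \<bar>real n * f t - real n * t * f 1\<bar>"
      by (simp add: mult.assoc abs_mult flip: right_diff_distrib)
    ultimately show ?thesis by simp
  qed
  show ?thesis
  proof (rule ccontr)
    assume "f t \<noteq> t * f 1"
    then obtain n where "f 1 < real n * \<bar>f t - t * f 1\<bar>"
      using reals_Archimedean3[of "\<bar>f t - t * f 1\<bar>"] by auto
    with bound[of n] show False by simp
  qed
qed

lemma exp_difference_quotient:
  "(\<lambda>n. real (Suc n) * (1 - exp (- (x / real (Suc n))))) \<longlonglongrightarrow> x"
proof (cases "x = 0")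
  case False
  have "((\<lambda>h. (exp h - 1) / h) \<longlongrightarrow> 1) (at (0::real))"
    using DERIV_exp[of "0::real"] by (simp add: DERIV_def)
  moreover have "filterlim (\<lambda>n. - (x / real (Suc n))) (at 0) sequentially"
  proof (rule filterlim_atI)
    show "(\<lambda>n. - (x / real (Suc n))) \<longlonglongrightarrow> 0"
      using tendsto_mult[OF tendsto_const[of "- x"] LIMSEQ_inverse_real_of_nat] by (simp add: divide_inverse)
  qed (use False in simp)
  ultimately have "(\<lambda>n. (exp (- (x / real (Suc n))) - 1) / (- (x / real (Suc n)))) \<longlonglongrightarrow> 1"
    by (rule filterlim_compose)
  from tendsto_mult[OF tendsto_const[of x] this]
  have "(\<lambda>n. x * ((exp (- (x / real (Suc n))) - 1) / (- (x / real (Suc n))))) \<longlonglongrightarrow> x" by simp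
  moreover have "x * ((exp (- (x / real (Suc n))) - 1) / (- (x / real (Suc n))))
      = real (Suc n) * (1 - exp (- (x / real (Suc n))))" for n
  proof -
    have "x * ((u - 1) / (- (x / m))) = m * (1 - u)" if "m > 0" for u m :: real
      using that False by (simp add: field_simps)
    then show ?thesis by simp
  qed
  ultimately show ?thesis by (simp only:)
qed simp

text \<open>Contains one half of Schoenberg's theorem: if exp(-t \<psi>) is positive definite for
  all t >= 0, then \<psi> is conditionally negative definite, which is encoded by the kernel
  anchored at the neutral element.\<close>

lemma multiplier_semigroup_symbol:
  fixes T :: "real \<Rightarrow> ('g::group_add ell2 \<Rightarrow>\<^sub>L 'g ell2) \<Rightarrow> ('g ell2 \<Rightarrow>\<^sub>L 'g ell2)"
  assumes semigroup: "weak_star_continuous_semigroup group_vna T"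
    and T: "\<And>t. t \<ge> 0 \<Longrightarrow> multiplier (T t)"
  shows "\<exists>\<psi> :: 'g \<Rightarrow> real. \<psi> 0 = 0 \<and> (\<forall>s. \<psi> (- s) = \<psi> s) \<and>
    psd_kernel (\<lambda>s r. (\<psi> s + \<psi> r - \<psi> (- s + r)) / 2) \<and>
    (\<forall>t\<ge>0. \<forall>x\<in>group_vna. \<forall>s. coefficient (T t x) s = exp (- t * \<psi> s) * coefficient x s)"
proof -
  define A where "A t s = Re (coefficient (T t (left_translation s)) s)" for t s
  have a: "multiplier.a (T t) s = of_real (A t s)" if "t \<ge> 0" for t s
    using multiplier.a_real[OF T[OF that]] multiplier.a_def[OF T[OF that]] by (simp add: A_def)
  have coef: "coefficient (T t x) s = A t s * coefficient x s" if "t \<ge> 0" "x \<in> group_vna" for t s x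
    using multiplier.coefficient_S[OF T] multiplier.a_minus[OF T] that a[OF that(1)] by simp
  have A_add: "A (t + u) s = A t s * A u s" if "t \<ge> 0" "u \<ge> 0" for t u s
  proof -
    have "T u \<in> group_vna \<rightarrow> group_vna"
      using semigroup that by (simp add: weak_star_continuous_semigroup_def)
    then have "T u (left_translation s) \<in> group_vna"
      using left_translation_group_vna by (rule funcset_mem)
    moreover have "T (t + u) (left_translation s) = T t (T u (left_translation s))"
      using semigroup that by (simp add: weak_star_continuous_semigroup_def left_translation_group_vna)
    ultimately show ?thesis
      using coef[OF that(1), of "T u (left_translation s)" s] coef[OF that(2) left_translation_group_vna, of s s]
      by (simp add: A_def[of "t + u"] coefficient_left_translation)
  qed
  have A_0: "A 0 s = 1" for s
    using semigroup
    by (simp add: A_def weak_star_continuous_semigroup_def coefficient_left_translation left_translation_group_vna)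
  have A_zero: "A t 0 = 1" if "t \<ge> 0" for t
    using multiplier.a_zero[OF T[OF that]] a[OF that, of 0] by simp
  have A_minus: "A t (- s) = A t s" if "t \<ge> 0" for t s
    using multiplier.a_minus[OF T[OF that], of s] a[OF that] by simp
  have A_le: "A t s \<le> 1" if "t \<ge> 0" for t s
    using multiplier.a_le_1[OF T[OF that], of s] a[OF that] by simp
  have A_psd: "psd_kernel (\<lambda>s r. A t (- s + r))" if "t \<ge> 0" for t
    using multiplier.psd_kernel_a[OF T[OF that]] a[OF that] by simp
  have A_cont: "continuous_on {0..} (\<lambda>t. A t s)" for s
  proof -
    have "(\<lambda>x. coefficient x s) \<in> predual group_vna"
      unfolding coefficient_def by (rule vector_functional_predual)
    then have "continuous_on {0..} (\<lambda>t. coefficient (T t (left_translation s)) s)"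
      using semigroup unfolding weak_star_continuous_semigroup_def
      by (elim conjE) (drule bspec, rule left_translation_group_vna[of s], drule (1) bspec, assumption)
    then show ?thesis unfolding A_def by (rule continuous_on_Re)
  qed
  \<comment> \<open>A zero at t would descend to all t / 2^n by taking square roots, against
    continuity at 0 and the value 1 there.\<close>
  have A_pos: "A t s > 0" if "t \<ge> 0" for t s
  proof -
    have half: "A (t / 2 ^ n) s = (A (t / 2 ^ Suc n) s)\<^sup>2" for n
      using A_add[of "t / 2 ^ Suc n" "t / 2 ^ Suc n" s] that by (simp add: power2_eq_square field_simps)
    have "A t s \<noteq> 0"
    proof
      assume "A t s = 0"
      then have z: "A (t / 2 ^ n) s = 0" for n
      proof (induction n)
        case (Suc n)
        then show ?case using half[of n] by (simp del: power_Suc)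
      qed simp
      have "(\<lambda>n. t * (1 / 2) ^ n) \<longlonglongrightarrow> t * 0"
        by (intro tendsto_intros LIMSEQ_power_zero) simp
      then have "(\<lambda>n. t / 2 ^ n) \<longlonglongrightarrow> 0" by (simp add: power_divide)
      then have "(\<lambda>n. A (t / 2 ^ n) s) \<longlonglongrightarrow> A 0 s"
        using that by (intro continuous_on_tendsto_compose[OF A_cont]) auto
      then show False by (simp add: z A_0 LIMSEQ_const_iff)
    qed
    moreover have "A t s \<ge> 0" using half[of 0] by simp
    ultimately show ?thesis by simp
  qed
  define \<psi> where "\<psi> s = - ln (A 1 s)" for s
  have exp: "A t s = exp (- t * \<psi> s)" if "t \<ge> 0" for t s
  proof -
    have "- ln (A t s) = t * - ln (A 1 s)"
    proof (rule additive_nonneg_linear[of "\<lambda>t. - ln (A t s)"])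
      show "- ln (A (t + u) s) = - ln (A t s) + - ln (A u s)" if "t \<ge> 0" "u \<ge> 0" for t u
        using A_pos[OF that(1), of s] A_pos[OF that(2), of s] by (simp add: A_add that ln_mult)
      show "0 \<le> - ln (A t s)" if "t \<ge> 0" for t
        using A_pos[OF that] A_le[OF that] by simp
    qed fact
    then show ?thesis using A_pos[OF that, of s] by (simp add: \<psi>_def) (metis exp_ln minus_minus mult_minus_right)
  qed
  have "psd_kernel (\<lambda>s r. (\<psi> s + \<psi> r - \<psi> (- s + r)) / 2)"
  proof (rule psd_kernel_lim)
    \<comment> \<open>Centred Gram kernels of the symbol at time 1/(n+1). Since 1 - A(s) - A(r) +
      A(-s+r) = (1 - A(s)) + (1 - A(r)) - (1 - A(-s+r)), difference quotients of exp give the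
      limit.\<close>
    define k where "k n s r = real (Suc n) / 2 * (1 - A (1 / real (Suc n)) s - A (1 / real (Suc n)) r
        + A (1 / real (Suc n)) (- s + r))" for n s r
    show "psd_kernel (k n)" for n
    proof -
      obtain v :: "'g \<Rightarrow> 'g ell2" where v: "\<And>x y. inner (v x) (v y) = A (1 / real (Suc n)) (- x + y)"
        using gram_vectors[OF A_psd[of "1 / real (Suc n)"]] by auto
      have "k n = (\<lambda>s r. real (Suc n) / 2 * inner (v s - v 0) (v r - v 0))"
        by (intro ext) (simp add: inner_diff_left inner_diff_right v k_def A_minus A_zero)
      then show ?thesis by (simp only:) (intro psd_kernel_scale psd_kernel_gram, simp)
    qed
    show "(\<lambda>n. k n s r) \<longlonglongrightarrow> (\<psi> s + \<psi> r - \<psi> (- s + r)) / 2" for s r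
    proof -
      have "(\<lambda>n. (real (Suc n) * (1 - exp (- (\<psi> s / real (Suc n)))) + real (Suc n) * (1 - exp (- (\<psi> r / real (Suc n))))
          - real (Suc n) * (1 - exp (- (\<psi> (- s + r) / real (Suc n))))) / 2) \<longlonglongrightarrow> (\<psi> s + \<psi> r - \<psi> (- s + r)) / 2"
        by (intro tendsto_intros exp_difference_quotient) simp
      then show ?thesis
        by (rule filterlim_cong[THEN iffD1, OF refl refl, rotated])
          (simp add: k_def exp field_simps)
    qed
  qed
  moreover have "\<psi> 0 = 0" "\<psi> (- s) = \<psi> s" for s
    by (simp_all add: \<psi>_def A_zero A_minus)
  ultimately show ?thesis using coef exp by (intro exI[of _ \<psi>]) simp
qed

section \<open>Reindexing square summable families\<close>

lemma summable_reindex: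
  fixes f :: "'a \<Rightarrow> real"
  assumes "f summable_on UNIV" "inj_on j A" "\<And>x. f x \<ge> 0"
  shows "(\<lambda>b. if b \<in> A then f (j b) else 0) summable_on UNIV"
    and "(\<Sum>\<^sub>\<infinity>b. if b \<in> A then f (j b) else 0) \<le> (\<Sum>\<^sub>\<infinity>a. f a)"
proof -
  have A: "f summable_on (j ` A)" using summable_on_subset_banach[OF assms(1)] by blast
  then have *: "(f \<circ> j) summable_on A" by (simp add: summable_on_reindex assms(2))
  have **: "(\<lambda>b. if b \<in> A then f (j b) else 0) summable_on UNIV \<longleftrightarrow> (f \<circ> j) summable_on A"
    by (rule summable_on_cong_neutral) auto
  show "(\<lambda>b. if b \<in> A then f (j b) else 0) summable_on UNIV" using * ** by simp
  have "(\<Sum>\<^sub>\<infinity>b. if b \<in> A then f (j b) else 0) = infsum (f \<circ> j) A"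
    by (rule infsum_cong_neutral) auto
  also have "\<dots> = infsum f (j ` A)" by (simp add: infsum_reindex assms(2))
  also have "\<dots> \<le> infsum f UNIV"
    by (rule infsum_mono_neutral) (use A assms in auto)
  finally show "(\<Sum>\<^sub>\<infinity>b. if b \<in> A then f (j b) else 0) \<le> (\<Sum>\<^sub>\<infinity>a. f a)" .
qed

text \<open>Restriction of indices along a map injective on \<open>A\<close>, filled up with zeros.
  It provides embeddings into coordinate blocks and, along the inverse map, their adjoints.\<close>

definition pull :: "('b \<Rightarrow> 'a) \<Rightarrow> 'b set \<Rightarrow> 'a ell2 \<Rightarrow>\<^sub>L 'b ell2" where
  "pull j A = Blinfun (\<lambda>v. Abs_ell2 (\<lambda>b. if b \<in> A then Rep_ell2 v (j b) else 0))"

lemma Rep_pull: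
  fixes j :: "'b \<Rightarrow> 'a"
  assumes "inj_on j A"
  shows "Rep_ell2 (pull j A v) b = (if b \<in> A then Rep_ell2 v (j b) else 0)"
proof -
  let ?P = "\<lambda>v. Abs_ell2 (\<lambda>b. if b \<in> A then Rep_ell2 v (j b) else 0)"
  have sq: "(\<lambda>b. (cmod (if b \<in> A then Rep_ell2 v (j b) else 0))\<^sup>2)
      = (\<lambda>b. if b \<in> A then (\<lambda>a. (cmod (Rep_ell2 v a))\<^sup>2) (j b) else 0)" for v
    by auto
  have summ: "(\<lambda>a. (cmod (Rep_ell2 v a))\<^sup>2) summable_on UNIV" for v
    using Rep_ell2[of v] by simp
  have rep: "Rep_ell2 (?P v) = (\<lambda>b. if b \<in> A then Rep_ell2 v (j b) else 0)" for v
    using summable_reindex(1)[OF summ assms] by (intro Abs_ell2_inverse) (simp only: mem_Collect_eq sq zero_le_power2)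
  have "bounded_linear ?P"
  proof (rule bounded_linear_intro[where K = 1])
    fix v w :: "'a ell2" and r
    show "?P (v + w) = ?P v + ?P w"
      by (rule Rep_ell2_ext) (simp add: rep plus_ell2.rep_eq)
    show "?P (r *\<^sub>R v) = r *\<^sub>R ?P v"
      by (rule Rep_ell2_ext) (simp add: rep scaleR_ell2.rep_eq)
    have "(norm (?P v))\<^sup>2 \<le> (norm v)\<^sup>2"
      unfolding norm_ell2_square rep sq by (rule summable_reindex(2)[OF summ assms]) simp
    then show "norm (?P v) \<le> norm v * 1" using power2_le_imp_le[of "norm (?P v)" "norm v"] by simp
  qed
  then have "blinfun_apply (pull j A) v = ?P v"
    by (simp only: pull_def bounded_linear_Blinfun_apply)
  then show ?thesis by (simp only: rep)
qed

lemma cinner_pull: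
  assumes j: "bij_betw j A A'" and j': "\<And>b. b \<in> A \<Longrightarrow> j' (j b) = b"
  shows "cinner (pull j A v) w = cinner v (pull j' A' w)"
proof -
  have inj: "inj_on j A" "inj_on j' A'"
    using j j' by (auto simp: bij_betw_def inj_on_def)
  have "((\<lambda>b. cnj (Rep_ell2 (pull j A v) b) * Rep_ell2 w b) has_sum cinner v (pull j' A' w)) UNIV"
  proof -
    let ?s = "cinner v (pull j' A' w)"
    have "((\<lambda>a. cnj (Rep_ell2 v a) * Rep_ell2 w (j' a)) has_sum ?s) A' \<longleftrightarrow>
        ((\<lambda>a. cnj (Rep_ell2 v a) * Rep_ell2 (pull j' A' w) a) has_sum ?s) UNIV"
      by (rule has_sum_cong_neutral) (auto simp: Rep_pull inj)
    then have "((\<lambda>b. cnj (Rep_ell2 v (j b)) * Rep_ell2 w (j' (j b))) has_sum ?s) A"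
      unfolding has_sum_reindex_bij_betw[OF j, of "\<lambda>a. cnj (Rep_ell2 v a) * Rep_ell2 w (j' a)"]
      by (simp only: has_sum_cinner_ell2)
    moreover have "((\<lambda>b. cnj (Rep_ell2 (pull j A v) b) * Rep_ell2 w b) has_sum ?s) UNIV \<longleftrightarrow>
        ((\<lambda>b. cnj (Rep_ell2 v (j b)) * Rep_ell2 w (j' (j b))) has_sum ?s) A"
      by (rule has_sum_cong_neutral) (auto simp: Rep_pull inj j')
    ultimately show ?thesis by (simp only:)
  qed
  then show ?thesis by (rule has_sum_unique[OF has_sum_cinner_ell2])
qed

section \<open>Cardinalities\<close>

lemma lepoll_iff_ordLeq:
  includes cardinal_syntax
  shows "A \<lesssim> B \<longleftrightarrow> |A| \<le>o |B|"
  by (simp add: lepoll_def card_of_ordLeq)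

lemma infinite_times_lepoll:
  assumes "infinite K" "A \<lesssim> K" "B \<lesssim> K"
  shows "A \<times> B \<lesssim> K"
proof -
  have "A \<times> B \<lesssim> K \<times> K" by (rule times_lepoll_mono[OF assms(2,3)])
  also have "K \<times> K \<approx> K"
    using card_of_Times_same_infinite[OF assms(1)] by (simp add: eqpoll_iff_card_of_ordIso)
  finally show ?thesis .
qed

lemma infinite_UN_lepoll:
  assumes "infinite K" "I \<lesssim> K" "\<And>i. i \<in> I \<Longrightarrow> A i \<lesssim> K"
  shows "(\<Union>i\<in>I. A i) \<lesssim> K"
  using assms unfolding lepoll_iff_ordLeq by (intro card_of_UNION_ordLeq_infinite) auto

lemma countable_lepoll_infinite: "countable A \<Longrightarrow> infinite K \<Longrightarrow> A \<lesssim> K"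
  by (meson countableE infinite_le_lepoll lepoll_def lepoll_trans subset_UNIV)

text \<open>Closure under differences in countably many stages; the stages increase because each
  contains 0, and an infinite bound \<open>K\<close> absorbs every step.\<close>

lemma generated_subgroup_lepoll:
  fixes S :: "'a::ab_group_add set"
  assumes K: "infinite K" and S: "S \<lesssim> K"
  shows "\<exists>D. S \<subseteq> D \<and> 0 \<in> D \<and> (\<forall>x\<in>D. \<forall>y\<in>D. x - y \<in> D) \<and> D \<lesssim> K"
proof -
  define F where "F = rec_nat (insert 0 S) (\<lambda>_ X. (\<lambda>(x, y). x - y) ` (X \<times> X))"
  have F0: "F 0 = insert 0 S" and FS: "F (Suc n) = (\<lambda>(x, y). x - y) ` (F n \<times> F n)" for n
    by (simp_all add: F_def)
  have zero: "0 \<in> F n" for n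
    by (induction n) (auto simp: F0 FS image_iff intro!: bexI[of _ "(0, 0)"])
  have "F n \<subseteq> F (Suc n)" for n
  proof
    fix x assume "x \<in> F n"
    then show "x \<in> F (Suc n)" unfolding FS using zero[of n] by (intro image_eqI[of _ _ "(x, 0)"]) auto
  qed
  then have mono: "F m \<subseteq> F n" if "m \<le> n" for m n using that by (rule lift_Suc_mono_le)
  have card: "F n \<lesssim> K" for n
  proof (induction n)
    case 0
    have "(\<Union>i\<in>{False, True}. if i then S else {0}) = insert 0 S" by auto
    moreover
    have "(\<Union>i\<in>{False, True}. if i then S else {0}) \<lesssim> K"
      using K S by (intro infinite_UN_lepoll) (auto simp: finite_lepoll_infinite)
    ultimately show ?case by (simp only: F0)
  next
    case (Suc n)
    show ?case
      unfolding FS by (rule lepoll_trans[OF image_lepoll infinite_times_lepoll[OF K Suc Suc]])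
  qed
  show ?thesis
  proof (intro exI[of _ "\<Union>n. F n"] conjI ballI)
    show "S \<subseteq> (\<Union>n. F n)" "0 \<in> (\<Union>n. F n)" using F0 by auto
    fix x y assume "x \<in> (\<Union>n. F n)" "y \<in> (\<Union>n. F n)"
    then obtain m n where "x \<in> F m" "y \<in> F n" by auto
    then have "x \<in> F (max m n)" "y \<in> F (max m n)" using mono[of m "max m n"] mono[of n "max m n"] by auto
    then have "x - y \<in> F (Suc (max m n))" unfolding FS by force
    then show "x - y \<in> (\<Union>n. F n)" by blast
  next
    show "(\<Union>n. F n) \<lesssim> K"
      using K card by (intro infinite_UN_lepoll) (auto simp: infinite_le_lepoll)
  qed
qed

section \<open>The noise of a cocycle\<close>

text \<open>The covariance of two-sided Brownian motion.\<close>

definition brownian :: "real \<Rightarrow> real \<Rightarrow> real" where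
  "brownian t u = (\<bar>t\<bar> + \<bar>u\<bar> - \<bar>t - u\<bar>) / 2"

lemma psd_kernel_brownian: "psd_kernel brownian"
proof (rule psd_kernelI)
  show "brownian t u = brownian u t" for t u by (simp add: brownian_def)
  \<comment> \<open>The signed indicator function of the interval between 0 and t;
    \<open>brownian t u\<close> is the L^2 inner product of two of them.\<close>
  define g :: "real \<Rightarrow> real \<Rightarrow> real" where "g t x = indicator {0<..t} x - indicator {t<..0} x" for t x
  have ind: "has_bochner_integral lborel (indicator {a<..b} :: real \<Rightarrow> real) (b - a)" if "a \<le> b" for a b :: real
    using has_bochner_integral_real_indicator[of "{a<..b}" lborel] that by (simp add: measure_lborel_Ioc)
  have g: "has_bochner_integral lborel (\<lambda>x. g t x * g u x) (brownian t u)" for t u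
  proof -
    consider "t \<ge> 0" "u \<ge> 0" | "t \<le> 0" "u \<le> 0" | "t > 0" "u < 0" | "t < 0" "u > 0" by linarith
    then show ?thesis
    proof cases
      case 1
      then have "(\<lambda>x. g t x * g u x) = indicator {0<..min t u}" by (auto simp: g_def fun_eq_iff indicator_def)
      moreover have "brownian t u = min t u - 0" using 1 by (auto simp: brownian_def min_def)
      ultimately show ?thesis using 1 by (simp only: ind min.boundedI)
    next
      case 2
      then have "(\<lambda>x. g t x * g u x) = indicator {max t u<..0}" by (auto simp: g_def fun_eq_iff indicator_def)
      moreover have "brownian t u = 0 - max t u" using 2 by (auto simp: brownian_def max_def)
      ultimately show ?thesis using 2 by (simp only: ind max.boundedI)
    next
      case 3
      then have "(\<lambda>x. g t x * g u x) = (\<lambda>_. 0)" by (auto simp: g_def fun_eq_iff indicator_def)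
      moreover have "brownian t u = 0" using 3 by (auto simp: brownian_def)
      ultimately show ?thesis by (simp add: has_bochner_integral_zero)
    next
      case 4
      then have "(\<lambda>x. g t x * g u x) = (\<lambda>_. 0)" by (auto simp: g_def fun_eq_iff indicator_def)
      moreover have "brownian t u = 0" using 4 by (auto simp: brownian_def)
      ultimately show ?thesis by (simp add: has_bochner_integral_zero)
    qed
  qed
  fix n :: nat and t :: "nat \<Rightarrow> real" and c
  have "has_bochner_integral lborel (\<lambda>x. \<Sum>i<n. \<Sum>j<n. c i * c j * (g (t i) x * g (t j) x))
      (\<Sum>i<n. \<Sum>j<n. c i * c j * brownian (t i) (t j))"
    by (intro has_bochner_integral_sum has_bochner_integral_mult_right g)
  moreover have "(\<Sum>i<n. \<Sum>j<n. c i * c j * (g (t i) x * g (t j) x)) = (\<Sum>i<n. c i * g (t i) x)\<^sup>2" for x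
    by (simp add: power2_eq_square sum_product mult_ac)
  ultimately have "has_bochner_integral lborel (\<lambda>x. (\<Sum>i<n. c i * g (t i) x)\<^sup>2)
      (\<Sum>i<n. \<Sum>j<n. c i * c j * brownian (t i) (t j))" by simp
  then have "(\<Sum>i<n. \<Sum>j<n. c i * c j * brownian (t i) (t j)) = (\<integral>x. (\<Sum>i<n. c i * g (t i) x)\<^sup>2 \<partial>lborel)"
    by (rule has_bochner_integral_integral_eq[symmetric])
  also have "\<dots> \<ge> 0" by (rule Bochner_Integration.integral_nonneg) simp
  finally show "0 \<le> (\<Sum>i<n. \<Sum>j<n. c i * c j * brownian (t i) (t j))" .
qed

type_synonym 'g generator = "real \<times> real \<times> 'g \<times> 'g"

text \<open>White noise over the cocycle of \<open>\<psi>\<close>: \<open>noise (a, b, r, s)\<close> plays the role of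
  \<open>1\<^bsub>[a,b]\<^esub> \<otimes> (\<delta>\<^sub>s - \<delta>\<^sub>r)\<close> in \<open>L\<^sup>2(\<real>) \<otimes> H\<close>, where \<open>H\<close> is the Hilbert space of the conditionally negative
  definite function \<open>\<psi>\<close>. On formal combinations of these generators the shift of \<open>\<real>\<close> and the action
  of the group are honest actions.\<close>

locale cocycle_noise =
  fixes \<psi> :: "'g::group_add \<Rightarrow> real"
  assumes psi_zero: "\<psi> 0 = 0" and psi_minus: "\<psi> (- s) = \<psi> s"
    and psd_psi: "psd_kernel (\<lambda>s r. (\<psi> s + \<psi> r - \<psi> (- s + r)) / 2)"
begin

text \<open>Stands for 1_[0,t] tensor b(s). The Gram kernel of a tensor product is the product of
  the Gram kernels, so Schur's theorem replaces a construction of the tensor product.\<close>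

definition \<beta> :: "real \<times> 'g \<Rightarrow> (real \<times> 'g) ell2" where
  "\<beta> = (SOME f. \<forall>x y. inner (f x) (f y) =
     brownian (fst x) (fst y) * ((\<psi> (snd x) + \<psi> (snd y) - \<psi> (- snd x + snd y)) / 2))"

lemma inner_\<beta>: "inner (\<beta> (t, s)) (\<beta> (u, r)) = brownian t u * ((\<psi> s + \<psi> r - \<psi> (- s + r)) / 2)"
proof -
  have "psd_kernel (\<lambda>x y. brownian (fst x) (fst y) * ((\<psi> (snd x) + \<psi> (snd y) - \<psi> (- snd x + snd y)) / 2))"
    by (rule psd_kernel_mult[OF psd_kernel_pullback[OF psd_kernel_brownian, of fst] psd_kernel_pullback[OF psd_psi, of snd]])
  from someI_ex[OF gram_vectors[OF this]] show ?thesis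
    unfolding \<beta>_def[symmetric] by (metis fst_conv snd_conv)
qed

fun noise :: "'g generator \<Rightarrow> (real \<times> 'g) ell2" where
  "noise (a, b, r, s) = \<beta> (b, s) - \<beta> (a, s) - \<beta> (b, r) + \<beta> (a, r)"

text \<open>\<open>\<beta>\<close> is anchored at time 0 and at the neutral element, whereas here
  only differences of times and quotients -p + q of group elements remain. Hence shifts and left
  translations preserve the Gram matrix.\<close>

lemma inner_noise:
  "inner (noise (a, b, r, s)) (noise (a', b', r', s')) =
    ((\<bar>a - b'\<bar> + \<bar>b - a'\<bar> - \<bar>a - a'\<bar> - \<bar>b - b'\<bar>) / 2) *
    ((\<psi> (- r + s') + \<psi> (- s + r') - \<psi> (- r + r') - \<psi> (- s + s')) / 2)"
  by (simp add: inner_diff_left inner_diff_right inner_add_left inner_add_right inner_\<beta> brownian_def)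
    (simp add: field_simps)

text \<open>Not injective: for instance a generator with \<open>a = b\<close> is sent to 0.
  Relations true only for vectors pass to the GNS space, which depends on labels through
  \<open>vec\<close>.\<close>

definition vec :: "('g generator \<Rightarrow>\<^sub>0 int) \<Rightarrow> (real \<times> 'g) ell2" where
  "vec c = (\<Sum>x\<in>Poly_Mapping.keys c. of_int (poly_mapping.lookup c x) *\<^sub>R noise x)"

lemma vec_superset:
  assumes "finite S" "Poly_Mapping.keys c \<subseteq> S"
  shows "vec c = (\<Sum>x\<in>S. of_int (poly_mapping.lookup c x) *\<^sub>R noise x)"
  unfolding vec_def by (rule sum.mono_neutral_left) (use assms in \<open>auto simp: in_keys_iff\<close>)

lemma vec_zero [simp]: "vec 0 = 0"
  by (simp add: vec_def)

lemma vec_frag_of [simp]: "vec (frag_of x) = noise x"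
  by (simp add: vec_def keys_frag_of)

lemma vec_diff: "vec (c - d) = vec c - vec d"
proof -
  let ?S = "Poly_Mapping.keys c \<union> Poly_Mapping.keys d"
  have "Poly_Mapping.keys (c - d) \<subseteq> ?S" by (rule keys_diff)
  then show ?thesis
    by (simp add: vec_superset[of ?S] lookup_minus scaleR_diff_left sum_subtractf)
qed

lemma vec_minus: "vec (- c) = - vec c"
  using vec_diff[of 0 c] by simp

lemma vec_add: "vec (c + d) = vec c + vec d"
  using vec_diff[of c "- d"] by (simp add: vec_minus)

lemma generator_induct [case_names zero frag_of diff]:
  fixes c :: "'a \<Rightarrow>\<^sub>0 int"
  assumes "P 0" "\<And>x. P (frag_of x)" "\<And>a b. P a \<Longrightarrow> P b \<Longrightarrow> P (a - b)"
  shows "P c"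
  by (rule frag_induction[OF subset_UNIV]) (use assms in auto)

definition relabel :: "('g generator \<Rightarrow> 'g generator) \<Rightarrow> ('g generator \<Rightarrow>\<^sub>0 int) \<Rightarrow> 'g generator \<Rightarrow>\<^sub>0 int" where
  "relabel h = frag_extend (\<lambda>x. frag_of (h x))"

lemma relabel_simps [simp]:
  "relabel h 0 = 0" "relabel h (frag_of x) = frag_of (h x)"
  "relabel h (c - d) = relabel h c - relabel h d" "relabel h (c + d) = relabel h c + relabel h d"
  "relabel h (- c) = - relabel h c"
  by (simp_all add: relabel_def frag_extend_diff frag_extend_add frag_extend_minus)

lemma relabel_relabel: "relabel h (relabel k c) = relabel (\<lambda>x. h (k x)) c"
  by (induction c rule: generator_induct) simp_all

lemma relabel_id: "(\<And>x. h x = x) \<Longrightarrow> relabel h c = c"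
  by (induction c rule: generator_induct) simp_all

lemma inner_vec_relabel:
  assumes "\<And>x y. inner (noise (h x)) (noise (h y)) = inner (noise x) (noise y)"
  shows "inner (vec (relabel h c)) (vec (relabel h d)) = inner (vec c) (vec d)"
proof (induction c rule: generator_induct)
  case (frag_of x)
  show ?case
    by (induction d rule: generator_induct) (simp_all add: assms vec_diff inner_diff_right)
qed (simp_all add: vec_diff inner_diff_left)

lemma norm_vec_relabel:
  assumes "\<And>x y. inner (noise (h x)) (noise (h y)) = inner (noise x) (noise y)"
  shows "norm (vec (relabel h c) - vec (relabel h d)) = norm (vec c - vec d)"
proof -
  have "norm (vec (relabel h (c - d))) = norm (vec (c - d))"
    unfolding norm_eq_sqrt_inner inner_vec_relabel[OF assms] ..
  then show ?thesis by (simp add: vec_diff)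
qed

definition act :: "'g \<Rightarrow> ('g generator \<Rightarrow>\<^sub>0 int) \<Rightarrow> 'g generator \<Rightarrow>\<^sub>0 int" where
  "act u = relabel (\<lambda>(a, b, r, s). (a, b, u + r, u + s))"

definition shift :: "real \<Rightarrow> ('g generator \<Rightarrow>\<^sub>0 int) \<Rightarrow> 'g generator \<Rightarrow>\<^sub>0 int" where
  "shift t = relabel (\<lambda>(a, b, r, s). (a + t, b + t, r, s))"

lemma act_act: "act u (act v c) = act (u + v) c"
  and act_zero: "act 0 c = c"
  and shift_shift: "shift t (shift t' c) = shift (t + t') c"
  and shift_zero: "shift 0 c = c"
  and shift_act: "shift t (act u c) = act u (shift t c)"
  unfolding act_def shift_def relabel_relabel
  by (auto intro!: relabel_id arg_cong[of _ _ "\<lambda>h. relabel h c"] simp: fun_eq_iff add_ac add.assoc)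

lemma norm_vec_act: "norm (vec (act u c) - vec (act u d)) = norm (vec c - vec d)"
  unfolding act_def
proof (rule norm_vec_relabel)
  fix x y
  have *: "- (u + p) + (u + q) = - p + q" for p q by (simp only: minus_add add.assoc minus_add_cancel)
  show "inner (noise (case x of (a, b, r, s) \<Rightarrow> (a, b, u + r, u + s)))
      (noise (case y of (a, b, r, s) \<Rightarrow> (a, b, u + r, u + s))) = inner (noise x) (noise y)"
    by (cases x; cases y) (simp only: prod.case inner_noise *)
qed

lemma norm_vec_shift: "norm (vec (shift t c) - vec (shift t d)) = norm (vec c - vec d)"
  unfolding shift_def
  by (rule norm_vec_relabel) (auto simp only: split_paired_all prod.case inner_noise add_diff_cancel_right)

text \<open>The squared length |t| of the time interval times the squared length \<psi>(s) of the
  cocycle: this is where the exponent of the semigroup comes from.\<close>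

lemma norm_noise: "(norm (noise (0, t, s, 0)))\<^sup>2 = \<bar>t\<bar> * \<psi> s"
  unfolding power2_norm_eq_inner inner_noise by (simp add: psi_zero psi_minus)

lemma continuous_\<beta>: "continuous_on UNIV (\<lambda>t. \<beta> (t, s))"
proof -
  have "(norm (\<beta> (t, s) - \<beta> (u, s)))\<^sup>2 = \<bar>t - u\<bar> * \<psi> s" for t u
    unfolding power2_norm_eq_inner inner_diff_left inner_diff_right inner_\<beta> brownian_def
    by (simp add: psi_zero abs_minus_commute field_simps)
  then have n: "norm (\<beta> (t, s) - \<beta> (u, s)) = sqrt (\<bar>t - u\<bar> * \<psi> s)" for t u
    by (metis norm_ge_zero real_sqrt_unique)
  have "((\<lambda>t. \<beta> (t, s)) \<longlongrightarrow> \<beta> (u, s)) (at u)" for u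
  proof -
    have "((\<lambda>t. sqrt (\<bar>t - u\<bar> * \<psi> s)) \<longlongrightarrow> sqrt (\<bar>u - u\<bar> * \<psi> s)) (at u)" by (intro tendsto_intros)
    then have "((\<lambda>t. norm (\<beta> (t, s) - \<beta> (u, s))) \<longlongrightarrow> 0) (at u)" by (simp add: n)
    then show ?thesis by (simp add: LIM_zero_iff tendsto_norm_zero_iff)
  qed
  then show ?thesis by (simp add: continuous_on_def)
qed

lemma continuous_noise:
  assumes "continuous_on UNIV a" "continuous_on UNIV b"
  shows "continuous_on UNIV (\<lambda>t. noise (a t, b t, r, s))"
  unfolding noise.simps
  by (intro continuous_intros continuous_on_compose2[OF continuous_\<beta>] assms) auto

lemma continuous_vec_shift: "continuous_on UNIV (\<lambda>t. vec (shift t c))"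
proof (induction c rule: generator_induct)
  case (frag_of x)
  show ?case
    by (cases x) (auto simp: shift_def simp del: noise.simps intro!: continuous_noise continuous_intros)
qed (auto simp: shift_def vec_diff intro: continuous_on_diff)

text \<open>\<open>\<beta>\<close> is continuous in time, so generators with rational endpoints
  suffice. These are few enough to bound the dimension of the Gaussian space.\<close>

lemma vec_in_closure_rational:
  assumes "0 \<in> D" and diff: "\<And>x y. x \<in> D \<Longrightarrow> y \<in> D \<Longrightarrow> x - y \<in> D"
    and gen: "\<And>a b r s. a \<in> \<rat> \<Longrightarrow> b \<in> \<rat> \<Longrightarrow> frag_of (a, b, r, s) \<in> D"
  shows "vec c \<in> closure (vec ` D)"
proof (induction c rule: generator_induct)
  case zero
  then show ?case using assms(1) closure_subset[of "vec ` D"] by (metis imageI subsetD vec_zero)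
next
  case (frag_of x)
  obtain a b r s where x: "x = (a, b, r, s)" by (cases x)
  have "\<exists>q. (\<forall>n. q n \<in> \<rat>) \<and> q \<longlonglongrightarrow> u" for u :: real
    using Rats_closure_real closure_sequential[of u "\<rat>"] by auto
  then obtain q q' where q: "\<And>n. q n \<in> \<rat>" "q \<longlonglongrightarrow> a" "\<And>n. q' n \<in> \<rat>" "q' \<longlonglongrightarrow> b" by metis
  have "(\<lambda>n. vec (frag_of (q n, q' n, r, s))) \<longlonglongrightarrow> vec (frag_of x)"
    unfolding x vec_frag_of noise.simps
    by (intro tendsto_intros continuous_on_tendsto_compose[OF continuous_\<beta>] q) auto
  moreover have "vec (frag_of (q n, q' n, r, s)) \<in> vec ` D" for n by (intro imageI gen q)
  ultimately show ?case
    unfolding closure_sequential by (intro exI[of _ "\<lambda>n. vec (frag_of (q n, q' n, r, s))"]) blast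
next
  case (diff a b)
  then obtain x y where "\<And>n. x n \<in> vec ` D" "x \<longlonglongrightarrow> vec a" "\<And>n. y n \<in> vec ` D" "y \<longlonglongrightarrow> vec b"
    unfolding closure_sequential by blast
  moreover have "v - w \<in> vec ` D" if "v \<in> vec ` D" "w \<in> vec ` D" for v w
    using that assms(2) by (auto simp flip: vec_diff)
  ultimately show ?case
    unfolding closure_sequential vec_diff by (intro exI[of _ "\<lambda>n. x n - y n"]) (auto intro: tendsto_diff)
qed

text \<open>A subgroup \<open>D\<close> of cardinality at most that of G x N has dense image, and
  each \<open>f d\<close> has countable support. An index of \<open>B\<close> outside all these
  supports would give a basis vector orthogonal to its own closed span.\<close>

lemma gaussian_dimension:
  fixes f :: "('g generator \<Rightarrow>\<^sub>0 int) \<Rightarrow> ('g generator \<Rightarrow>\<^sub>0 int) ell2"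
  assumes f: "\<And>c d. inner (f c) (f d) = exp (- (norm (vec c - vec d))\<^sup>2)"
    and B: "\<And>b. b \<in> B \<Longrightarrow> basis_vector b \<in> closure (span (range f))"
  shows "B \<lesssim> (UNIV :: ('g \<times> nat) set)"
proof -
  let ?K = "UNIV :: ('g \<times> nat) set"
  have K: "infinite ?K" by (simp add: finite_prod)
  have g: "(UNIV :: 'g set) \<lesssim> ?K"
    unfolding lepoll_def by (rule exI[of _ "\<lambda>g. (g, 0)"]) (auto simp: inj_on_def)
  let ?S = "frag_of ` (\<rat> \<times> \<rat> \<times> UNIV \<times> UNIV) :: ('g generator \<Rightarrow>\<^sub>0 int) set"
  have "?S \<lesssim> ?K"
    by (rule lepoll_trans[OF image_lepoll])
      (intro infinite_times_lepoll K g countable_lepoll_infinite countable_rat)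
  from generated_subgroup_lepoll[OF K this]
  obtain D where D: "?S \<subseteq> D" "0 \<in> D" "\<forall>x\<in>D. \<forall>y\<in>D. x - y \<in> D" "D \<lesssim> ?K"
    by (elim exE conjE)
  have dense: "f c \<in> closure (f ` D)" for c
  proof -
    have "vec c \<in> closure (vec ` D)"
    proof (rule vec_in_closure_rational[OF D(2)])
      show "x - y \<in> D" if "x \<in> D" "y \<in> D" for x y using D(3) that by blast
      show "frag_of (a, b, r, s) \<in> D" if "a \<in> \<rat>" "b \<in> \<rat>" for a b :: real and r s
        using D(1) that by blast
    qed
    then obtain v where v: "\<And>n. v n \<in> vec ` D" "v \<longlonglongrightarrow> vec c" unfolding closure_sequential by blast
    have "\<forall>n. \<exists>d. d \<in> D \<and> v n = vec d" using v(1) by blast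
    then obtain d where d: "\<And>n. d n \<in> D" "\<And>n. v n = vec (d n)" by metis
    have n: "(norm (f x - f y))\<^sup>2 = 2 - 2 * exp (- (norm (vec x - vec y))\<^sup>2)" for x y
      by (simp add: norm_diff_square f)
    have "(\<lambda>n. 2 - 2 * exp (- (norm (v n - vec c))\<^sup>2)) \<longlonglongrightarrow> 2 - 2 * exp (- (norm (vec c - vec c))\<^sup>2)"
      by (intro tendsto_intros v)
    then have "(\<lambda>n. (norm (f (d n) - f c))\<^sup>2) \<longlonglongrightarrow> 0" by (simp add: n d)
    from tendsto_real_sqrt[OF this] have "(\<lambda>n. norm (f (d n) - f c)) \<longlonglongrightarrow> 0" by simp
    then have "(\<lambda>n. f (d n)) \<longlonglongrightarrow> f c" by (simp add: LIM_zero_iff tendsto_norm_zero_iff)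
    with d(1) show ?thesis unfolding closure_sequential by (intro exI[of _ "\<lambda>n. f (d n)"]) blast
  qed
  have "B \<subseteq> (\<Union>d\<in>D. {b. Rep_ell2 (f d) b \<noteq> 0})"
  proof (rule subsetI, rule ccontr)
    fix b assume "b \<in> B" and b: "b \<notin> (\<Union>d\<in>D. {b. Rep_ell2 (f d) b \<noteq> 0})"
    have cl: "closed {v. cinner (basis_vector b) v = 0}"
      by (intro closed_Collect_eq cinner.continuous_on continuous_intros)
    have "closure (f ` D) \<subseteq> {v. cinner (basis_vector b) v = 0}"
      by (intro closure_minimal cl) (use b in \<open>auto simp: cinner_basis_vector\<close>)
    then have "range f \<subseteq> {v. cinner (basis_vector b) v = 0}" using dense by blast
    moreover have "subspace {v. cinner (basis_vector b) v = 0}"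
      by (rule subspaceI) (auto simp: cinner.add_right cinner.scaleR_right cinner.zero_right)
    ultimately have "closure (span (range f)) \<subseteq> {v. cinner (basis_vector b) v = 0}"
      by (intro closure_minimal span_minimal cl)
    then have "cinner (basis_vector b) (basis_vector b) = 0" using B[OF \<open>b \<in> B\<close>] by blast
    then show False by (simp add: cinner_basis_vectors)
  qed
  moreover have "{b. Rep_ell2 (f d) b \<noteq> 0} \<lesssim> ?K" for d
  proof -
    have "countable {b \<in> UNIV. (cmod (Rep_ell2 (f d) b))\<^sup>2 \<noteq> 0}"
      using Rep_ell2[of "f d"] by (intro summable_countable_real) simp
    then show ?thesis by (intro countable_lepoll_infinite K) simp
  qed
  then have "(\<Union>d\<in>D. {b. Rep_ell2 (f d) b \<noteq> 0}) \<lesssim> ?K"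
    using K D(4) by (intro infinite_UN_lepoll)
  ultimately show ?thesis using subset_imp_lepoll lepoll_trans by blast
qed

text \<open>The factor \<open>'g \<times> int\<close> only serves to make the dimension of the space equal to that of
  \<open>\<ell>\<^sup>2(G \<times> \<nat>)\<close>.\<close>

lemma gaussian_vectors:
  "\<exists>E :: ('g \<times> int) \<times> ('g generator \<Rightarrow>\<^sub>0 int) \<Rightarrow> ('g \<times> nat) ell2. total_family E \<and>
    (\<forall>l c l' c'. cinner (E (l, c)) (E (l', c'))
      = (if l = l' then of_real (exp (- (norm (vec c - vec c'))\<^sup>2)) else 0))"
proof -
  obtain f :: "('g generator \<Rightarrow>\<^sub>0 int) \<Rightarrow> ('g generator \<Rightarrow>\<^sub>0 int) ell2" and B where
    f: "\<And>c d. inner (f c) (f d) = exp (- (norm (vec c - vec d))\<^sup>2)"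
    and fB: "\<And>c. f c \<in> closure (span (basis_vector ` B))"
    and B: "\<And>b. b \<in> B \<Longrightarrow> basis_vector b \<in> closure (span (range f))"
    by (rule gram_representation[OF psd_kernel_gaussian[of vec]]) blast
  \<comment> \<open>Closed real spans of basis vectors have real coordinates; hence the complex
    inner products of the \<open>f c\<close> are real and equal to the prescribed kernel.\<close>
  have coord: "Im (Rep_ell2 (f c) i) = 0 \<and> (i \<notin> B \<longrightarrow> Rep_ell2 (f c) i = 0)" for c i
  proof -
    let ?P = "\<lambda>v. Im (cinner (basis_vector i) v) = 0 \<and> (i \<notin> B \<longrightarrow> cinner (basis_vector i) v = 0)"
    have "closure (span (basis_vector ` B)) \<subseteq> {v. ?P v}"
    proof (intro closure_minimal span_minimal)
      show "closed {v. ?P v}"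
        by (intro closed_Collect_conj closed_Collect_imp closed_Collect_eq open_Collect_const
            continuous_on_Im cinner.continuous_on continuous_intros)
      show "subspace {v. ?P v}"
        by (rule subspaceI) (auto simp: cinner.add_right cinner.scaleR_right cinner.zero_right)
    qed (auto simp: cinner_basis_vectors)
    then show ?thesis using fB[of c] by (auto simp: cinner_basis_vector)
  qed
  have cf: "cinner (f c) (f d) = of_real (exp (- (norm (vec c - vec d))\<^sup>2))" for c d
  proof -
    have "((\<lambda>i. Im (cnj (Rep_ell2 (f c) i) * Rep_ell2 (f d) i)) has_sum Im (cinner (f c) (f d))) UNIV"
      by (intro has_sum_Im has_sum_cinner_ell2)
    moreover have "(\<lambda>i. Im (cnj (Rep_ell2 (f c) i) * Rep_ell2 (f d) i)) = (\<lambda>_. 0)"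
      by (simp add: coord fun_eq_iff)
    ultimately have "Im (cinner (f c) (f d)) = 0" by (simp only: has_sum_unique[OF _ has_sum_0_simp])
    then show ?thesis using f[of c d] by (simp add: complex_eq_iff inner_Re_cinner)
  qed
  have "B \<noteq> {}"
  proof
    assume "B = {}"
    then have "f 0 = 0" using coord[of 0] by (intro Rep_ell2_ext) (simp add: zero_ell2.rep_eq)
    then show False using f[of 0 0] by simp
  qed
  then obtain b0 where b0: "b0 \<in> B" by blast
  let ?K = "UNIV :: ('g \<times> nat) set"
  have K: "infinite ?K" by (simp add: finite_prod)
  have int: "(UNIV :: ('g \<times> int) set) \<lesssim> ?K"
    unfolding lepoll_def by (rule exI[of _ "\<lambda>(g, n). (g, to_nat n)"]) (auto simp: inj_on_def)
  have "(UNIV :: ('g \<times> int) set) \<times> B \<approx> ?K"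
  proof (rule lepoll_antisym)
    show "(UNIV :: ('g \<times> int) set) \<times> B \<lesssim> ?K"
      by (intro infinite_times_lepoll K int gaussian_dimension[OF f B])
    show "?K \<lesssim> (UNIV :: ('g \<times> int) set) \<times> B"
      unfolding lepoll_def
      by (rule exI[of _ "\<lambda>(g, n). ((g, int n), b0)"]) (use b0 in \<open>auto simp: inj_on_def\<close>)
  qed
  \<comment> \<open>Splits the coordinates G x N into blocks indexed by G x Z, each a copy of
    \<open>B\<close>.\<close>
  then obtain \<delta> where \<delta>: "bij_betw \<delta> ?K ((UNIV :: ('g \<times> int) set) \<times> B)"
    using eqpoll_sym unfolding eqpoll_def by blast
  define j' where "j' l b = inv_into UNIV \<delta> (l, b)" for l b
  have \<delta>j': "\<delta> (j' l b) = (l, b)" if "b \<in> B" for l b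
    unfolding j'_def using \<delta> that by (intro f_inv_into_f) (auto simp: bij_betw_def)
  have j'\<delta>: "j' (fst (\<delta> k)) (snd (\<delta> k)) = k" for k
    unfolding j'_def using \<delta> by (simp add: bij_betw_def)
  have \<delta>B: "snd (\<delta> k) \<in> B" for k
    using bij_betwE[OF \<delta>, rule_format, of k] by (simp add: mem_Times_iff)
  let ?A = "\<lambda>l. {k. fst (\<delta> k) = l}"
  have A: "\<forall>k\<in>?A l. j' l (snd (\<delta> k)) = k" "\<forall>b\<in>B. snd (\<delta> (j' l b)) = b"
    "(\<lambda>k. snd (\<delta> k)) ` ?A l \<subseteq> B" "j' l ` B \<subseteq> ?A l" for l
    using j'\<delta> by (blast, simp_all add: \<delta>j' image_subset_iff \<delta>B)
  have bij: "bij_betw (\<lambda>k. snd (\<delta> k)) (?A l) B" for l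
    by (rule bij_betw_byWitness[OF A])
  have bij': "bij_betw (j' l) B (?A l)" for l
    by (rule bij_betw_byWitness[OF A(2,1,4,3)])
  have inj: "inj_on (\<lambda>k. snd (\<delta> k)) (?A l)" "inj_on (j' l) B" for l
    using bij bij' by (auto simp: bij_betw_def)
  \<comment> \<open>\<open>E (l, c)\<close> is the copy of \<open>f c\<close> in block
    \<open>l\<close>, so different blocks are orthogonal.\<close>
  define E where "E = (\<lambda>(l, c). pull (\<lambda>k. snd (\<delta> k)) (?A l) (f c))"
  have Ev: "cinner (E (l, c)) v = cinner (f c) (pull (j' l) B v)" for l c v
    unfolding E_def prod.case by (rule cinner_pull[OF bij]) (use j'\<delta> in auto)
  have "pull (j' l) B (E (l', c')) = (if l = l' then f c' else 0)" for l l' c'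
    by (rule Rep_ell2_ext) (simp add: E_def Rep_pull inj \<delta>j' coord zero_ell2.rep_eq)
  then have "cinner (E (l, c)) (E (l', c')) = (if l = l' then of_real (exp (- (norm (vec c - vec c'))\<^sup>2)) else 0)"
    for l c l' c' by (simp add: Ev cf cinner.zero_right)
  moreover have "total_family E"
    unfolding total_family_def
  proof (intro allI impI)
    fix v assume v: "\<forall>x. cinner (E x) v = 0"
    have z: "cinner (basis_vector b) (pull (j' l) B v) = 0" if "b \<in> B" for l b
    proof -
      have "closure (span (range f)) \<subseteq> {u. cinner u (pull (j' l) B v) = 0}"
      proof (intro closure_minimal span_minimal)
        show "closed {u. cinner u (pull (j' l) B v) = 0}"
          by (intro closed_Collect_eq cinner.continuous_on continuous_intros)
        show "subspace {u. cinner u (pull (j' l) B v) = 0}"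
          by (rule subspaceI) (auto simp: cinner.add_left cinner.scaleR_left cinner.zero_left)
        have "cinner (f c) (pull (j' l) B v) = 0" for c using v Ev[of l c v] by metis
        then show "range f \<subseteq> {u. cinner u (pull (j' l) B v) = 0}" by blast
      qed
      then show ?thesis using B[OF that] by blast
    qed
    show "v = 0"
    proof (rule Rep_ell2_ext)
      fix k
      show "Rep_ell2 v k = Rep_ell2 0 k"
        using z[OF \<delta>B, of k "fst (\<delta> k)"] \<delta>B[of k]
        by (simp add: cinner_basis_vector Rep_pull inj j'\<delta> zero_ell2.rep_eq)
    qed
  qed
  ultimately show ?thesis by (intro exI[of _ E]) simp
qed

end

section \<open>Amplification\<close>

text \<open>The bijection identifies \<open>ell2\<close> over \<open>'k\<close> with the tensor
  product of \<open>ell2\<close> over \<open>'g\<close> and over \<open>'i\<close>, so the target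
  type can be prescribed.\<close>

locale tensor_index =
  fixes \<gamma> :: "'g \<times> 'i \<Rightarrow> 'k"
  assumes bij_\<gamma>: "bij \<gamma>"
begin

definition slice :: "'i \<Rightarrow> 'k ell2 \<Rightarrow>\<^sub>L 'g ell2" where
  "slice i = pull (\<lambda>s. \<gamma> (s, i)) UNIV"

lemma Rep_slice [simp]: "Rep_ell2 (slice i v) s = Rep_ell2 v (\<gamma> (s, i))"
  using bij_\<gamma> unfolding slice_def by (subst Rep_pull) (auto simp: inj_on_def bij_def)

lemma complex_linear_slice: "complex_linear (slice i)"
  unfolding complex_linear_def by (intro allI Rep_ell2_ext) (simp add: scaleC_ell2.rep_eq)

lemma slice_ext: "(\<And>i. slice i v = slice i w) \<Longrightarrow> v = w"
proof (rule Rep_ell2_ext)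
  fix k assume eq: "\<And>i. slice i v = slice i w"
  obtain s i where "k = \<gamma> (s, i)" using bij_\<gamma> by (metis bij_pointE surj_pair)
  then show "Rep_ell2 v k = Rep_ell2 w k" using eq[of i] by (metis Rep_slice)
qed

lemma has_sum_slices: "((\<lambda>i. cinner (slice i v) (slice i w)) has_sum cinner v w) UNIV"
proof -
  let ?h = "\<lambda>k. cnj (Rep_ell2 v k) * Rep_ell2 w k"
  have "bij_betw (\<lambda>(i, s). \<gamma> (s, i)) (UNIV \<times> UNIV) UNIV"
  proof -
    have "bij_betw prod.swap (UNIV \<times> UNIV :: ('i \<times> 'g) set) UNIV"
      by (simp add: bij_swap)
    from bij_betw_trans[OF this] bij_\<gamma> have "bij_betw (\<gamma> \<circ> prod.swap) (UNIV \<times> UNIV :: ('i \<times> 'g) set) UNIV"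
      by auto
    moreover have "\<gamma> \<circ> prod.swap = (\<lambda>(i, s). \<gamma> (s, i))" by auto
    ultimately show ?thesis by (simp only:)
  qed
  from has_sum_reindex_bij_betw[OF this, of ?h "cinner v w"]
  have "((\<lambda>x. ?h ((\<lambda>(i, s). \<gamma> (s, i)) x)) has_sum cinner v w) (Sigma UNIV (\<lambda>_. UNIV))"
    by (simp only: has_sum_cinner_ell2)
  moreover have "((\<lambda>s. ?h ((\<lambda>(i, s). \<gamma> (s, i)) (i, s))) has_sum cinner (slice i v) (slice i w)) UNIV" for i
    using has_sum_cinner_ell2[of "slice i v" "slice i w"] by simp
  ultimately show ?thesis by (rule has_sum_SigmaD)
qed

lemma sum_norm_slices: "finite I \<Longrightarrow> (\<Sum>i\<in>I. (norm (slice i v))\<^sup>2) \<le> (norm v)\<^sup>2"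
proof -
  assume "finite I"
  have "((\<lambda>i. Re (cinner (slice i v) (slice i v))) has_sum Re (cinner v v)) UNIV"
    by (intro has_sum_Re has_sum_slices)
  then have "((\<lambda>i. (norm (slice i v))\<^sup>2) has_sum (norm v)\<^sup>2) UNIV" by (simp add: cinner_self)
  from finite_sum_le_has_sum[OF this \<open>finite I\<close>] show ?thesis by simp
qed

text \<open>The operator x tensor 1, acting by x on every slice; its properties are verified slice
  by slice.\<close>

definition amplify :: "('g ell2 \<Rightarrow>\<^sub>L 'g ell2) \<Rightarrow> 'k ell2 \<Rightarrow>\<^sub>L 'k ell2" where
  "amplify x = Blinfun (\<lambda>v. Abs_ell2 (\<lambda>k. Rep_ell2 (x (slice (snd (inv \<gamma> k)) v)) (fst (inv \<gamma> k))))"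

lemma slice_amplify: "slice i (amplify x v) = x (slice i v)"
proof -
  let ?f = "\<lambda>v k. Rep_ell2 (x (slice (snd (inv \<gamma> k)) v)) (fst (inv \<gamma> k))"
  \<comment> \<open>A finite index set is enclosed in a rectangle, where the sum splits into
    finitely many slices, each controlled by the norm of \<open>x\<close>.\<close>
  have bound: "(\<Sum>k\<in>F. (cmod (?f v k))\<^sup>2) \<le> (norm x * norm v)\<^sup>2" if F: "finite F" for F v
  proof -
    let ?S = "fst ` inv \<gamma> ` F" and ?I = "snd ` inv \<gamma> ` F"
    have inj: "inj (inv \<gamma>)" using bij_\<gamma> by (simp add: bij_imp_bij_inv bij_is_inj)
    have "(\<Sum>k\<in>F. (cmod (?f v k))\<^sup>2) = (\<Sum>(s, i)\<in>inv \<gamma> ` F. (cmod (Rep_ell2 (x (slice i v)) s))\<^sup>2)"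
      by (subst sum.reindex) (auto intro: inj_on_subset[OF inj] simp: case_prod_beta)
    also have "\<dots> \<le> (\<Sum>(s, i)\<in>?S \<times> ?I. (cmod (Rep_ell2 (x (slice i v)) s))\<^sup>2)"
      by (intro sum_mono2 subset_fst_snd) (use F in auto)
    also have "\<dots> = (\<Sum>i\<in>?I. \<Sum>s\<in>?S. (cmod (Rep_ell2 (x (slice i v)) s))\<^sup>2)"
      by (subst sum.swap) (simp add: sum.cartesian_product)
    also have "\<dots> \<le> (\<Sum>i\<in>?I. (norm (x (slice i v)))\<^sup>2)"
      using F by (intro sum_mono finite_sum_le_norm_ell2) simp
    also have "\<dots> \<le> (\<Sum>i\<in>?I. (norm x)\<^sup>2 * (norm (slice i v))\<^sup>2)"
      unfolding power_mult_distrib[symmetric] by (intro sum_mono power_mono norm_blinfun) simp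
    also have "\<dots> \<le> (norm x)\<^sup>2 * (norm v)\<^sup>2"
      unfolding sum_distrib_left[symmetric] using F by (intro mult_left_mono sum_norm_slices) auto
    finally show ?thesis by (simp add: power_mult_distrib)
  qed
  have summ: "(\<lambda>k. (cmod (?f v k))\<^sup>2) summable_on UNIV" for v
    by (rule nonneg_bdd_above_summable_on) (use bound in \<open>auto intro!: bdd_aboveI2\<close>)
  have rep: "Rep_ell2 (Abs_ell2 (?f v)) = ?f v" for v
    using summ by (intro Abs_ell2_inverse) simp
  have "bounded_linear (\<lambda>v. Abs_ell2 (?f v))"
  proof (rule bounded_linear_intro[where K = "norm x"])
    fix v w :: "'k ell2" and r
    show "Abs_ell2 (?f (v + w)) = Abs_ell2 (?f v) + Abs_ell2 (?f w)"
      by (rule Rep_ell2_ext) (unfold rep plus_ell2.rep_eq, simp add: plus_ell2.rep_eq blinfun.add_right)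
    show "Abs_ell2 (?f (r *\<^sub>R v)) = r *\<^sub>R Abs_ell2 (?f v)"
      by (rule Rep_ell2_ext) (unfold rep scaleR_ell2.rep_eq, simp add: scaleR_ell2.rep_eq blinfun.scaleR_right)
    have "(norm (Abs_ell2 (?f v)))\<^sup>2 \<le> (norm x * norm v)\<^sup>2"
      unfolding norm_ell2_square rep by (rule infsum_le_finite_sums[OF summ bound])
    then have "norm (Abs_ell2 (?f v)) \<le> norm x * norm v" by (rule power2_le_imp_le) simp
    then show "norm (Abs_ell2 (?f v)) \<le> norm v * norm x" by (simp only: mult.commute)
  qed
  then have "blinfun_apply (amplify x) v = Abs_ell2 (?f v)"
    by (simp only: amplify_def bounded_linear_Blinfun_apply)
  then show ?thesis
    using bij_\<gamma> by (intro Rep_ell2_ext) (simp add: rep bij_is_inj inv_f_f)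
qed

lemma complex_linear_amplify: "complex_linear x \<Longrightarrow> complex_linear (amplify x)"
  unfolding complex_linear_def
  by (intro allI slice_ext) (simp add: slice_amplify complex_linearD[OF complex_linear_slice])

lemma cinner_amplify:
  assumes "\<And>v w. cinner (blinfun_apply y v) w = cinner v (blinfun_apply x w)"
  shows "cinner (amplify y v) w = cinner v (amplify x w)"
proof -
  have "((\<lambda>i. cinner (slice i (amplify y v)) (slice i w)) has_sum cinner v (amplify x w)) UNIV"
    using has_sum_slices[of v "amplify x w"] by (simp add: slice_amplify assms)
  then show ?thesis by (rule has_sum_unique[OF has_sum_slices])
qed

lemma star_homomorphism_amplify:
  assumes "M \<subseteq> bounded_operators" "amplify ` M \<subseteq> N"
  shows "star_homomorphism M N amplify"
  unfolding star_homomorphism_def linear_on_vna_def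
proof (intro conjI ballI allI)
  fix x assume x: "x \<in> M"
  show "amplify (adjoint_operator x) = adjoint_operator (amplify x)"
    by (rule adjoint_operator_eqI[symmetric], rule cinner_amplify, rule cinner_adjoint_operator)
      (use x assms(1) in blast)
  fix c show "amplify (scale_operator c x) = scale_operator c (amplify x)"
    by (intro blinfun_eqI slice_ext)
      (simp add: slice_amplify scale_operator.rep_eq complex_linearD[OF complex_linear_slice])
next
  fix x y assume "x \<in> M" "y \<in> M"
  show "amplify (x + y) = amplify x + amplify y"
    by (intro blinfun_eqI slice_ext) (simp add: slice_amplify blinfun.add_left blinfun.add_right)
  show "amplify (x o\<^sub>L y) = amplify x o\<^sub>L amplify y"
    by (intro blinfun_eqI slice_ext) (simp add: slice_amplify)
qed (use assms in auto)

lemma amplify_id: "amplify id_blinfun = id_blinfun"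
  by (intro blinfun_eqI slice_ext) (simp add: slice_amplify)

text \<open>The quadratic form of the amplified matrix is the sum over the slices of that of
  \<open>a\<close>; nonnegative real part and zero imaginary part both survive summation.\<close>

lemma positive_matrix_amplify:
  assumes "positive_operator_matrix n a"
  shows "positive_operator_matrix n (\<lambda>i j. amplify (a i j))"
  unfolding positive_operator_matrix_def
proof
  fix \<xi> :: "nat \<Rightarrow> 'k ell2"
  let ?s = "\<Sum>i<n. \<Sum>j<n. cinner (\<xi> i) (amplify (a i j) (\<xi> j))"
  have s: "((\<lambda>k. \<Sum>i<n. \<Sum>j<n. cinner (slice k (\<xi> i)) (a i j (slice k (\<xi> j)))) has_sum ?s) UNIV"
    using has_sum_slices by (intro has_sum_sum) (simp flip: slice_amplify)
  have p: "(\<Sum>i<n. \<Sum>j<n. cinner (slice k (\<xi> i)) (a i j (slice k (\<xi> j)))) \<in> \<real>\<^sub>\<ge>\<^sub>0" for k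
    using assms[unfolded positive_operator_matrix_def] by (rule allE[of _ "\<lambda>i. slice k (\<xi> i)"])
  have "Re ?s \<ge> 0"
    by (rule has_sum_nonneg[OF has_sum_Re[OF s]]) (use p in \<open>simp only: complex_nonneg_Reals_iff\<close>)
  moreover have "((\<lambda>_ :: 'i. 0) has_sum Im ?s) UNIV"
    using has_sum_Im[OF s] p by (simp only: complex_nonneg_Reals_iff)
  then have "Im ?s = 0" by (rule has_sum_unique) simp
  ultimately show "?s \<in> \<real>\<^sub>\<ge>\<^sub>0" by (simp only: complex_nonneg_Reals_iff)
qed

text \<open>The isometry v -> delta_s tensor v, whose adjoint reads off row
  \<open>s\<close>.\<close>

definition put :: "'g \<Rightarrow> 'i ell2 \<Rightarrow>\<^sub>L 'k ell2" where
  "put s = pull (\<lambda>k. snd (inv \<gamma> k)) {k. fst (inv \<gamma> k) = s}"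

lemma put_bij: "bij_betw (\<lambda>k. snd (inv \<gamma> k)) {k. fst (inv \<gamma> k) = s} UNIV"
  by (rule bij_betw_byWitness[where f' = "\<lambda>i. \<gamma> (s, i)"])
    (use bij_\<gamma> in \<open>auto simp: bij_is_inj inv_f_f surj_f_inv_f bij_is_surj\<close>)

lemma Rep_put: "Rep_ell2 (put s v) (\<gamma> (r, i)) = (if r = s then Rep_ell2 v i else 0)"
  unfolding put_def using put_bij[of s] bij_\<gamma>
  by (subst Rep_pull) (auto simp: bij_betw_def bij_is_inj inv_f_f)

lemma cinner_put: "cinner (put s v) w = cinner v (pull (\<lambda>i. \<gamma> (s, i)) UNIV w)"
  unfolding put_def
  by (rule cinner_pull[OF put_bij]) (use bij_\<gamma> in \<open>auto simp: surj_f_inv_f bij_is_surj\<close>)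

lemma Rep_pull_row: "Rep_ell2 (pull (\<lambda>i. \<gamma> (s, i)) UNIV w) i = Rep_ell2 w (\<gamma> (s, i))"
  using bij_\<gamma> by (subst Rep_pull) (auto simp: inj_on_def bij_def)

lemma cinner_put_put: "cinner (put s v) (put r w) = (if s = r then cinner v w else 0)"
proof -
  have "pull (\<lambda>i. \<gamma> (s, i)) UNIV (put r w) = (if s = r then w else 0)"
    by (rule Rep_ell2_ext) (simp add: Rep_pull_row Rep_put zero_ell2.rep_eq)
  then show ?thesis by (simp add: cinner_put cinner.zero_right)
qed

lemma slice_put: "slice i (put s v) = Rep_ell2 v i *\<^sub>C basis_vector s"
  by (rule Rep_ell2_ext) (simp add: Rep_put scaleC_ell2.rep_eq basis_vector.rep_eq)

lemma total_put:
  assumes "total_family E"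
  shows "total_family (\<lambda>(s, x). put s (E x))"
  unfolding total_family_def
proof (intro allI impI)
  fix v assume v: "\<forall>x. cinner ((\<lambda>(s, x). put s (E x)) x) v = 0"
  have "pull (\<lambda>i. \<gamma> (s, i)) UNIV v = 0" for s
    using assms v unfolding total_family_def by (auto simp: cinner_put)
  then have z: "Rep_ell2 v (\<gamma> (s, i)) = 0" for s i
    using Rep_pull_row[of s v i] by (simp add: zero_ell2.rep_eq)
  show "v = 0"
  proof (rule Rep_ell2_ext)
    fix k
    have "k = \<gamma> (fst (inv \<gamma> k), snd (inv \<gamma> k))" using bij_\<gamma> by (simp add: surj_f_inv_f bij_is_surj)
    then show "Rep_ell2 v k = Rep_ell2 0 k" using z by (metis zero_ell2.rep_eq)
  qed
qed

end

section \<open>The dilation\<close>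

text \<open>For isometries, convergence of vectors gives convergence of their orbits uniformly in t,
  so the vectors with continuous orbit form a closed subspace.\<close>

lemma isometry_continuous_family:
  fixes u :: "real \<Rightarrow> 'h::chilbert_space \<Rightarrow>\<^sub>L 'h"
  assumes tot: "total_family e" and lin: "\<And>t. complex_linear (u t)" and iso: "\<And>t v. norm (u t v) = norm v"
    and cont: "\<And>x. continuous_on UNIV (\<lambda>t. u t (e x))"
  shows "continuous_on UNIV (\<lambda>t. u t v)"
proof (rule total_family_induct[OF tot])
  show "closed {v. continuous_on UNIV (\<lambda>t. u t v)}"
    unfolding closed_sequential_limits
  proof (intro allI impI, elim conjE)
    fix X l assume X: "\<forall>n. X n \<in> {v. continuous_on UNIV (\<lambda>t. u t v)}" "X \<longlonglongrightarrow> l"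
    have "uniform_limit UNIV (\<lambda>n t. u t (X n)) (\<lambda>t. u t l) sequentially"
    proof (rule uniform_limitI)
      fix \<epsilon> :: real assume "\<epsilon> > 0"
      have "dist (u t (X n)) (u t l) = dist (X n) l" for t n
        using iso[of t "X n - l"] by (simp add: dist_norm blinfun.diff_right)
      then show "\<forall>\<^sub>F n in sequentially. \<forall>t\<in>UNIV. dist (u t (X n)) (u t l) < \<epsilon>"
        using tendstoD[OF X(2) \<open>\<epsilon> > 0\<close>] by simp
    qed
    then show "l \<in> {v. continuous_on UNIV (\<lambda>t. u t v)}"
      using X(1) by (auto intro: uniform_limit_theorem[rotated])
  qed
  show "subspace {v. continuous_on UNIV (\<lambda>t. u t v)}"
    by (rule subspaceI) (auto simp: blinfun.add_right blinfun.scaleR_right intro: continuous_intros)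
  show "continuous_on UNIV (\<lambda>t. u t (c *\<^sub>C e x))" for c x
    by (simp add: complex_linearD[OF lin]) (intro scaleC.continuous_on continuous_intros cont)
qed

text \<open>The unitaries are moved onto the vectors of the functional. Every term is then
  continuous in t with a bound independent of t, and the Weierstrass test applies.\<close>

lemma unitary_group_weak_star_continuous:
  fixes u :: "real \<Rightarrow> 'h::chilbert_space \<Rightarrow>\<^sub>L 'h"
  assumes iso: "\<And>t v. norm (u t v) = norm v"
    and adj: "\<And>t v w. cinner v (u t w) = cinner (u (- t) v) w"
    and cont: "\<And>v. continuous_on UNIV (\<lambda>t. u t v)"
    and \<omega>: "\<omega> \<in> predual N" and N: "\<And>t. u t o\<^sub>L x o\<^sub>L u (- t) \<in> N"
  shows "continuous_on UNIV (\<lambda>t. \<omega> (u t o\<^sub>L x o\<^sub>L u (- t)))"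
proof -
  obtain \<xi> \<eta> where s: "summable (\<lambda>n. (norm (\<xi> n))\<^sup>2)" "summable (\<lambda>n. (norm (\<eta> n))\<^sup>2)"
    and \<omega>: "\<And>y. y \<in> N \<Longrightarrow> \<omega> y = suminf (\<lambda>n. cinner (\<xi> n) (y (\<eta> n)))"
    using \<omega> by (auto simp: predual_def)
  define f where "f n t = cinner (u (- t) (\<xi> n)) (x (u (- t) (\<eta> n)))" for n t
  have eq: "\<omega> (u t o\<^sub>L x o\<^sub>L u (- t)) = suminf (\<lambda>n. f n t)" for t
    unfolding \<omega>[OF N] by (simp add: f_def adj)
  have bound: "norm (f n t) \<le> norm x * ((norm (\<xi> n))\<^sup>2 + (norm (\<eta> n))\<^sup>2)" for n t
  proof -
    have "norm (f n t) \<le> norm (u (- t) (\<xi> n)) * norm (x (u (- t) (\<eta> n)))"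
      unfolding f_def by (rule cinner_cauchy_schwarz)
    also have "\<dots> \<le> norm (\<xi> n) * (norm x * norm (\<eta> n))"
      using norm_blinfun[of x "u (- t) (\<eta> n)"] by (simp add: iso mult_left_mono)
    also have "\<dots> = norm x * (norm (\<xi> n) * norm (\<eta> n))" by simp
    also have "\<dots> \<le> norm x * ((norm (\<xi> n))\<^sup>2 + (norm (\<eta> n))\<^sup>2)"
    proof (rule mult_left_mono)
      have "0 \<le> norm (\<xi> n) * norm (\<eta> n)" by simp
      then show "norm (\<xi> n) * norm (\<eta> n) \<le> (norm (\<xi> n))\<^sup>2 + (norm (\<eta> n))\<^sup>2"
        using sum_squares_bound[of "norm (\<xi> n)" "norm (\<eta> n)"] by linarith
    qed simp
    finally show ?thesis .
  qed
  have "uniform_limit UNIV (\<lambda>n t. \<Sum>i<n. f i t) (\<lambda>t. suminf (\<lambda>n. f n t)) sequentially"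
    by (rule Weierstrass_m_test[OF bound]) (intro summable_mult summable_add s)
  moreover have "continuous_on UNIV (\<lambda>t. \<Sum>i<n. f i t)" for n
  proof -
    have c: "continuous_on UNIV (\<lambda>t. u (- t) v)" for v
      by (rule continuous_on_compose2[OF cont[of v]]) (intro continuous_intros, simp)
    then have "continuous_on UNIV (\<lambda>t. x (u (- t) v))" for v
      by (rule blinfun.continuous_on[OF continuous_on_const])
    with c show ?thesis
      unfolding f_def by (intro continuous_on_sum cinner.continuous_on)
  qed
  ultimately have "continuous_on UNIV (\<lambda>t. suminf (\<lambda>n. f n t))"
    by (auto intro: uniform_limit_theorem[rotated])
  then show ?thesis by (simp add: eq)
qed

type_synonym 'g label = "'g \<times> ('g \<times> int) \<times> ('g generator \<Rightarrow>\<^sub>0 int)"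

text \<open>A label \<open>(s, l, c)\<close> stands for the element \<open>s l c\<close> of the group generated by \<open>G\<close>, \<open>G \<times> \<int>\<close> and the
  noise group, in which \<open>G \<times> \<int>\<close> is a direct factor and \<open>G\<close> acts on the noise.\<close>

locale noise_dilation = cocycle_noise \<psi> + tensor_index \<gamma>
  for \<psi> :: "'g::group_add \<Rightarrow> real" and \<gamma> :: "'g \<times> ('g \<times> nat) \<Rightarrow> 'g \<times> nat" +
  fixes E :: "('g \<times> int) \<times> ('g generator \<Rightarrow>\<^sub>0 int) \<Rightarrow> ('g \<times> nat) ell2"
  assumes total_E: "total_family E"
    and gram_E: "cinner (E (l, c)) (E (l', c'))
      = (if l = l' then of_real (exp (- (norm (vec c - vec c'))\<^sup>2)) else 0)"
begin

definition e :: "'g label \<Rightarrow> ('g \<times> nat) ell2" where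
  "e = (\<lambda>(s, x). put s (E x))"

lemma cinner_e:
  "cinner (e (s, l, c)) (e (s', l', c'))
    = (if s = s' \<and> l = l' then of_real (exp (- (norm (vec c - vec c'))\<^sup>2)) else 0)"
  by (simp add: e_def cinner_put_put gram_E)

lemma total_e: "total_family e"
  unfolding e_def by (rule total_put[OF total_E])

text \<open>Moving u to the left past c turns c into \<open>act (- u) c\<close>.\<close>

fun mul :: "'g label \<Rightarrow> 'g label \<Rightarrow> 'g label" where
  "mul (s, l, c) (u, m, d) = (s + u, l + m, act (- u) c + d)"

fun inv :: "'g label \<Rightarrow> 'g label" where
  "inv (s, l, c) = (- s, - l, - act s c)"

lemma act_simps [simp]:
  "act u 0 = 0" "act u (c + d) = act u c + act u d" "act u (c - d) = act u c - act u d" "act u (- c) = - act u c"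
  "act u (frag_of (a, b, r, s)) = frag_of (a, b, u + r, u + s)"
  by (simp_all add: act_def)

lemma shift_simps [simp]:
  "shift t 0 = 0" "shift t (c + d) = shift t c + shift t d" "shift t (c - d) = shift t c - shift t d"
  "shift t (- c) = - shift t c" "shift t (frag_of (a, b, r, s)) = frag_of (a + t, b + t, r, s)"
  by (simp_all add: shift_def)

sublocale gns: central_gram e mul inv "(0, 0, 0)"
proof
  show "total_family e" by (rule total_e)
  fix x y z :: "'g label"
  obtain s l c where x: "x = (s, l, c)" by (cases x)
  obtain s' l' c' where y: "y = (s', l', c')" by (cases y)
  obtain s'' l'' c'' where z: "z = (s'', l'', c'')" by (cases z)
  show "cinner (e (mul y x)) (e (mul z x)) = cinner (e y) (e z)"
    by (simp add: x y z cinner_e vec_add norm_vec_act)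
  show "e (mul (mul y x) (inv x)) = e y"
    by (simp add: x y act_act act_zero add.assoc)
  show "e (mul (0, 0, 0) x) = e x" by (simp add: x)
  show "inv (inv x) = x" by (simp add: x act_act act_zero)
  have "norm (vec (act s c) - vec (act s c')) = norm (vec c' - vec c)"
    by (simp add: norm_vec_act norm_minus_commute)
  then show "cinner (e (inv x)) (e (inv y)) = cinner (e y) (e x)"
    by (auto simp: x y cinner_e vec_minus norm_minus_commute)
  show "cinner (e (0, 0, 0)) (e (0, 0, 0)) = 1" by (simp add: cinner_e)
qed

lemma e_eqI:
  assumes "vec c = vec d"
  shows "e (s, l, c) = e (s, l, d)"
proof -
  have "cinner (e (s, l, c) - e (s, l, d)) (e (s, l, c) - e (s, l, d)) = 0"
    by (simp add: cinner.diff_left cinner.diff_right cinner_e assms)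
  then show ?thesis by (simp add: cinner_self)
qed

section \<open>The blocks f tensor E(x) of the GNS space and the embedding of VN(G)\<close>

definition W :: "('g \<times> int) \<times> ('g generator \<Rightarrow>\<^sub>0 int) \<Rightarrow> 'g ell2 \<Rightarrow>\<^sub>L ('g \<times> nat) ell2" where
  "W x = (SOME w. complex_linear w \<and> (\<forall>s. blinfun_apply w (basis_vector s) = e (s, x)) \<and>
     (\<forall>f g. cinner (blinfun_apply w f) (blinfun_apply w g) = cinner f g))"

lemma complex_linear_W: "complex_linear (W x)" and W_basis_vector: "W x (basis_vector s) = e (s, x)"
  and W_isometry: "cinner (W x f) (W x g) = cinner f g"
proof -
  have "cinner (basis_vector s) (basis_vector r) = cinner (e (s, x)) (e (r, x))" for s r
    by (cases x) (simp add: cinner_basis_vectors cinner_e)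
  from someI_ex[OF gram_extension[OF total_family_basis_vector this]]
  show "complex_linear (W x)" "W x (basis_vector s) = e (s, x)"
    "cinner (W x f) (W x g) = cinner f g"
    unfolding W_def[symmetric] by blast+
qed

lemma slice_W: "slice i (W x f) = Rep_ell2 (E x) i *\<^sub>C f"
proof -
  have "slice i o\<^sub>L W x = scale_operator (Rep_ell2 (E x) i) id_blinfun"
  proof (rule total_family_blinfun_eqI[OF total_family_basis_vector])
    show "complex_linear (slice i o\<^sub>L W x)" by (intro complex_linear_compose complex_linear_slice complex_linear_W)
    show "complex_linear (scale_operator (Rep_ell2 (E x) i) id_blinfun :: 'g ell2 \<Rightarrow>\<^sub>L 'g ell2)"
      by (simp add: complex_linear_def scale_operator.rep_eq scaleC_scaleC mult.commute)
    fix s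
    show "blinfun_apply (slice i o\<^sub>L W x) (basis_vector s)
        = blinfun_apply (scale_operator (Rep_ell2 (E x) i) id_blinfun) (basis_vector s)"
      by (simp add: W_basis_vector e_def slice_put scale_operator.rep_eq)
  qed
  from arg_cong[OF this, of "\<lambda>a. blinfun_apply a f"] show ?thesis by (simp add: scale_operator.rep_eq)
qed

lemma amplify_W: "complex_linear x \<Longrightarrow> amplify x (W y f) = W y (x f)"
  by (rule slice_ext) (simp add: slice_amplify slice_W complex_linearD)

lemma \<rho>_W: "gns.\<rho> (u, m, d) (W (l, c) f) = W (l + m, act (- u) c + d) (vn.\<rho> u f)"
proof -
  have "gns.\<rho> (u, m, d) o\<^sub>L W (l, c) = W (l + m, act (- u) c + d) o\<^sub>L vn.\<rho> u"
    by (rule total_family_blinfun_eqI[OF total_family_basis_vector])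
      (simp_all add: complex_linear_compose complex_linear_W gns.\<rho>_linear vn.\<rho>_linear W_basis_vector
        gns.\<rho>_e vn.\<rho>_e)
  from arg_cong[OF this, of "\<lambda>a. blinfun_apply a f"] show ?thesis by simp
qed

text \<open>Right multiplication by (u, m, d) carries each block to a block, acting inside by right
  translation by u, which commutes with x; the amplification acts as x in every block.\<close>

lemma amplify_N:
  assumes x: "x \<in> vn.N"
  shows "amplify x \<in> gns.N"
  unfolding gns.N_iff
proof (intro conjI allI)
  have lin: "complex_linear x" using x by (simp add: vn.N_iff)
  then show "complex_linear (amplify x)" by (rule complex_linear_amplify)
  fix y :: "'g label" and v
  obtain u m d where y: "y = (u, m, d)" by (cases y)
  have "amplify x o\<^sub>L gns.\<rho> y = gns.\<rho> y o\<^sub>L amplify x"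
  proof (rule total_family_blinfun_eqI[OF total_e])
    fix z :: "'g label"
    obtain s l c where z: "z = (s, l, c)" by (cases z)
    show "(amplify x o\<^sub>L gns.\<rho> y) (e z) = (gns.\<rho> y o\<^sub>L amplify x) (e z)"
      unfolding y z W_basis_vector[symmetric]
      using x by (simp add: \<rho>_W amplify_W[OF lin] vn.N_iff)
  qed (simp_all add: complex_linear_compose complex_linear_amplify lin gns.\<rho>_linear)
  from arg_cong[OF this, of "\<lambda>a. blinfun_apply a v"]
  show "amplify x (gns.\<rho> y v) = gns.\<rho> y (amplify x v)" by simp
qed

lemma state_amplify: "x \<in> vn.N \<Longrightarrow> vector_state (e (0, 0, 0)) (amplify x) = group_trace x"
  unfolding group_trace_eq vector_state_def W_basis_vector[symmetric]
  by (simp add: amplify_W vn.N_iff W_isometry)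

lemma star_homomorphism_J: "star_homomorphism group_vna gns.N amplify"
  unfolding group_vna_eq
  by (rule star_homomorphism_amplify) (auto simp: vn.N_bounded amplify_N)

lemma inj_amplify: "inj_on amplify group_vna"
  unfolding group_vna_eq
proof (rule inj_onI)
  fix x y :: "'g ell2 \<Rightarrow>\<^sub>L 'g ell2" assume xy: "x \<in> vn.N" "y \<in> vn.N" and eq: "amplify x = amplify y"
  show "x = y"
  proof (rule blinfun_eqI)
    fix f
    have "W 0 (x f) = W 0 (y f)"
      using arg_cong[OF eq, of "\<lambda>a. blinfun_apply a (W 0 f)"] xy by (simp add: amplify_W vn.N_iff)
    then have "cinner (W 0 (x f - y f)) (W 0 (x f - y f)) = 0" by (simp add: blinfun.diff_right cinner.zero_left)
    then show "x f = y f" unfolding W_isometry unfolding cinner_self by simp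
  qed
qed

lemma markov_map_J: "markov_map group_vna group_trace gns.N (vector_state (e (0, 0, 0))) amplify"
  unfolding markov_map_def completely_positive_def
proof (intro conjI allI impI)
  show "amplify \<in> group_vna \<rightarrow> gns.N" "linear_on_vna group_vna amplify"
    using star_homomorphism_J by (simp_all add: star_homomorphism_def)
  show "amplify id_blinfun = id_blinfun" by (rule amplify_id)
  show "positive_operator_matrix n (\<lambda>i j. amplify (a i j))" if "positive_operator_matrix n a" for n a
    using that by (rule positive_matrix_amplify)
  show "\<forall>x\<in>group_vna. vector_state (e (0, 0, 0)) (amplify x) = group_trace x"
    by (simp add: group_vna_eq state_amplify)
  show "\<exists>\<sigma> \<sigma>'. is_modular_group group_vna group_trace \<sigma> \<and>
      is_modular_group gns.N (vector_state (e (0, 0, 0))) \<sigma>' \<and>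
      (\<forall>t. \<forall>x\<in>group_vna. amplify (\<sigma> t x) = \<sigma>' t (amplify x))"
    using vn.modular_group_N gns.modular_group_N unfolding group_vna_eq group_trace_eq
    by (intro exI[of _ "\<lambda>t x. x"] conjI) simp_all
qed

section \<open>The automorphism group\<close>

text \<open>In a label the noise stands to the right of s. The cocycle delta_s - delta_0 is
  therefore translated by -s and becomes delta_0 - delta_(-s), the pair (-s, 0).\<close>

fun \<theta> :: "real \<Rightarrow> 'g label \<Rightarrow> 'g label" where
  "\<theta> t (s, l, c) = (s, l, shift t c + frag_of (0, t, - s, 0))"

definition u :: "real \<Rightarrow> ('g \<times> nat) ell2 \<Rightarrow>\<^sub>L ('g \<times> nat) ell2" where
  "u t = (SOME w. complex_linear w \<and> (\<forall>x. blinfun_apply w (e x) = e (\<theta> t x)) \<and>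
     (\<forall>f g. cinner (blinfun_apply w f) (blinfun_apply w g) = cinner f g))"

lemma complex_linear_u: "complex_linear (u t)" and u_e: "u t (e x) = e (\<theta> t x)"
  and u_isometry: "cinner (u t f) (u t g) = cinner f g"
proof -
  have gram: "cinner (e x) (e y) = cinner (e (\<theta> t x)) (e (\<theta> t y))" for x y
    by (cases x; cases y) (auto simp: cinner_e vec_add norm_vec_shift)
  from someI_ex[OF gram_extension[OF total_e gram]]
  show "complex_linear (u t)" "u t (e x) = e (\<theta> t x)"
    "cinner (u t f) (u t g) = cinner f g"
    unfolding u_def[symmetric] by blast+
qed

text \<open>Rests on 1_[t,t+t'] + 1_[0,t] = 1_[0,t+t'], an identity of vectors and not of formal
  combinations; hence the appeal to \<open>e_eqI\<close>.\<close>

lemma u_add: "u t (u t' v) = u (t + t') v"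
proof -
  have "u t o\<^sub>L u t' = u (t + t')"
  proof (rule total_family_blinfun_eqI[OF total_e])
    fix x :: "'g label"
    obtain s l c where "x = (s, l, c)" by (cases x)
    then show "(u t o\<^sub>L u t') (e x) = u (t + t') (e x)"
      by (simp add: u_e shift_shift) (rule e_eqI, simp add: vec_add add_ac)
  qed (simp_all add: complex_linear_compose complex_linear_u)
  from arg_cong[OF this, of "\<lambda>a. blinfun_apply a v"] show ?thesis by simp
qed

lemma u_zero: "u 0 v = v"
proof -
  have "u 0 = id_blinfun"
  proof (rule total_family_blinfun_eqI[OF total_e])
    fix x :: "'g label"
    obtain s l c where "x = (s, l, c)" by (cases x)
    then show "u 0 (e x) = id_blinfun (e x)"
      by (simp add: u_e shift_zero) (rule e_eqI, simp add: vec_add)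
  qed (simp_all add: complex_linear_u, simp add: complex_linear_def)
  then show ?thesis by simp
qed

lemma u_minus [simp]: "u t (u (- t) v) = v" "u (- t) (u t v) = v"
  by (simp_all add: u_add u_zero)

lemma u_adjoint: "cinner v (u t w) = cinner (u (- t) v) w"
  using u_isometry[of t "u (- t) v" w] by simp

lemma u_one: "u t (e (0, 0, 0)) = e (0, 0, 0)"
  by (simp add: u_e) (rule e_eqI, simp)

text \<open>Multiplicativity of \<open>\<theta> t\<close> up to equality of vectors. It is the
  cocycle identity (delta_(-s) - delta_(-s-r)) + (delta_0 - delta_(-s)) = delta_0 -
  delta_(-s-r).\<close>

lemma u_\<rho>: "u t (gns.\<rho> x v) = gns.\<rho> (\<theta> t x) (u t v)"
proof -
  have "u t o\<^sub>L gns.\<rho> x = gns.\<rho> (\<theta> t x) o\<^sub>L u t"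
  proof (rule total_family_blinfun_eqI[OF total_e])
    fix y :: "'g label"
    obtain s l c where "x = (s, l, c)" by (cases x)
    moreover obtain r m d where "y = (r, m, d)" by (cases y)
    ultimately show "(u t o\<^sub>L gns.\<rho> x) (e y) = (gns.\<rho> (\<theta> t x) o\<^sub>L u t) (e y)"
      by (simp add: u_e gns.\<rho>_e shift_act)
        (rule e_eqI, simp add: vec_add minus_add diff_conv_add_uminus del: add_uminus_conv_diff)
  qed (simp_all add: complex_linear_compose complex_linear_u gns.\<rho>_linear)
  from arg_cong[OF this, of "\<lambda>a. blinfun_apply a v"] show ?thesis by simp
qed

lemma \<rho>_u: "gns.\<rho> x (u t v) = u t (gns.\<rho> (\<theta> (- t) x) v)"
  using arg_cong[OF u_\<rho>[of "- t" x "u t v"], of "blinfun_apply (u t)"] by simp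

definition U :: "real \<Rightarrow> (('g \<times> nat) ell2 \<Rightarrow>\<^sub>L ('g \<times> nat) ell2) \<Rightarrow> ('g \<times> nat) ell2 \<Rightarrow>\<^sub>L ('g \<times> nat) ell2" where
  "U t x = u t o\<^sub>L x o\<^sub>L u (- t)"

text \<open>Conjugation by \<open>u t\<close> permutes the right multiplications, hence preserves
  their commutant.\<close>

lemma U_N: "x \<in> gns.N \<Longrightarrow> U t x \<in> gns.N"
  unfolding U_def gns.N_iff
  by (auto simp: complex_linear_compose complex_linear_u u_\<rho>[of "- t"] \<rho>_u[of _ t])

lemma U_add: "U (s + t) x = U s (U t x)"
  by (rule blinfun_eqI) (simp add: U_def u_add add.commute)

lemma U_zero: "U 0 x = x"
  by (rule blinfun_eqI) (simp add: U_def u_zero)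

lemma star_automorphism_U: "star_automorphism gns.N (U t)"
  unfolding star_automorphism_def star_homomorphism_def linear_on_vna_def
proof (intro conjI ballI allI)
  show "bij_betw (U t) gns.N gns.N"
  proof (rule bij_betw_byWitness[where f' = "U (- t)"])
    show "\<forall>x\<in>gns.N. U (- t) (U t x) = x" "\<forall>x\<in>gns.N. U t (U (- t) x) = x"
      using U_add[of "- t" t] U_add[of t "- t"] by (simp_all add: U_zero)
  qed (auto simp: U_N)
  show "U t \<in> gns.N \<rightarrow> gns.N" by (simp add: U_N)
  fix x assume x: "x \<in> gns.N"
  show "U t (adjoint_operator x) = adjoint_operator (U t x)"
  proof (rule adjoint_operator_eqI[symmetric])
    fix v w
    have "cinner (U t (adjoint_operator x) v) w = cinner (adjoint_operator x (u (- t) v)) (u (- t) w)"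
      using u_adjoint[of "adjoint_operator x (u (- t) v)" "- t" w] by (simp add: U_def)
    also have "\<dots> = cinner (u (- t) v) (x (u (- t) w))"
      by (rule cinner_adjoint_operator[OF gns.N_bounded[OF x]])
    also have "\<dots> = cinner v (U t x w)"
      using u_adjoint[of v t "x (u (- t) w)"] by (simp add: U_def)
    finally show "cinner (U t (adjoint_operator x) v) w = cinner v (U t x w)" .
  qed
  show "U t (scale_operator c x) = scale_operator c (U t x)" for c
    by (rule blinfun_eqI) (simp add: U_def scale_operator.rep_eq complex_linearD[OF complex_linear_u])
  fix y assume "y \<in> gns.N"
  show "U t (x + y) = U t x + U t y"
    by (rule blinfun_eqI) (simp add: U_def blinfun.add_left blinfun.add_right)
  show "U t (x o\<^sub>L y) = U t x o\<^sub>L U t y"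
    by (rule blinfun_eqI) (simp add: U_def)
qed

lemma continuous_e:
  assumes "continuous_on UNIV (\<lambda>t. vec (c t))"
  shows "continuous_on UNIV (\<lambda>t::real. e (s, l, c t))"
proof -
  have sq: "(norm (e (s, l, c t) - e (s, l, c t')))\<^sup>2 = 2 - 2 * exp (- (norm (vec (c t) - vec (c t')))\<^sup>2)" for t t'
    by (simp add: norm_diff_square inner_Re_cinner cinner_e)
  have n: "norm (e (s, l, c t) - e (s, l, c t')) = sqrt (2 - 2 * exp (- (norm (vec (c t) - vec (c t')))\<^sup>2))" for t t'
    by (rule real_sqrt_unique[OF sq norm_ge_zero, symmetric])
  have "((\<lambda>t. e (s, l, c t)) \<longlongrightarrow> e (s, l, c t')) (at t')" for t'
  proof -
    have "((\<lambda>t. vec (c t)) \<longlongrightarrow> vec (c t')) (at t')" using assms by (simp add: continuous_on_def)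
    then have "((\<lambda>t. sqrt (2 - 2 * exp (- (norm (vec (c t) - vec (c t')))\<^sup>2))) \<longlongrightarrow>
        sqrt (2 - 2 * exp (- (norm (vec (c t') - vec (c t')))\<^sup>2))) (at t')" by (intro tendsto_intros)
    then have "((\<lambda>t. norm (e (s, l, c t) - e (s, l, c t'))) \<longlongrightarrow> 0) (at t')" by (simp add: n)
    then show ?thesis by (simp add: LIM_zero_iff tendsto_norm_zero_iff)
  qed
  then show ?thesis by (simp add: continuous_on_def)
qed

lemma norm_u: "norm (u t v) = norm v"
  using u_isometry[of t v v] by (simp add: cinner_self flip: of_real_power)

lemma automorphism_group_U: "weak_star_continuous_automorphism_group gns.N U"
  unfolding weak_star_continuous_automorphism_group_def
proof (intro conjI allI ballI)
  have "continuous_on UNIV (\<lambda>t. u t (e x))" for x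
  proof -
    obtain s l c where x: "x = (s, l, c)" by (cases x)
    show ?thesis
      unfolding x u_e \<theta>.simps
      by (rule continuous_e, unfold vec_add vec_frag_of)
        (intro continuous_on_add continuous_vec_shift continuous_noise continuous_on_id continuous_on_const)
  qed
  then have cont: "continuous_on UNIV (\<lambda>t. u t v)" for v
    by (rule isometry_continuous_family[OF total_e complex_linear_u norm_u])
  fix x \<omega> assume x: "x \<in> gns.N" and "\<omega> \<in> predual gns.N"
  show "continuous_on UNIV (\<lambda>t. \<omega> (U t x))"
    unfolding U_def
    by (rule unitary_group_weak_star_continuous[OF norm_u u_adjoint cont \<open>\<omega> \<in> _\<close> U_N[OF x, unfolded U_def]])
qed (simp_all add: star_automorphism_U U_zero U_add)

lemma leaves_invariant_U: "leaves_invariant gns.N (vector_state (e (0, 0, 0))) U"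
  by (simp add: leaves_invariant_def vector_state_def U_def u_adjoint u_one)

section \<open>The conditional expectation, as compression to the block of VN(G)\<close>

definition V' :: "('g \<times> nat) ell2 \<Rightarrow>\<^sub>L 'g ell2" where
  "V' = (SOME w. complex_linear w \<and> (\<forall>v f. cinner (blinfun_apply w v) f = cinner v (W (0, 0) f)))"

lemma complex_linear_V': "complex_linear V'" and cinner_V': "cinner (V' v) f = cinner v (W (0, 0) f)"
proof -
  obtain w where "complex_linear w" "\<And>v f. cinner (blinfun_apply w v) f = cinner v (W (0, 0) f)"
    using adjoint_exists[OF complex_linear_W] by blast
  then have "\<exists>w. complex_linear w \<and> (\<forall>v f. cinner (blinfun_apply w v) f = cinner v (W (0, 0) f))"
    by blast
  from someI_ex[OF this] show "complex_linear V'" "cinner (V' v) f = cinner v (W (0, 0) f)"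
    unfolding V'_def[symmetric] by blast+
qed

lemma V'_e: "V' (e (s, 0, c)) = of_real (exp (- (norm (vec c))\<^sup>2)) *\<^sub>C basis_vector s"
proof (rule Rep_ell2_ext)
  fix r
  have "Rep_ell2 (V' (e (s, 0, c))) r = cnj (cinner (V' (e (s, 0, c))) (basis_vector r))"
    by (simp add: cinner_basis_vector flip: cinner_commute)
  also have "\<dots> = (if s = r then of_real (exp (- (norm (vec c))\<^sup>2)) else 0)"
    by (simp add: cinner_V' W_basis_vector cinner_e)
  finally show "Rep_ell2 (V' (e (s, 0, c))) r = Rep_ell2 (of_real (exp (- (norm (vec c))\<^sup>2)) *\<^sub>C basis_vector s) r"
    by (simp add: scaleC_ell2.rep_eq basis_vector.rep_eq)
qed

definition expectation :: "(('g \<times> nat) ell2 \<Rightarrow>\<^sub>L ('g \<times> nat) ell2) \<Rightarrow> 'g ell2 \<Rightarrow>\<^sub>L 'g ell2" where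
  "expectation y = V' o\<^sub>L y o\<^sub>L W (0, 0)"

text \<open>\<open>W (0, 0)\<close> intertwines right translation by s with right multiplication by
  (s, 0, 0), and so does its adjoint \<open>V'\<close> in the other direction.\<close>

lemma expectation_N:
  assumes y: "y \<in> gns.N"
  shows "expectation y \<in> vn.N"
proof -
  have V'\<rho>: "V' (gns.\<rho> (s, 0, 0) v) = vn.\<rho> s (V' v)" for s v
  proof (rule cinner_ext_left)
    fix f
    have "cinner (V' (gns.\<rho> (s, 0, 0) v)) f = cinner (gns.\<rho> (inv (- s, 0, 0)) v) (W (0, 0) f)"
      by (simp add: cinner_V')
    also have "\<dots> = cinner v (gns.\<rho> (- s, 0, 0) (W (0, 0) f))" by (rule gns.\<rho>_adjoint)
    also have "\<dots> = cinner (V' v) (vn.\<rho> (- s) f)" by (simp add: \<rho>_W cinner_V')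
    also have "\<dots> = cinner (vn.\<rho> s (V' v)) f" using vn.\<rho>_adjoint[of "- s"] by simp
    finally show "cinner (V' (gns.\<rho> (s, 0, 0) v)) f = cinner (vn.\<rho> s (V' v)) f" .
  qed
  have W\<rho>: "W (0, 0) (vn.\<rho> s f) = gns.\<rho> (s, 0, 0) (W (0, 0) f)" for s f by (simp add: \<rho>_W)
  have y\<rho>: "complex_linear y" "y (gns.\<rho> x v) = gns.\<rho> x (y v)" for x v
    using y by (simp_all only: gns.N_iff)
  show ?thesis
    by (simp add: y\<rho> vn.N_iff expectation_def complex_linear_compose complex_linear_V'
        complex_linear_W W\<rho> V'\<rho>)
qed

lemma expectation_adjoint: "is_markov_adjoint group_vna group_trace gns.N (vector_state (e (0, 0, 0))) amplify expectation"
  unfolding is_markov_adjoint_def linear_on_vna_def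
proof (intro conjI ballI allI)
  show "expectation \<in> gns.N \<rightarrow> group_vna" by (simp add: group_vna_eq expectation_N)
  fix y assume "y \<in> gns.N"
  show "expectation (scale_operator c y) = scale_operator c (expectation y)" for c
    by (rule blinfun_eqI) (simp add: expectation_def scale_operator.rep_eq complex_linearD[OF complex_linear_V'])
  fix z show "expectation (y + z) = expectation y + expectation z"
    by (rule blinfun_eqI) (simp add: expectation_def blinfun.add_left blinfun.add_right)
next
  fix x y assume x: "x \<in> (group_vna :: ('g ell2 \<Rightarrow>\<^sub>L 'g ell2) set)"
  have V: "cinner f (V' v) = cinner (W (0, 0) f) v" for f v
    by (metis cinner_commute cinner_V')
  show "group_trace (expectation y o\<^sub>L x) = vector_state (e (0, 0, 0)) (y o\<^sub>L amplify x)"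
    unfolding group_trace_eq vector_state_def W_basis_vector[symmetric] using x
    by (simp add: group_vna_eq expectation_def V amplify_W vn.N_iff)
qed

text \<open>The unitaries move onto the two vectors. The cyclic vector is fixed, the other acquires
  the increment over the interval between 0 and -t, and the compression turns that increment into
  its Gaussian value.\<close>

lemma coefficient_expectation:
  assumes x: "x \<in> group_vna"
  shows "coefficient (expectation (U t (amplify x))) s = exp (- \<bar>t\<bar> * \<psi> s) * coefficient x s"
proof -
  have V: "cinner f (V' v) = cinner (W (0, 0) f) v" for f v
    by (metis cinner_commute cinner_V')
  have lin: "complex_linear x" using x by (simp add: group_vna_eq vn.N_iff)
  have "coefficient (expectation (U t (amplify x))) s
      = cinner (u (- t) (e (s, 0, 0))) (amplify x (u (- t) (e (0, 0, 0))))"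
    by (simp add: coefficient_def expectation_def V U_def W_basis_vector u_adjoint)
  also have "\<dots> = cinner (e (s, 0, frag_of (0, - t, - s, 0))) (W (0, 0) (x (basis_vector 0)))"
    unfolding u_one by (simp add: u_e amplify_W[OF lin] flip: W_basis_vector[of "(0, 0)" 0])
  also have "\<dots> = exp (- (norm (noise (0, - t, - s, 0)))\<^sup>2) * coefficient x s"
    by (simp add: V'_e cinner_scaleC_left coefficient_def del: noise.simps flip: cinner_V')
  finally show ?thesis by (simp only: norm_noise abs_minus_cancel psi_minus mult_minus_left)
qed

end

theorem corollary6p1:
  fixes T :: "real \<Rightarrow> ('g::group_add ell2 \<Rightarrow>\<^sub>L 'g ell2) \<Rightarrow> ('g ell2 \<Rightarrow>\<^sub>L 'g ell2)"
  assumes "weak_star_continuous_semigroup group_vna T"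
    and "\<And>t. t \<ge> 0 \<Longrightarrow> fourier_multiplier (T t)"
    and "\<And>t. t \<ge> 0 \<Longrightarrow> selfadjoint_markov_map group_vna group_trace (T t)"
  shows "dilatable TYPE(('g \<times> nat) ell2) group_vna group_trace T"
proof -
  have mult: "multiplier (T t)" if "t \<ge> 0" for t
    using assms(2,3) that by (simp add: multiplier_def)
  obtain \<psi> :: "'g \<Rightarrow> real" where \<psi>: "\<psi> 0 = 0" "\<And>s. \<psi> (- s) = \<psi> s"
    "psd_kernel (\<lambda>s r. (\<psi> s + \<psi> r - \<psi> (- s + r)) / 2)"
    and T: "\<forall>t\<ge>0. \<forall>x\<in>group_vna. \<forall>s. coefficient (T t x) s = exp (- t * \<psi> s) * coefficient x s"
    using multiplier_semigroup_symbol[OF assms(1) mult] by blast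
  interpret cocycle_noise \<psi> by unfold_locales (fact \<psi>)+
  obtain E :: "('g \<times> int) \<times> ('g generator \<Rightarrow>\<^sub>0 int) \<Rightarrow> ('g \<times> nat) ell2" where E: "total_family E"
    "\<And>l c l' c'. cinner (E (l, c)) (E (l', c'))
      = (if l = l' then of_real (exp (- (norm (vec c - vec c'))\<^sup>2)) else 0)"
    using gaussian_vectors by auto
  \<comment> \<open>The factor \<open>nat\<close> makes G x N infinite for every G, so one more
    factor G does not change its cardinality.\<close>
  have "(UNIV :: ('g \<times> 'g \<times> nat) set) \<approx> (UNIV :: ('g \<times> nat) set)"
  proof (rule lepoll_antisym)
    have g: "(UNIV :: 'g set) \<lesssim> (UNIV :: ('g \<times> nat) set)"
      unfolding lepoll_def by (rule exI[of _ "\<lambda>g. (g, 0)"]) (auto simp: inj_on_def)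
    show "(UNIV :: ('g \<times> 'g \<times> nat) set) \<lesssim> (UNIV :: ('g \<times> nat) set)"
      using infinite_times_lepoll[OF _ g lepoll_refl] by (simp add: finite_prod)
    show "(UNIV :: ('g \<times> nat) set) \<lesssim> (UNIV :: ('g \<times> 'g \<times> nat) set)"
      unfolding lepoll_def by (rule exI[of _ "\<lambda>x. (0, x)"]) (auto simp: inj_on_def)
  qed
  then obtain \<gamma> :: "'g \<times> 'g \<times> nat \<Rightarrow> 'g \<times> nat" where \<gamma>: "bij \<gamma>"
    by (auto simp: eqpoll_def)
  interpret noise_dilation \<psi> \<gamma> E by unfold_locales (fact \<gamma> E)+
  have "T t x = expectation (U t (amplify x))" if t: "t \<ge> 0" and x: "x \<in> group_vna" for t x
  proof (rule coefficient_eqI)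
    have "T t \<in> group_vna \<rightarrow> group_vna"
      using assms(1) t by (simp add: weak_star_continuous_semigroup_def)
    then show "T t x \<in> group_vna" using x by (rule funcset_mem)
    show "expectation (U t (amplify x)) \<in> group_vna"
      using x by (simp add: group_vna_eq expectation_N U_N amplify_N)
    show "coefficient (T t x) s = coefficient (expectation (U t (amplify x))) s" for s
      using t by (simp add: T x coefficient_expectation)
  qed
  then show ?thesis
    unfolding dilatable_def
    by (intro exI[of _ gns.N] exI[of _ "vector_state (e (0, 0, 0))"] exI[of _ U] exI[of _ amplify]
        exI[of _ expectation] conjI gns.von_neumann_algebra_N gns.normal_faithful_state_N
        automorphism_group_U leaves_invariant_U markov_map_J star_homomorphism_J inj_amplify
        expectation_adjoint) simp
qed

end
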